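(* Assume GCH. Then $\mathrm{HC}(\kappa)$ holds for every cardinal $\kappa$ with $\mathrm{cf}(\kappa) \notin \{\mu^+ : \mathrm{cf}(\mu) = \omega\}$.
   Context: A ray is a one-way infinite path. Two rays in a graph $G$ are equivalent if there are infinitely many pairwise vertex-disjoint paths between them in $G$; an end of $G$ is an equivalence class of rays. The degree of an end $\varepsilon$ is the maximum cardinality of a set of pairwise disjoint rays in $\varepsilon$. Given a set $\mathcal{R}$ of pairwise disjoint equivalent rays in $G$, an $\mathcal{R}$-path is a path meeting $\bigcup\mathcal{R}$ exactly in its two endvertices; a set of paths is independent if no inner vertex of one of them lies on another. A graph $H$ with vertex set $\mathcal{R}$ is a ray graph in $G$ if there is a set $\mathcal{P}$ of independent $\mathcal{R}$-paths in $G$ such that for each edge $RS$ of $H$ there are infinitely many disjoint $R$--$S$ paths in $\mathcal{P}$. $\mathrm{HC}(\kappa)$ is the statement: for every graph $G$ and every end $\varepsilon$ of $G$ of degree $\kappa$, there is a set $\mathcal{R}\subseteq\varepsilon$ of $\kappa$ pairwise disjoint rays admitting a connected ray graph in $G$ with vertex set $\mathcal{R}$. *)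

theory Defs
  imports Main
begin

section \<open>Graphs\<close>

text \<open>A graph is given by a vertex set V and an adjacency relation E
  (symmetric, irreflexive, between vertices of V). Graphs may be infinite.\<close>

definition graph :: "'v set \<Rightarrow> ('v \<Rightarrow> 'v \<Rightarrow> bool) \<Rightarrow> bool" where
  "graph V E \<longleftrightarrow> (\<forall>x y. E x y \<longrightarrow> x \<in> V \<and> y \<in> V \<and> x \<noteq> y \<and> E y x)"

text \<open>A finite path is a nonempty list of distinct vertices, consecutive ones adjacent.\<close>

definition is_path :: "'v set \<Rightarrow> ('v \<Rightarrow> 'v \<Rightarrow> bool) \<Rightarrow> 'v list \<Rightarrow> bool" where
  "is_path V E p \<longleftrightarrow> p \<noteq> [] \<and> distinct p \<and> set p \<subseteq> V \<and>
     (\<forall>i. Suc i < length p \<longrightarrow> E (p ! i) (p ! Suc i))"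

text \<open>A ray (one-way infinite path) is an injective sequence of vertices,
  consecutive ones adjacent.\<close>

definition is_ray :: "'v set \<Rightarrow> ('v \<Rightarrow> 'v \<Rightarrow> bool) \<Rightarrow> (nat \<Rightarrow> 'v) \<Rightarrow> bool" where
  "is_ray V E R \<longleftrightarrow> inj R \<and> range R \<subseteq> V \<and> (\<forall>i. E (R i) (R (Suc i)))"

text \<open>A path between vertex sets A and B: it starts in A and ends in B
  (either orientation, since the graph is undirected).\<close>

definition path_between :: "'v set \<Rightarrow> 'v set \<Rightarrow> 'v list \<Rightarrow> bool" where
  "path_between A B p \<longleftrightarrow> (hd p \<in> A \<and> last p \<in> B) \<or> (hd p \<in> B \<and> last p \<in> A)"

definition pairwise_vdisjoint_paths :: "'v list set \<Rightarrow> bool" where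
  "pairwise_vdisjoint_paths P \<longleftrightarrow> (\<forall>p\<in>P. \<forall>q\<in>P. p \<noteq> q \<longrightarrow> set p \<inter> set q = {})"

text \<open>Two rays are equivalent if there are infinitely many pairwise vertex-disjoint
  paths between them.\<close>

definition equiv_rays :: "'v set \<Rightarrow> ('v \<Rightarrow> 'v \<Rightarrow> bool) \<Rightarrow> (nat \<Rightarrow> 'v) \<Rightarrow> (nat \<Rightarrow> 'v) \<Rightarrow> bool" where
  "equiv_rays V E R S \<longleftrightarrow> (\<exists>P. infinite P \<and> pairwise_vdisjoint_paths P \<and>
      (\<forall>p\<in>P. is_path V E p \<and> path_between (range R) (range S) p))"

text \<open>An end is an equivalence class of rays.\<close>

definition is_end :: "'v set \<Rightarrow> ('v \<Rightarrow> 'v \<Rightarrow> bool) \<Rightarrow> (nat \<Rightarrow> 'v) set \<Rightarrow> bool" where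
  "is_end V E \<epsilon> \<longleftrightarrow> (\<exists>R. is_ray V E R \<and> \<epsilon> = {S. is_ray V E S \<and> equiv_rays V E R S})"

definition disjoint_rays :: "(nat \<Rightarrow> 'v) set \<Rightarrow> bool" where
  "disjoint_rays \<R> \<longleftrightarrow> (\<forall>R\<in>\<R>. \<forall>S\<in>\<R>. R \<noteq> S \<longrightarrow> range R \<inter> range S = {})"

text \<open>The degree of an end is the maximum cardinality of a set of pairwise disjoint
  rays in it: \<R>0 witnesses the degree of \<epsilon> if it is such a set of maximum
  cardinality; the degree is then the cardinal of \<R>0.\<close>

definition end_degree_witness :: "(nat \<Rightarrow> 'v) set \<Rightarrow> (nat \<Rightarrow> 'v) set \<Rightarrow> bool" where
  "end_degree_witness \<epsilon> \<R>0 \<longleftrightarrow> \<R>0 \<subseteq> \<epsilon> \<and> disjoint_rays \<R>0 \<and>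
     (\<forall>\<S>. \<S> \<subseteq> \<epsilon> \<and> disjoint_rays \<S> \<longrightarrow> (card_of \<S>, card_of \<R>0) \<in> ordLeq)"

text \<open>\<R>-paths and independence.\<close>

definition inner_vertices :: "'v list \<Rightarrow> 'v set" where
  "inner_vertices p = set (butlast (tl p))"

definition is_R_path :: "'v set \<Rightarrow> ('v \<Rightarrow> 'v \<Rightarrow> bool) \<Rightarrow> (nat \<Rightarrow> 'v) set \<Rightarrow> 'v list \<Rightarrow> bool" where
  "is_R_path V E \<R> p \<longleftrightarrow> is_path V E p \<and> hd p \<noteq> last p \<and>
     set p \<inter> (\<Union>R\<in>\<R>. range R) = {hd p, last p}"

definition independent_paths :: "'v list set \<Rightarrow> bool" where
  "independent_paths P \<longleftrightarrow> (\<forall>p\<in>P. \<forall>q\<in>P. p \<noteq> q \<longrightarrow> inner_vertices p \<inter> set q = {})"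

text \<open>A graph H on vertex set \<R> (edge relation F \<subseteq> \<R> \<times> \<R>, symmetric, irreflexive)
  is a ray graph in G.\<close>

definition is_ray_graph :: "'v set \<Rightarrow> ('v \<Rightarrow> 'v \<Rightarrow> bool) \<Rightarrow> (nat \<Rightarrow> 'v) set
    \<Rightarrow> ((nat \<Rightarrow> 'v) \<times> (nat \<Rightarrow> 'v)) set \<Rightarrow> bool" where
  "is_ray_graph V E \<R> F \<longleftrightarrow> F \<subseteq> \<R> \<times> \<R> \<and> sym F \<and> irrefl F \<and>
     (\<exists>\<P>. (\<forall>p\<in>\<P>. is_R_path V E \<R> p) \<and> independent_paths \<P> \<and>
        (\<forall>(R, S)\<in>F. \<exists>Q\<subseteq>\<P>. infinite Q \<and> pairwise_vdisjoint_paths Q \<and>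
           (\<forall>p\<in>Q. path_between (range R) (range S) p)))"

definition connected_on :: "'a set \<Rightarrow> ('a \<times> 'a) set \<Rightarrow> bool" where
  "connected_on A F \<longleftrightarrow> (\<forall>x\<in>A. \<forall>y\<in>A. (x, y) \<in> F\<^sup>*)"

definition admits_connected_ray_graph :: "'v set \<Rightarrow> ('v \<Rightarrow> 'v \<Rightarrow> bool) \<Rightarrow> (nat \<Rightarrow> 'v) set \<Rightarrow> bool" where
  "admits_connected_ray_graph V E \<R> \<longleftrightarrow> (\<exists>F. is_ray_graph V E \<R> F \<and> connected_on \<R> F)"

section \<open>Cardinal arithmetic\<close>

text \<open>Cofinality: c is (isomorphic to) the cofinality of the well-order r if it is the
  least cardinality of a cofinal subset of the field of r.\<close>

definition cofinal_set :: "'a rel \<Rightarrow> 'a set \<Rightarrow> bool" where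
  "cofinal_set r A \<longleftrightarrow> A \<subseteq> Field r \<and> (\<forall>a\<in>Field r. \<exists>b\<in>A. (a, b) \<in> r)"

definition has_cf :: "'a rel \<Rightarrow> 'b rel \<Rightarrow> bool" where
  "has_cf r c \<longleftrightarrow> (\<exists>A. cofinal_set r A \<and> (card_of A, c) \<in> ordIso) \<and>
     (\<forall>A. cofinal_set r A \<longrightarrow> (c, card_of A) \<in> ordLeq)"

text \<open>GCH, for all infinite sets of elements of type 'a: no cardinal strictly between
  |A| and |Pow A|.\<close>

definition GCH_type :: "'a itself \<Rightarrow> bool" where
  "GCH_type _ \<longleftrightarrow> (\<forall>(A::'a set) (B::'a set). infinite A \<longrightarrow>
      \<not> ((card_of A, card_of B) \<in> ordLess \<and> (card_of B, card_of (Pow A)) \<in> ordLess))"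

end

theory Submission
  imports Defs "HOL-Library.Countable_Set_Type" "HOL-Library.Ramsey"
begin

text \<open>
  Call a ray \<open>R\<close> with infinitely many disjoint paths ending in a vertex set \<open>A\<close> a comb over \<open>A\<close>.
  If \<open>\<kappa>\<close> is regular and uncountable and every set of fewer than \<open>\<kappa>\<close> vertices has fewer than \<open>\<kappa>\<close>
  countable subsets, then among \<open>\<kappa>\<close> disjoint equivalent rays there are \<open>\<kappa>\<close> that are the spines of
  combs with the same countable set of teeth \<open>A\<close>, disjoint outside \<open>A\<close>: otherwise a maximal such family
  over each countable \<open>A\<close> has fewer than \<open>\<kappa>\<close> members, closing a ray under these families in
  \<open>\<omega>\<^sub>1\<close> steps gives a set of fewer than \<open>\<kappa>\<close> vertices, and a ray of the end avoiding this set
  contradicts maximality. A ray threaded through infinitely many vertices of \<open>A\<close> is the centre of a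
  star of rays. Under GCH the assumption on countable subsets fails only at successors of cardinals
  of cofinality \<open>\<omega>\<close>.

  A singular \<open>\<kappa>\<close> is a sum of \<open>cf \<kappa>\<close> increasing regular cardinals to each of which this applies. If
  \<open>cf \<kappa> = \<omega>\<close>, one centre can be threaded through all the tooth sets. If \<open>cf \<kappa> > \<omega>\<close>, then either
  \<open>cf \<kappa>\<close> many tooth sets have a common infinite subset, which gives a star, or they can be made
  disjoint; then each yields the centre of a star of its own, and the regular case for \<open>cf \<kappa>\<close> joins
  these centres to a tree of rays.

  For \<open>\<kappa> = \<aleph>\<^sub>0\<close> one finds disjoint finite connected sets \<open>H\<^sub>k\<close>, each meeting the first \<open>k\<close> rays, and applies
  Ramsey's theorem to the way in which geodesics between rays inside \<open>H\<^sub>k\<close> pass through other rays.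
\<close>

unbundle cardinal_syntax

section \<open>Connectivity, paths and ends\<close>

text \<open>The closure takes omega_1 steps because the teeth of a comb over the closed set are
  countably many, and they must all be present at one stage for the maximal family over them to be
  absorbed later. That \<kappa> exceeds omega_1 is itself an instance of the assumption on countable
  subsets, applied to the vertices of one ray. GCH serves only to count countable subsets. If
  \<lambda> < \<kappa> and the power set of \<lambda> has size at least \<kappa>, then \<kappa> is
  the successor of \<lambda>; unless cf \<lambda> = \<omega>, countable subsets of \<lambda> are
  bounded, and there are only \<lambda> bounded subsets. For singular \<kappa> the summands can be
  chosen as double successors, which are never exceptional. The count is still needed at cf
  \<kappa>, once for the traces of the tooth sets on a small set and once for joining the centres;
  hence a hypothesis on cf \<kappa> alone. A ray has countably many vertices and cannot meet
  uncountably many disjoint tooth sets, so a star no longer suffices there and the ray graph becomes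
  a tree of depth two.\<close>

lemma is_path_iff_successively:
  "is_path V E p \<longleftrightarrow> p \<noteq> [] \<and> distinct p \<and> set p \<subseteq> V \<and> successively E p"
  unfolding is_path_def successively_conv_nth by blast

lemma is_path_mono: "is_path W E p \<Longrightarrow> W \<subseteq> W' \<Longrightarrow> is_path W' E p"
  unfolding is_path_def by blast

text \<open>The conjunct \<open>x \<in> W\<close> excludes the reflexive pairs outside
  \<open>W\<close>, which the closure alone would contain.\<close>

definition conn :: "('v \<Rightarrow> 'v \<Rightarrow> bool) \<Rightarrow> 'v set \<Rightarrow> 'v \<Rightarrow> 'v \<Rightarrow> bool" where
  "conn E W x y \<longleftrightarrow> x \<in> W \<and> (\<lambda>a b. E a b \<and> a \<in> W \<and> b \<in> W)\<^sup>*\<^sup>* x y"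

lemma conn_refl: "x \<in> W \<Longrightarrow> conn E W x x"
  by (simp add: conn_def)

lemma conn_trans: "conn E W x y \<Longrightarrow> conn E W y z \<Longrightarrow> conn E W x z"
  unfolding conn_def by auto

lemma conn_mono: assumes "conn E W x y" "W \<subseteq> W'" shows "conn E W' x y"
proof -
  have "(\<lambda>a b. E a b \<and> a \<in> W \<and> b \<in> W)\<^sup>*\<^sup>* x y" using assms unfolding conn_def by blast
  hence "(\<lambda>a b. E a b \<and> a \<in> W' \<and> b \<in> W')\<^sup>*\<^sup>* x y"
    by (rule rtranclp_mono[THEN predicate2D, rotated]) (use assms(2) in blast)
  thus ?thesis using assms unfolding conn_def by blast
qed

lemma conn_edge: "E x y \<Longrightarrow> x \<in> W \<Longrightarrow> y \<in> W \<Longrightarrow> conn E W x y"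
  unfolding conn_def by auto

lemma conn_mem: assumes "conn E W x y" shows "x \<in> W" "y \<in> W"
proof -
  show "x \<in> W" using assms by (simp add: conn_def)
  have "(\<lambda>a b. E a b \<and> a \<in> W \<and> b \<in> W)\<^sup>*\<^sup>* x y" using assms unfolding conn_def by blast
  thus "y \<in> W" using \<open>x \<in> W\<close> by (induction) auto
qed

lemma conn_path:
  assumes "conn E W x y" shows "\<exists>p. is_path W E p \<and> hd p = x \<and> last p = y"
proof -
  have x: "x \<in> W" using assms by (simp add: conn_def)
  have "(\<lambda>a b. E a b \<and> a \<in> W \<and> b \<in> W)\<^sup>*\<^sup>* x y" using assms unfolding conn_def by blast
  thus ?thesis
  proof induction
    case base
    show ?case using x by (intro exI[of _ "[x]"]) (simp add: is_path_iff_successively)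
  next
    case (step y z)
    then obtain p where p: "is_path W E p" "hd p = x" "last p = y" by blast
    show ?case
    \<comment> \<open>If the walk returns to a vertex of the path found so far, the path is cut off
      at that vertex.\<close>
    proof (cases "z \<in> set p")
      case True
      then obtain us vs where uv: "p = us @ z # vs" by (auto dest: split_list)
      have "is_path W E (us @ [z])"
        using p(1) unfolding uv is_path_iff_successively by (auto simp: successively_append_iff)
      moreover have "hd (us @ [z]) = x" using p(2) uv by (cases us) auto
      ultimately show ?thesis by (intro exI[of _ "us @ [z]"]) simp
    next
      case False
      have "is_path W E (p @ [z])"
        using p False step(2) unfolding is_path_iff_successively by (auto simp: successively_append_iff)
      moreover have "hd (p @ [z]) = x" using p by (auto simp: is_path_def)
      ultimately show ?thesis by (intro exI[of _ "p @ [z]"]) simp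
    qed
  qed
qed

lemma conn_ray_le:
  assumes "is_ray V E R" "i \<le> j" "R ` {i..j} \<subseteq> W" shows "conn E W (R i) (R j)"
  using assms(2,3)
proof (induction j rule: dec_induct)
  case base
  then show ?case by (intro conn_refl) auto
next
  case (step n)
  have "R ` {i..n} \<subseteq> W" using step.prems by (force simp: image_subset_iff)
  hence "conn E W (R i) (R n)" by (rule step.IH)
  moreover have "conn E W (R n) (R (Suc n))"
    using assms(1) step by (intro conn_edge) (auto simp: is_ray_def)
  ultimately show ?case by (rule conn_trans)
qed

text \<open>The lists chosen before step \<open>n\<close> cover a finite set, so avoidability of
  finite sets is all that is needed. The index in \<open>P\<close> lets the requirement change from
  step to step.\<close>

lemma greedy_disjoint:
  assumes "\<And>n X. finite X \<Longrightarrow> \<exists>p. P n p \<and> set p \<inter> X = {}"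
  shows "\<exists>f :: nat \<Rightarrow> 'a list. \<forall>n. P n (f n) \<and> (\<forall>m<n. set (f m) \<inter> set (f n) = {})"
proof -
  define Q where "Q f n p \<longleftrightarrow> P n p \<and> (\<forall>m<n. set (f m) \<inter> set p = {})" for f n p
  have "\<exists>f. \<forall>n. Q f n (f n)"
  proof (rule dependent_wf_choice)
    show "wf less_than" by simp
    show "Q f x r = Q g x r" if "\<And>z. (z, x) \<in> less_than \<Longrightarrow> f z = g z" for f g x r
      using that by (auto simp: Q_def)
    show "\<exists>r. Q f x r" for x f
      using assms[of "\<Union>m<x. set (f m)" x] by (auto simp: Q_def)
  qed
  thus ?thesis by (simp add: Q_def)
qed

locale ugraph =
  fixes V :: "'v set" and E :: "'v \<Rightarrow> 'v \<Rightarrow> bool"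
  assumes G: "graph V E"
begin

lemma E_sym: "E x y \<Longrightarrow> E y x"
  using G unfolding graph_def by blast

lemma conn_sym: assumes "conn E W x y" shows "conn E W y x"
proof -
  let ?r = "\<lambda>a b. E a b \<and> a \<in> W \<and> b \<in> W"
  have "symp ?r" by (auto intro!: sympI dest: E_sym)
  moreover have "?r\<^sup>*\<^sup>* x y" using assms by (simp add: conn_def)
  ultimately have "?r\<^sup>*\<^sup>* y x" by (meson symp_rtranclp sympD)
  thus ?thesis using conn_mem[OF assms] by (simp add: conn_def)
qed

lemma conn_ray:
  assumes "is_ray V E R" "R ` {min i j..max i j} \<subseteq> W" shows "conn E W (R i) (R j)"
  using assms conn_ray_le[of V E R i j W] conn_sym[OF conn_ray_le[of V E R j i W]]
  by (cases "i \<le> j") (auto simp: min_def max_def)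

lemma conn_ray_range:
  assumes "is_ray V E R" "range R \<subseteq> W" shows "conn E W (R i) (R j)"
  by (rule conn_ray) (use assms in auto)

lemma path_conn_hd:
  assumes "is_path W' E p" "x \<in> set p" "set p \<subseteq> W" shows "conn E W (hd p) x"
proof -
  have "\<exists>i<length p. x = p ! i" using assms(2) by (metis in_set_conv_nth)
  then obtain i where i: "i < length p" "x = p ! i" by blast
  have "conn E W (hd p) (p ! i)" using i(1)
  proof (induction i)
    case 0
    then show ?case using assms(3) by (intro conn_refl[of _ W E, THEN back_subst[of "conn E W (hd p)"]])
       (auto simp: hd_conv_nth)
  next
    case (Suc i)
    have "conn E W (p ! i) (p ! Suc i)"
      using Suc assms by (intro conn_edge) (auto simp: is_path_def)
    with Suc show ?case using conn_trans by (metis Suc_lessD)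
  qed
  thus ?thesis using i by simp
qed

lemma path_conn:
  assumes "is_path W' E p" "x \<in> set p" "y \<in> set p" "set p \<subseteq> W" shows "conn E W x y"
  using path_conn_hd[OF assms(1,2,4)] path_conn_hd[OF assms(1,3,4)] conn_sym conn_trans by meson

text \<open>Among all paths in \<open>W\<close> from \<open>A\<close> to \<open>B\<close> take a
  shortest one: a further vertex in \<open>A\<close> or in \<open>B\<close> would allow it to be
  shortened at that vertex. If \<open>A\<close> and \<open>B\<close> intersect, the path may be a
  single vertex.\<close>

lemma shortest_path_between:
  assumes "conn E W a b" "a \<in> A" "b \<in> B"
  shows "\<exists>p. is_path W E p \<and> hd p \<in> A \<and> last p \<in> B \<and> set p \<inter> A = {hd p} \<and> set p \<inter> B = {last p}"
proof -
  define S where "S p \<longleftrightarrow> is_path W E p \<and> hd p \<in> A \<and> last p \<in> B" for p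
  have "\<exists>p. S p" using conn_path[OF assms(1)] assms(2,3) unfolding S_def by blast
  then obtain p where p: "S p" "\<And>q. S q \<Longrightarrow> length p \<le> length q"
    using exists_least_lemma[of "\<lambda>n. \<exists>p. S p \<and> length p = n"] by (metis not_le ex_has_least_nat)
  have ne: "p \<noteq> []" using p by (simp add: S_def is_path_def)
  have "x = hd p" if x: "x \<in> set p" "x \<in> A" for x
  proof (rule ccontr)
    assume "x \<noteq> hd p"
    obtain us vs where uv: "p = us @ x # vs" using x by (auto dest: split_list)
    have "us \<noteq> []" using \<open>x \<noteq> hd p\<close> uv by auto
    have "S (x # vs)" using p(1) x uv unfolding S_def is_path_iff_successively
      by (auto simp: successively_append_iff)
    from p(2)[OF this] show False using uv \<open>us \<noteq> []\<close> by simp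
  qed
  moreover have "x = last p" if x: "x \<in> set p" "x \<in> B" for x
  proof (rule ccontr)
    assume "x \<noteq> last p"
    obtain us vs where uv: "p = us @ x # vs" using x by (auto dest: split_list)
    have "vs \<noteq> []" using \<open>x \<noteq> last p\<close> uv by auto
    have "hd (us @ [x]) = hd p" using uv by (cases us) auto
    hence "S (us @ [x])" using p(1) x uv unfolding S_def is_path_iff_successively
      by (auto simp: successively_append_iff)
    from p(2)[OF this] show False using uv \<open>vs \<noteq> []\<close> by simp
  qed
  ultimately show ?thesis using p(1) ne unfolding S_def by (intro exI[of _ p]) auto
qed

lemma disjoint_paths_avoid:
  assumes "infinite P" "pairwise_vdisjoint_paths P" "finite X"
  shows "\<exists>p\<in>P. set p \<inter> X = {}"
proof (rule ccontr)
  assume "\<not> ?thesis"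
  hence "\<forall>p\<in>P. \<exists>x. x \<in> set p \<inter> X" by blast
  then obtain f where f: "\<And>p. p \<in> P \<Longrightarrow> f p \<in> set p \<inter> X" by metis
  have "inj_on f P" using f assms(2) unfolding pairwise_vdisjoint_paths_def
    by (intro inj_onI) (metis Int_iff disjoint_iff)
  moreover have "f ` P \<subseteq> X" using f by blast
  ultimately show False using assms by (meson finite_imageD finite_subset)
qed

lemma greedy_disjoint_set:
  assumes "\<And>X. finite X \<Longrightarrow> \<exists>p. P p \<and> p \<noteq> [] \<and> set p \<inter> X = {}"
  shows "\<exists>Q. infinite Q \<and> pairwise_vdisjoint_paths Q \<and> (\<forall>p\<in>Q. P p)"
proof -
  obtain f :: "nat \<Rightarrow> 'a list" where f: "\<And>n. P (f n)" "\<And>n. f n \<noteq> []" "\<And>m n. m < n \<Longrightarrow> set (f m) \<inter> set (f n) = {}"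
  proof -
    have "\<exists>f :: nat \<Rightarrow> 'a list. \<forall>n. (P (f n) \<and> f n \<noteq> []) \<and> (\<forall>m<n. set (f m) \<inter> set (f n) = {})"
      by (rule greedy_disjoint[of "\<lambda>_ p. P p \<and> p \<noteq> []"]) (use assms in auto)
    thus ?thesis using that by blast
  qed
  have d: "set (f m) \<inter> set (f n) = {}" if "m \<noteq> n" for m n
    using f(3)[of m n] f(3)[of n m] that by (metis Int_commute nat_neq_iff)
  have "inj f"
  proof (rule injI, rule ccontr)
    fix m n assume "f m = f n" "m \<noteq> n"
    with d[of m n] f(2)[of n] show False by auto
  qed
  hence "infinite (range f)" by (simp add: range_inj_infinite)
  moreover have "pairwise_vdisjoint_paths (range f)"
    unfolding pairwise_vdisjoint_paths_def
  proof (intro ballI impI)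
    fix p q assume "p \<in> range f" "q \<in> range f" "p \<noteq> q"
    then obtain m n where "p = f m" "q = f n" "m \<noteq> n" by auto
    thus "set p \<inter> set q = {}" using d by simp
  qed
  ultimately show ?thesis using f(1) by (intro exI[of _ "range f"]) auto
qed

section \<open>Equivalence of rays through finite separators, and membership in an end\<close>

lemma equiv_raysI:
  assumes "\<And>X. finite X \<Longrightarrow> \<exists>i j. conn E (V - X) (R i) (S j)"
  shows "equiv_rays V E R S"
proof -
  have "\<exists>p. (is_path V E p \<and> path_between (range R) (range S) p) \<and> p \<noteq> [] \<and> set p \<inter> X = {}" if X: "finite X" for X
  proof -
    obtain i j where "conn E (V - X) (R i) (S j)" using assms[OF X] by blast
    then obtain p where p: "is_path (V - X) E p" "hd p = R i" "last p = S j" by (metis conn_path)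
    thus ?thesis by (intro exI[of _ p]) (auto simp: is_path_def path_between_def)
  qed
  thus ?thesis using greedy_disjoint_set[of "\<lambda>p. is_path V E p \<and> path_between (range R) (range S) p"]
    unfolding equiv_rays_def by blast
qed

text \<open>No finite set separates tails of the two rays. For the rays of the graph this agrees
  with the definition by disjoint paths, but it is directly transitive, whereas path systems for two
  pairs of rays cannot simply be concatenated.\<close>

definition eqv :: "(nat \<Rightarrow> 'v) \<Rightarrow> (nat \<Rightarrow> 'v) \<Rightarrow> bool" where
  "eqv R S \<longleftrightarrow> (\<forall>X. finite X \<longrightarrow> (\<exists>N. \<forall>i\<ge>N. \<forall>j\<ge>N. conn E (V - X) (R i) (S j)))"

lemma ray_tail_avoids:
  assumes "is_ray V E R" "finite X" shows "\<exists>N. \<forall>i\<ge>N. R i \<notin> X"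
proof -
  have "finite (R -` X)" using assms by (intro finite_vimageI) (auto simp: is_ray_def)
  then obtain N where "R -` X \<subseteq> {..<N}" using finite_nat_iff_bounded by blast
  thus ?thesis by (intro exI[of _ N]) force
qed

lemma ray_in_V: "is_ray V E R \<Longrightarrow> R i \<in> V"
  by (auto simp: is_ray_def)

lemma ray_tail_conn:
  assumes "is_ray V E R" "\<forall>i\<ge>N. R i \<notin> X" "i \<ge> N" "j \<ge> N" shows "conn E (V - X) (R i) (R j)"
  by (rule conn_ray[OF assms(1)]) (use assms ray_in_V in auto)

text \<open>One sufficiently late connection for each finite \<open>X\<close> is enough, since a
  tail of either ray that avoids \<open>X\<close> is connected outside \<open>X\<close>.\<close>

lemma eqvI:
  assumes R: "is_ray V E R" and S: "is_ray V E S"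
    and c: "\<And>X N. finite X \<Longrightarrow> \<exists>i\<ge>N. \<exists>j\<ge>N. conn E (V - X) (R i) (S j)"
  shows "eqv R S"
  unfolding eqv_def
proof (intro allI impI)
  fix X :: "'v set" assume X: "finite X"
  obtain N1 where N1: "\<forall>i\<ge>N1. R i \<notin> X" using ray_tail_avoids[OF R X] by blast
  obtain N2 where N2: "\<forall>i\<ge>N2. S i \<notin> X" using ray_tail_avoids[OF S X] by blast
  obtain i j where ij: "i \<ge> max N1 N2" "j \<ge> max N1 N2" "conn E (V - X) (R i) (S j)" using c[OF X] by blast
  show "\<exists>N. \<forall>i\<ge>N. \<forall>j\<ge>N. conn E (V - X) (R i) (S j)"
  proof (intro exI allI impI)
    fix i' j' assume "max N1 N2 \<le> i'" "max N1 N2 \<le> j'"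
    hence "conn E (V - X) (R i') (R i)" "conn E (V - X) (S j) (S j')"
      using ray_tail_conn[OF R N1] ray_tail_conn[OF S N2] ij by auto
    thus "conn E (V - X) (R i') (S j')" using ij(3) conn_trans by metis
  qed
qed

lemma equiv_rays_imp_eqv:
  assumes R: "is_ray V E R" and S: "is_ray V E S" and eq: "equiv_rays V E R S"
  shows "eqv R S"
proof (rule eqvI[OF R S])
  fix X :: "'v set" and N :: nat assume X: "finite X"
  obtain P where P: "infinite P" "pairwise_vdisjoint_paths P"
    "\<And>p. p \<in> P \<Longrightarrow> is_path V E p \<and> path_between (range R) (range S) p"
    using eq unfolding equiv_rays_def by blast
  \<comment> \<open>Avoiding the first \<open>N\<close> vertices of both rays as well forces the
    path to meet them at indices at least \<open>N\<close>.\<close>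
  have "finite (X \<union> R ` {..<N} \<union> S ` {..<N})" using X by simp
  then obtain p where p: "p \<in> P" "set p \<inter> (X \<union> R ` {..<N} \<union> S ` {..<N}) = {}"
    using disjoint_paths_avoid[OF P(1,2)] by metis
  have ip: "is_path V E p" using P(3)[OF p(1)] by blast
  hence ne: "hd p \<in> set p" "last p \<in> set p" by (auto simp: is_path_def)
  obtain i j where ij: "R i \<in> set p" "S j \<in> set p"
    using P(3)[OF p(1)] ne unfolding path_between_def by (metis imageE)
  hence "i \<ge> N" "j \<ge> N" using p(2) by (force simp: not_less[symmetric])+
  moreover have "conn E (V - X) (R i) (S j)"
    by (rule path_conn[OF ip ij]) (use p(2) ip in \<open>auto simp: is_path_def\<close>)
  ultimately show "\<exists>i\<ge>N. \<exists>j\<ge>N. conn E (V - X) (R i) (S j)" by blast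
qed

lemma eqv_sym: "eqv R S \<Longrightarrow> eqv S R"
  unfolding eqv_def using conn_sym by meson

lemma eqv_trans: assumes "eqv R S" "eqv S T" shows "eqv R T"
  unfolding eqv_def
proof (intro allI impI)
  fix X :: "'v set" assume X: "finite X"
  obtain N1 where N1: "\<forall>i\<ge>N1. \<forall>j\<ge>N1. conn E (V - X) (R i) (S j)" using assms(1) X unfolding eqv_def by blast
  obtain N2 where N2: "\<forall>i\<ge>N2. \<forall>j\<ge>N2. conn E (V - X) (S i) (T j)" using assms(2) X unfolding eqv_def by blast
  show "\<exists>N. \<forall>i\<ge>N. \<forall>j\<ge>N. conn E (V - X) (R i) (T j)"
  proof (intro exI allI impI)
    fix i j assume "max N1 N2 \<le> i" "max N1 N2 \<le> j"
    hence "conn E (V - X) (R i) (S (max N1 N2))" "conn E (V - X) (S (max N1 N2)) (T j)" using N1 N2 by auto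
    thus "conn E (V - X) (R i) (T j)" by (rule conn_trans)
  qed
qed

lemma eqv_imp_equiv_rays: "eqv R S \<Longrightarrow> equiv_rays V E R S"
  unfolding eqv_def by (intro equiv_raysI) blast

lemma end_is_ray: "is_end V E \<epsilon> \<Longrightarrow> R \<in> \<epsilon> \<Longrightarrow> is_ray V E R"
  unfolding is_end_def by blast

lemma end_eqv: "is_end V E \<epsilon> \<Longrightarrow> R \<in> \<epsilon> \<Longrightarrow> S \<in> \<epsilon> \<Longrightarrow> eqv R S"
  unfolding is_end_def using equiv_rays_imp_eqv eqv_sym eqv_trans by blast

lemma eqv_mem_end:
  assumes "is_end V E \<epsilon>" "R \<in> \<epsilon>" "is_ray V E S" "eqv R S" shows "S \<in> \<epsilon>"
proof -
  obtain T where T: "is_ray V E T" "\<epsilon> = {S. is_ray V E S \<and> equiv_rays V E T S}"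
    using assms(1) unfolding is_end_def by blast
  have "eqv T R" using T assms(2) equiv_rays_imp_eqv by auto
  thus ?thesis using T assms eqv_trans eqv_imp_equiv_rays by blast
qed

text \<open>A membership test for threaded rays: outside every finite set, \<open>C\<close> must
  reach some ray of the end that avoids the set entirely. That ray may depend on the set;
  equivalence inside the end links it to a fixed ray \<open>T\<close>.\<close>

lemma ray_mem_end:
  assumes e: "is_end V E \<epsilon>" and C: "is_ray V E C"
    and c: "\<And>X. finite X \<Longrightarrow> \<exists>R\<in>\<epsilon>. \<exists>i j. range R \<inter> X = {} \<and> conn E (V - X) (C j) (R i)"
  shows "C \<in> \<epsilon>"
proof -
  obtain T where T: "T \<in> \<epsilon>" using c[of "{}"] by auto
  have Tr: "is_ray V E T" using end_is_ray e T by blast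
  have "eqv T C"
  proof (rule eqvI[OF Tr C])
    fix X :: "'v set" and N :: nat assume X: "finite X"
    \<comment> \<open>With an initial segment of \<open>C\<close> removed too, the vertex of
      \<open>C\<close> supplied by the hypothesis has index at least \<open>N\<close>.\<close>
    let ?X = "X \<union> C ` {..<N}"
    have fX: "finite ?X" using X by simp
    then obtain R i j where R: "R \<in> \<epsilon>" "range R \<inter> ?X = {}" "conn E (V - ?X) (C j) (R i)" using c by metis
    have "C j \<notin> ?X" using conn_mem(1)[OF R(3)] by blast
    hence jN: "j \<ge> N" by (force simp: not_less[symmetric])
    obtain M where M: "\<forall>i\<ge>M. \<forall>j\<ge>M. conn E (V - ?X) (T i) (R j)"
      using end_eqv[OF e T R(1)] fX unfolding eqv_def by blast
    have Rr: "is_ray V E R" using end_is_ray e R by blast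
    have "conn E (V - ?X) (T (max M N)) (R M)" using M by simp
    moreover have "conn E (V - ?X) (R M) (R i)"
      by (rule conn_ray_range[OF Rr]) (use R Rr in \<open>auto simp: is_ray_def\<close>)
    ultimately have "conn E (V - ?X) (T (max M N)) (C j)" using conn_sym[OF R(3)] conn_trans by metis
    hence "conn E (V - X) (T (max M N)) (C j)" by (rule conn_mono) blast
    thus "\<exists>i\<ge>N. \<exists>j\<ge>N. conn E (V - X) (T i) (C j)" using jN by (meson max.cobounded2)
  qed
  thus ?thesis using eqv_mem_end[OF e T C] by blast
qed

end

section \<open>Ray graphs and combs\<close>

lemma inner_vertices_subset:
  assumes "is_path V E p" shows "inner_vertices p \<subseteq> set p - {hd p, last p}"
proof (cases p)
  case (Cons a q)
  show ?thesis
  proof (cases q rule: rev_cases)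
    case (snoc r b)
    thus ?thesis using assms Cons by (auto simp: inner_vertices_def is_path_def)
  qed (use Cons in \<open>auto simp: inner_vertices_def\<close>)
qed (auto simp: inner_vertices_def)

section \<open>Sufficient conditions for a connected ray graph\<close>

context ugraph
begin

text \<open>Edges come in one orientation with one path system each. The ray graph is the symmetric
  closure, and a reversed edge reuses the same paths because \<open>path_between\<close> ignores the
  orientation.\<close>

lemma admitsI:
  assumes F0: "F0 \<subseteq> \<R> \<times> \<R>" "\<And>R. (R, R) \<notin> F0"
    and Q1: "\<And>R S. (R, S) \<in> F0 \<Longrightarrow> infinite (Q R S)"
    and Q2: "\<And>R S. (R, S) \<in> F0 \<Longrightarrow> pairwise_vdisjoint_paths (Q R S)"
    and Q3: "\<And>R S p. (R, S) \<in> F0 \<Longrightarrow> p \<in> Q R S \<Longrightarrow> is_R_path V E \<R> p"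
    and Q4: "\<And>R S p. (R, S) \<in> F0 \<Longrightarrow> p \<in> Q R S \<Longrightarrow> path_between (range R) (range S) p"
    and ind: "\<And>R S R' S' p q. (R, S) \<in> F0 \<Longrightarrow> (R', S') \<in> F0 \<Longrightarrow> p \<in> Q R S \<Longrightarrow> q \<in> Q R' S' \<Longrightarrow> p \<noteq> q
        \<Longrightarrow> inner_vertices p \<inter> set q = {}"
    and cn: "\<And>R S. R \<in> \<R> \<Longrightarrow> S \<in> \<R> \<Longrightarrow> (R, S) \<in> (F0 \<union> F0\<inverse>)\<^sup>*"
  shows "admits_connected_ray_graph V E \<R>"
proof -
  let ?F = "F0 \<union> F0\<inverse>" and ?P = "\<Union>(R, S)\<in>F0. Q R S"
  have "is_ray_graph V E \<R> ?F"
    unfolding is_ray_graph_def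
  proof (intro conjI exI[of _ ?P])
    show "?F \<subseteq> \<R> \<times> \<R>" using F0 by auto
    show "sym ?F" by (auto simp: sym_def)
    show "irrefl ?F" using F0 by (auto simp: irrefl_def)
    show "\<forall>p\<in>?P. is_R_path V E \<R> p" using Q3 by auto
    show "independent_paths ?P"
      unfolding independent_paths_def
    proof (intro ballI impI)
      fix p q assume "p \<in> ?P" "q \<in> ?P" and n: "p \<noteq> q"
      then obtain R S R' S' where "(R, S) \<in> F0" "p \<in> Q R S" "(R', S') \<in> F0" "q \<in> Q R' S'" by auto
      thus "inner_vertices p \<inter> set q = {}" using ind n by blast
    qed
    show "\<forall>(R, S)\<in>?F. \<exists>Q\<subseteq>?P. infinite Q \<and> pairwise_vdisjoint_paths Q \<and>
           (\<forall>p\<in>Q. path_between (range R) (range S) p)"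
    proof (intro ballI, clarify)
      fix R S assume RS: "(R, S) \<in> ?F"
      have "\<exists>Q\<subseteq>?P. infinite Q \<and> pairwise_vdisjoint_paths Q \<and> (\<forall>p\<in>Q. path_between (range R) (range S) p)"
        if "(R, S) \<in> F0" for R S
        using that Q1 Q2 Q4 by (intro exI[of _ "Q R S"]) auto
      from this[of R S] this[of S R] RS
      show "\<exists>Q\<subseteq>?P. infinite Q \<and> pairwise_vdisjoint_paths Q \<and> (\<forall>p\<in>Q. path_between (range R) (range S) p)"
        unfolding path_between_def by (auto simp: disj_commute)
    qed
  qed
  moreover have "connected_on \<R> ?F" using cn by (simp add: connected_on_def)
  ultimately show ?thesis unfolding admits_connected_ray_graph_def by blast
qed

definition weak_edge :: "(nat \<Rightarrow> 'v) set \<Rightarrow> (nat \<Rightarrow> 'v) \<Rightarrow> (nat \<Rightarrow> 'v) \<Rightarrow> bool" where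
  "weak_edge \<R> R S \<longleftrightarrow> (\<forall>X. finite X \<longrightarrow>
     (\<exists>p. is_R_path V E \<R> p \<and> path_between (range R) (range S) p \<and> set p \<inter> X = {}))"

text \<open>
  Over countably many edges, paths avoiding every finite set can be chosen disjoint one at a time, so
  the independence required of a ray graph comes for free.
\<close>

lemma admits_countable:
  assumes F0: "F0 \<subseteq> \<R> \<times> \<R>" "\<And>R. (R, R) \<notin> F0" and cF: "countable F0"
    and w: "\<And>R S. (R, S) \<in> F0 \<Longrightarrow> weak_edge \<R> R S"
    and cn: "\<And>R S. R \<in> \<R> \<Longrightarrow> S \<in> \<R> \<Longrightarrow> (R, S) \<in> (F0 \<union> F0\<inverse>)\<^sup>*"
  shows "admits_connected_ray_graph V E \<R>"
proof (cases "F0 = {}")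
  case True
  show ?thesis by (rule admitsI[of F0 _ "\<lambda>_ _. {}"]) (use True cn in auto)
next
  case False
  \<comment> \<open>Only the first component of the decoded pair is used, so every edge is scheduled
    infinitely often.\<close>
  define e where "e n = from_nat_into F0 (fst (prod_decode n))" for n
  have eF: "e n \<in> F0" for n using False by (simp add: e_def from_nat_into)
  define P where "P n p \<longleftrightarrow> is_R_path V E \<R> p \<and> path_between (range (fst (e n))) (range (snd (e n))) p" for n p
  have "\<exists>f :: nat \<Rightarrow> 'v list. \<forall>n. P n (f n) \<and> (\<forall>m<n. set (f m) \<inter> set (f n) = {})"
  proof (rule greedy_disjoint)
    fix n and X :: "'v set" assume "finite X"
    moreover have "weak_edge \<R> (fst (e n)) (snd (e n))" using w eF[of n] by simp
    ultimately show "\<exists>p. P n p \<and> set p \<inter> X = {}" unfolding weak_edge_def P_def by blast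
  qed
  then obtain f :: "nat \<Rightarrow> 'v list" where f: "\<And>n. P n (f n)" "\<And>m n. m < n \<Longrightarrow> set (f m) \<inter> set (f n) = {}" by blast
  have d: "set (f m) \<inter> set (f n) = {}" if "m \<noteq> n" for m n
    using f(2)[of m n] f(2)[of n m] that by (metis Int_commute nat_neq_iff)
  have ne: "f n \<noteq> []" for n using f(1)[of n] by (auto simp: P_def is_R_path_def is_path_def)
  have "inj f"
  proof (rule injI, rule ccontr)
    fix m n assume "f m = f n" "m \<noteq> n"
    with d[of m n] ne[of n] show False by auto
  qed
  define Q where "Q R S = f ` {n. e n = (R, S)}" for R S
  show ?thesis
  proof (rule admitsI[of F0 _ Q])
    show "F0 \<subseteq> \<R> \<times> \<R>" by fact
    show "\<And>R. (R, R) \<notin> F0" by fact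
    show "infinite (Q R S)" if RS: "(R, S) \<in> F0" for R S
    proof -
      obtain k where k: "from_nat_into F0 k = (R, S)" using RS cF by (metis from_nat_into_surj)
      have "range (\<lambda>j. prod_encode (k, j)) \<subseteq> {n. e n = (R, S)}" using k by (auto simp: e_def)
      moreover have "inj (\<lambda>j. prod_encode (k, j))" by (auto intro!: injI)
      ultimately have "infinite {n. e n = (R, S)}" using range_inj_infinite infinite_super by blast
      thus ?thesis using \<open>inj f\<close> unfolding Q_def by (meson finite_imageD inj_on_subset subset_UNIV)
    qed
    show "pairwise_vdisjoint_paths (Q R S)" for R S
      unfolding pairwise_vdisjoint_paths_def Q_def
    proof (intro ballI impI)
      fix p q assume "p \<in> f ` {n. e n = (R, S)}" "q \<in> f ` {n. e n = (R, S)}" "p \<noteq> q"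
      then obtain m n where "p = f m" "q = f n" "m \<noteq> n" by auto
      thus "set p \<inter> set q = {}" using d by simp
    qed
    show "is_R_path V E \<R> p" "path_between (range R) (range S) p" if pQ: "p \<in> Q R S" for R S p
    proof -
      obtain n where "e n = (R, S)" "p = f n" using pQ unfolding Q_def by blast
      thus "is_R_path V E \<R> p" "path_between (range R) (range S) p" using f(1)[of n] by (auto simp: P_def)
    qed
    show "inner_vertices p \<inter> set q = {}" if "p \<in> Q R S" "q \<in> Q R' S'" "p \<noteq> q" for R S R' S' p q
    proof -
      obtain m n where mn: "p = f m" "q = f n" "m \<noteq> n" using \<open>p \<in> Q R S\<close> \<open>q \<in> Q R' S'\<close> \<open>p \<noteq> q\<close> unfolding Q_def by auto
      have "inner_vertices p \<subseteq> set p" by (auto simp: inner_vertices_def dest: in_set_butlastD list.set_sel(2)[rotated])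
         (metis in_set_butlastD list.sel(2) list.set_sel(2))
      thus ?thesis using d[OF mn(3)] mn by blast
    qed
    show "\<And>R S. R \<in> \<R> \<Longrightarrow> S \<in> \<R> \<Longrightarrow> (R, S) \<in> (F0 \<union> F0\<inverse>)\<^sup>*" by fact
  qed
qed

lemma admits_finite:
  assumes fin: "finite \<R>" and dis: "disjoint_rays \<R>"
    and ray: "\<And>R. R \<in> \<R> \<Longrightarrow> is_ray V E R"
    and eq: "\<And>R S. R \<in> \<R> \<Longrightarrow> S \<in> \<R> \<Longrightarrow> eqv R S"
  shows "admits_connected_ray_graph V E \<R>"
proof -
  define F0 where "F0 = {(R, S). R \<in> \<R> \<and> S \<in> \<R> \<and> R \<noteq> S \<and> weak_edge \<R> R S}"
  have sub: "F0 \<subseteq> \<R> \<times> \<R>" by (auto simp: F0_def)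
  show ?thesis
  proof (rule admits_countable[of F0])
    show "F0 \<subseteq> \<R> \<times> \<R>" by fact
    show "\<And>R. (R, R) \<notin> F0" by (auto simp: F0_def)
    show "countable F0" using sub fin by (meson countable_finite finite_SigmaI finite_subset)
    show "\<And>R S. (R, S) \<in> F0 \<Longrightarrow> weak_edge \<R> R S" by (auto simp: F0_def)
    fix R S assume R: "R \<in> \<R>" and S: "S \<in> \<R>"
    show "(R, S) \<in> (F0 \<union> F0\<inverse>)\<^sup>*"
    proof (rule ccontr)
      assume n: "(R, S) \<notin> (F0 \<union> F0\<inverse>)\<^sup>*"
      define C where "C = {T \<in> \<R>. (R, T) \<in> (F0 \<union> F0\<inverse>)\<^sup>*}"
      have RC: "R \<in> C" and SC: "S \<in> \<R> - C" using R S n by (auto simp: C_def)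
      have no: "\<exists>X. finite X \<and> (\<forall>p. is_R_path V E \<R> p \<longrightarrow> path_between (range T) (range U) p \<longrightarrow> set p \<inter> X \<noteq> {})"
        if T: "T \<in> C" and U: "U \<in> \<R> - C" for T U
      proof -
        have "(T, U) \<notin> F0 \<union> F0\<inverse>" using T U unfolding C_def by (auto intro: rtrancl_into_rtrancl)
        moreover have "T \<in> \<R>" "T \<noteq> U" using T U by (auto simp: C_def)
        ultimately have "\<not> weak_edge \<R> T U" using U by (auto simp: F0_def)
        thus ?thesis unfolding weak_edge_def by blast
      qed
      then obtain X where X: "\<And>T U. T \<in> C \<Longrightarrow> U \<in> \<R> - C \<Longrightarrow> finite (X T U)"
        "\<And>T U p. T \<in> C \<Longrightarrow> U \<in> \<R> - C \<Longrightarrow> is_R_path V E \<R> p \<Longrightarrow> path_between (range T) (range U) p \<Longrightarrow> set p \<inter> X T U \<noteq> {}"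
        by metis
      define Y where "Y = (\<Union>T\<in>C. \<Union>U\<in>\<R> - C. X T U)"
      have "finite Y" using X(1) fin unfolding Y_def C_def by auto
      then obtain N where "\<forall>i\<ge>N. \<forall>j\<ge>N. conn E (V - Y) (R i) (S j)" using eq[OF R S] unfolding eqv_def by blast
      hence c: "conn E (V - Y) (R N) (S N)" by blast
      let ?A = "\<Union>T\<in>C. range T" and ?B = "\<Union>T\<in>\<R> - C. range T"
      have "R N \<in> ?A" "S N \<in> ?B" using RC SC by blast+
      from shortest_path_between[OF c this] obtain p where p: "is_path (V - Y) E p" "hd p \<in> ?A" "last p \<in> ?B"
        "set p \<inter> ?A = {hd p}" "set p \<inter> ?B = {last p}" by blast
      obtain T U where TU: "T \<in> C" "hd p \<in> range T" "U \<in> \<R> - C" "last p \<in> range U" using p(2,3) by blast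
      have "T \<in> \<R>" "U \<in> \<R>" "T \<noteq> U" using TU by (auto simp: C_def)
      hence "range T \<inter> range U = {}" using dis unfolding disjoint_rays_def by blast
      hence "hd p \<noteq> last p" using TU(2,4) by (metis disjoint_iff)
      have "C \<union> (\<R> - C) = \<R>" by (auto simp: C_def)
      hence "(\<Union>T\<in>\<R>. range T) = ?A \<union> ?B" by blast
      hence "set p \<inter> (\<Union>T\<in>\<R>. range T) = set p \<inter> ?A \<union> set p \<inter> ?B" by (simp only: Int_Un_distrib)
      hence "set p \<inter> (\<Union>T\<in>\<R>. range T) = {hd p, last p}" unfolding p(4,5) by (simp add: insert_commute)
      hence "is_R_path V E \<R> p" using p(1) \<open>hd p \<noteq> last p\<close> is_path_mono[OF p(1)] by (auto simp: is_R_path_def)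
      moreover have "path_between (range T) (range U) p" using TU by (auto simp: path_between_def)
      ultimately have "set p \<inter> X T U \<noteq> {}" using X(2) TU by blast
      moreover have "X T U \<subseteq> Y" using TU unfolding Y_def by blast
      ultimately show False using p(1) by (auto simp: is_path_def)
    qed
  qed
qed

text \<open>\<open>R\<close> is the spine and the last vertices of the paths in \<open>Q\<close> are
  the teeth. The set \<open>A\<close> may contain further vertices, but none on the spine and none
  on a path other than its tooth.\<close>

definition comb :: "'v set \<Rightarrow> (nat \<Rightarrow> 'v) \<Rightarrow> 'v list set \<Rightarrow> bool" where
  "comb A R Q \<longleftrightarrow> is_ray V E R \<and> range R \<inter> A = {} \<and> infinite Q \<and> pairwise_vdisjoint_paths Q \<and>
     (\<forall>p\<in>Q. is_path V E p \<and> hd p \<in> range R \<and> last p \<in> A \<and> set p \<inter> range R = {hd p} \<and> set p \<inter> A = {last p})"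

definition body :: "(nat \<Rightarrow> 'v) \<Rightarrow> 'v list set \<Rightarrow> 'v set" where
  "body R Q = range R \<union> (\<Union>p\<in>Q. set p)"

lemma comb_path:
  assumes "comb A R Q" "p \<in> Q"
  shows "is_path V E p" "hd p \<in> range R" "last p \<in> A" "set p \<inter> range R = {hd p}" "set p \<inter> A = {last p}"
    "hd p \<noteq> last p" "hd p \<in> set p" "last p \<in> set p"
  using assms unfolding comb_def is_path_def by (auto 0 3)

lemma range_subset_body: "range R \<subseteq> body R Q" and path_subset_body: "p \<in> Q \<Longrightarrow> set p \<subseteq> body R Q"
  by (auto simp: body_def)

lemma comb_body_Int: assumes "comb A R Q" shows "body R Q \<inter> A = last ` Q"
proof -
  have "range R \<inter> A = {}" using assms by (simp add: comb_def)
  moreover have "(\<Union>p\<in>Q. set p) \<inter> A = last ` Q" using comb_path(5)[OF assms] by blast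
  ultimately show ?thesis unfolding body_def by blast
qed

lemma comb_conn:
  assumes "comb A R Q" "p \<in> Q" "set p \<subseteq> W" "range R \<subseteq> W" shows "conn E W (last p) (R i)"
proof -
  note cp = comb_path[OF assms(1,2)]
  obtain j where j: "hd p = R j" using cp(2) by blast
  have "conn E W (last p) (hd p)" by (rule path_conn[OF cp(1)]) (use cp assms in auto)
  moreover have "conn E W (R j) (R i)" by (rule conn_ray_range) (use assms in \<open>auto simp: comb_def\<close>)
  ultimately show ?thesis using j conn_trans by metis
qed

text \<open>\<open>D\<close> may have vertices outside \<open>A\<close>. Since it meets the body
  only inside \<open>A\<close>, a path ending in \<open>D\<close> has no earlier vertex
  there.\<close>

lemma comb_restrict:
  assumes "comb A R Q" "infinite (last ` Q \<inter> D)" "D \<inter> body R Q \<subseteq> A"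
  shows "comb D R {p \<in> Q. last p \<in> D}"
  unfolding comb_def
proof (intro conjI ballI)
  show "is_ray V E R" using assms by (simp add: comb_def)
  show "range R \<inter> D = {}" using assms range_subset_body[of R Q] by (auto simp: comb_def)
  have "last ` Q \<inter> D \<subseteq> last ` {p \<in> Q. last p \<in> D}" by blast
  thus "infinite {p \<in> Q. last p \<in> D}" using assms(2) by (meson finite_imageI finite_subset)
  show "pairwise_vdisjoint_paths {p \<in> Q. last p \<in> D}"
    using assms(1) by (auto simp: comb_def pairwise_vdisjoint_paths_def)
  fix p assume p: "p \<in> {p \<in> Q. last p \<in> D}"
  hence pQ: "p \<in> Q" by blast
  note cp = comb_path[OF assms(1) pQ]
  show "is_path V E p" "hd p \<in> range R" "last p \<in> D" "set p \<inter> range R = {hd p}" using cp p by auto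
  show "set p \<inter> D = {last p}" using cp p assms(3) path_subset_body[OF pQ, of R] by blast
qed

lemma body_mono: "Q' \<subseteq> Q \<Longrightarrow> body R Q' \<subseteq> body R Q"
  by (auto simp: body_def)

lemma countable_comb:
  assumes "comb A R Q" shows "countable Q"
proof -
  have "inj_on hd Q"
  proof (rule inj_onI, rule ccontr)
    fix p q assume "p \<in> Q" "q \<in> Q" "hd p = hd q" "p \<noteq> q"
    thus False using assms comb_path(7)[OF assms] unfolding comb_def pairwise_vdisjoint_paths_def
      by (metis disjoint_iff)
  qed
  moreover have "countable (hd ` Q)"
    by (rule countable_subset[of _ "range R"]) (use comb_path(2)[OF assms] in auto)
  ultimately show ?thesis using countable_image_inj_on by blast
qed

lemma countable_body: assumes "comb A R Q" shows "countable (body R Q)"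
  using countable_comb[OF assms] unfolding body_def by (intro countable_Un countable_UN countable_image) (auto intro: countable_finite)

text \<open>The paths of the comb are shortest paths from \<open>R\<close> to \<open>U\<close>, each
  outside the finite set covered before. They exist because \<open>U\<close> contains a ray
  equivalent to \<open>R\<close>.\<close>

lemma comb_exists:
  assumes R: "is_ray V E R" and S: "range S \<subseteq> U" and RU: "range R \<inter> U = {}" and eq: "eqv R S"
  shows "\<exists>Q. comb U R Q"
proof -
  define P where "P p \<longleftrightarrow> is_path V E p \<and> hd p \<in> range R \<and> last p \<in> U \<and> set p \<inter> range R = {hd p} \<and> set p \<inter> U = {last p}" for p
  have "\<exists>Q. infinite Q \<and> pairwise_vdisjoint_paths Q \<and> (\<forall>p\<in>Q. P p)"
  proof (rule greedy_disjoint_set)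
    fix X :: "'v set" assume "finite X"
    then obtain N where "\<forall>i\<ge>N. \<forall>j\<ge>N. conn E (V - X) (R i) (S j)" using eq unfolding eqv_def by blast
    hence "conn E (V - X) (R N) (S N)" by blast
    moreover have "R N \<in> range R" "S N \<in> U" using S by auto
    ultimately have "\<exists>p. is_path (V - X) E p \<and> hd p \<in> range R \<and> last p \<in> U \<and> set p \<inter> range R = {hd p} \<and> set p \<inter> U = {last p}"
      by (rule shortest_path_between)
    then obtain p where p: "is_path (V - X) E p" "hd p \<in> range R" "last p \<in> U" "set p \<inter> range R = {hd p}" "set p \<inter> U = {last p}"
      by (elim exE conjE) (rule that)
    have "is_path V E p" using is_path_mono[OF p(1)] by blast
    moreover have "set p \<inter> X = {}" "p \<noteq> []" using p(1) by (auto simp: is_path_def)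
    ultimately show "\<exists>p. P p \<and> p \<noteq> [] \<and> set p \<inter> X = {}" using p unfolding P_def by (intro exI[of _ p]) simp
  qed
  then obtain Q where Q: "infinite Q" "pairwise_vdisjoint_paths Q" "\<And>p. p \<in> Q \<Longrightarrow> P p" by blast
  have "comb U R Q" unfolding comb_def using R RU Q(1,2) Q(3)[unfolded P_def] by simp
  thus ?thesis by blast
qed

lemma infinite_bodies_avoid:
  assumes "infinite L" "finite X"
    and d: "\<And>R S. R \<in> L \<Longrightarrow> S \<in> L \<Longrightarrow> R \<noteq> S \<Longrightarrow> B R \<inter> B S = {}"
  shows "\<exists>R\<in>L. B R \<inter> X = {}"
proof (rule ccontr)
  assume "\<not> ?thesis"
  hence "\<forall>R\<in>L. \<exists>x. x \<in> B R \<inter> X" by blast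
  then obtain f where f: "\<And>R. R \<in> L \<Longrightarrow> f R \<in> B R \<inter> X" by metis
  have "inj_on f L" using f d by (intro inj_onI) (metis IntD1 disjoint_iff)
  moreover have "f ` L \<subseteq> X" using f by blast
  ultimately show False using assms(1,2) by (meson finite_imageD finite_subset)
qed

text \<open>The ray is the union of nested finite paths, each prolonged from its last vertex to a
  new vertex of a scheduled target set. Confinement to \<open>W\<close> is what later makes
  different centres disjoint.\<close>

lemma greedy_ray:
  fixes B :: "nat \<Rightarrow> 'v set"
  assumes step: "\<And>X a n m. finite X \<Longrightarrow> a \<in> B n \<Longrightarrow> a \<notin> X \<Longrightarrow> \<exists>b\<in>B m. b \<noteq> a \<and> conn E (W - X) a b"
    and ne: "B 0 \<noteq> {}" and W: "W \<subseteq> V" and BW: "\<And>n. B n \<subseteq> W"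
  shows "\<exists>C. is_ray V E C \<and> range C \<subseteq> W \<and> (\<forall>m. infinite (range C \<inter> B m))"
proof -
  define P where "P xs \<longleftrightarrow> is_path W E xs \<and> last xs \<in> (\<Union>n. B n)" for xs
  \<comment> \<open>The target of step \<open>n\<close> is the first component of
    \<open>prod_decode n\<close>, so every \<open>B m\<close> is a target infinitely often.\<close>
  define T where "T n xs ys \<longleftrightarrow> (\<exists>zs. zs \<noteq> [] \<and> ys = xs @ zs) \<and> last ys \<in> B (fst (prod_decode n))" for n :: nat and xs ys
  have "\<exists>f. \<forall>n. P (f n) \<and> T n (f n) (f (Suc n))"
  proof (rule dependent_nat_choice)
    obtain a where "a \<in> B 0" using ne by blast
    thus "\<exists>x. P x" using BW by (intro exI[of _ "[a]"]) (auto simp: P_def is_path_def)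
    fix xs n assume xs: "P xs"
    hence ip: "is_path W E xs" by (simp add: P_def)
    hence x0: "xs \<noteq> []" and xd: "distinct xs" by (auto simp: is_path_def)
    \<comment> \<open>All vertices of the path except the last are forbidden; the continuation
      starts at the last one.\<close>
    let ?X = "set (butlast xs)"
    have xsplit: "xs = butlast xs @ [last xs]" using x0 by simp
    have "last xs \<notin> ?X" using xd xsplit by (metis distinct_append disjoint_iff list.set_intros(1))
    then obtain b where b: "b \<in> B (fst (prod_decode n))" "b \<noteq> last xs" "conn E (W - ?X) (last xs) b"
      using step[of ?X "last xs"] xs unfolding P_def by blast
    obtain p where p: "is_path (W - ?X) E p" "hd p = last xs" "last p = b" using conn_path[OF b(3)] by blast
    obtain zs where zs: "p = last xs # zs" using p by (cases p) (auto simp: is_path_def)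
    have z0: "zs \<noteq> []" using zs p b by auto
    have eqp: "xs @ zs = butlast xs @ p" using xsplit zs by (metis append.assoc append_Cons append_Nil)
    have "successively E (butlast xs @ [last xs])" using ip x0 unfolding is_path_iff_successively by simp
    hence "successively E (butlast xs @ p)"
      using p(1) zs unfolding is_path_iff_successively by (auto simp: successively_append_iff)
    hence "is_path W E (xs @ zs)" unfolding eqp
      using ip p(1) xd unfolding is_path_iff_successively by (auto simp: distinct_butlast dest: in_set_butlastD)
    moreover have "last (xs @ zs) = b" using z0 zs p by auto
    ultimately have "P (xs @ zs) \<and> T n xs (xs @ zs)" using b z0 unfolding P_def T_def by auto
    thus "\<exists>y. P y \<and> T n xs y" by blast
  qed
  then obtain f where fP: "\<And>n. P (f n)" and fT: "\<And>n. T n (f n) (f (Suc n))" by blast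
  have len: "n < length (f n)" for n
  proof (induction n)
    case 0
    then show ?case using fP[of 0] by (auto simp: P_def is_path_def)
  next
    case (Suc n)
    obtain zs where "zs \<noteq> []" "f (Suc n) = f n @ zs" using fT[of n] unfolding T_def by blast
    then show ?case using Suc by (cases zs) auto
  qed
  have pre: "f m ! i = f n ! i \<and> i < length (f m)" if "n \<le> m" "i < length (f n)" for n m i
    using that(1)
  proof (induction m rule: dec_induct)
    case (step m)
    obtain zs where "f (Suc m) = f m @ zs" using fT[of m] unfolding T_def by blast
    then show ?case using step by (auto simp: nth_append)
  qed (use that in simp)
  define C where "C i = f i ! i" for i
  have Cf: "C i = f m ! i" if "i < length (f m)" for i m
    using pre[of i m i] pre[of m i i] len that unfolding C_def by (metis nle_le)
  have ipath: "is_path W E (f n)" for n using fP by (simp add: P_def)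
  have inj: "inj C"
  proof (rule linorder_injI)
    fix i j :: nat assume "i < j"
    hence "i < length (f j)" "j < length (f j)" using len[of j] by auto
    thus "C i \<noteq> C j" using Cf[of i j] Cf[of j j] ipath[of j] \<open>i < j\<close> unfolding is_path_def
      by (metis nat_neq_iff nth_eq_iff_index_eq)
  qed
  have CW: "range C \<subseteq> W" using ipath len nth_mem unfolding C_def is_path_def by blast
  have "E (C i) (C (Suc i))" for i
  proof -
    have "i < length (f (Suc i))" "Suc i < length (f (Suc i))" using len[of "Suc i"] by auto
    thus ?thesis using Cf[of i "Suc i"] Cf[of "Suc i" "Suc i"] ipath[of "Suc i"] unfolding is_path_def by simp
  qed
  hence "is_ray V E C" using inj CW W by (auto simp: is_ray_def)
  moreover have "infinite (range C \<inter> B m)" for m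
  proof -
    have "\<exists>i\<ge>k. C i \<in> B m" for k
    proof -
      \<comment> \<open>This step number is at least \<open>k\<close>, so the visit to
        \<open>B m\<close> happens at a position of the ray not before \<open>k\<close>.\<close>
      let ?n = "prod_encode (m, k)"
      have k: "k \<le> ?n" by (rule le_prod_encode_2)
      have ne: "f (Suc ?n) \<noteq> []" using len[of "Suc ?n"] by auto
      have "last (f (Suc ?n)) \<in> B m" using fT[of ?n] unfolding T_def by simp
      moreover have "last (f (Suc ?n)) = C (length (f (Suc ?n)) - 1)"
        using Cf[of "length (f (Suc ?n)) - 1" "Suc ?n"] ne by (simp add: last_conv_nth)
      moreover have "length (f (Suc ?n)) - 1 \<ge> k" using len[of "Suc ?n"] k by linarith
      ultimately show ?thesis by auto
    qed
    hence "infinite {i. C i \<in> B m}" by (metis infinite_nat_iff_unbounded_le mem_Collect_eq)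
    moreover have "C ` {i. C i \<in> B m} \<subseteq> range C \<inter> B m" by blast
    ultimately show ?thesis using inj by (meson finite_imageD finite_subset inj_on_subset subset_UNIV)
  qed
  ultimately show ?thesis using CW by blast
qed

lemma comb_subset_V: "comb A R Q \<Longrightarrow> body R Q \<subseteq> V"
  unfolding comb_def body_def is_ray_def is_path_def by blast

lemma comb_inner:
  assumes "comb A R Q" "p \<in> Q"
  shows "inner_vertices p \<subseteq> body R Q - A" "inner_vertices p \<inter> range R = {}" "inner_vertices p \<subseteq> set p"
proof -
  note cp = comb_path[OF assms]
  have i: "inner_vertices p \<subseteq> set p - {hd p, last p}" using inner_vertices_subset[OF cp(1)] .
  thus "inner_vertices p \<subseteq> set p" by blast
  show "inner_vertices p \<subseteq> body R Q - A" using i cp(5) path_subset_body[OF assms(2), of R] by auto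
  show "inner_vertices p \<inter> range R = {}" using i cp(4) by auto
qed

lemma comb_disjoint_paths: "comb A R Q \<Longrightarrow> p \<in> Q \<Longrightarrow> q \<in> Q \<Longrightarrow> p \<noteq> q \<Longrightarrow> set p \<inter> set q = {}"
  unfolding comb_def pairwise_vdisjoint_paths_def by blast

lemma comb_teeth_infinite:
  assumes "comb A R Q" shows "infinite (last ` Q)"
proof
  have "inj_on last Q"
  proof (rule inj_onI, rule ccontr)
    fix p q assume "p \<in> Q" "q \<in> Q" "last p = last q" "p \<noteq> q"
    thus False using comb_disjoint_paths[OF assms] comb_path(8)[OF assms] by (metis disjoint_iff)
  qed
  moreover assume "finite (last ` Q)"
  ultimately show False using finite_imageD assms by (auto simp: comb_def)
qed

lemma comb_minus: "comb A R Q \<Longrightarrow> range R \<subseteq> body R Q - A"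
  using range_subset_body[of R Q] by (auto simp: comb_def)

text \<open>
  The rays in \<open>M\<close> are joined to the centre \<open>C\<close>, and each ray \<open>R\<close> in \<open>L\<close> is a leaf joined to the ray \<open>par R\<close> in \<open>M\<close>.
\<close>

lemma tree_admits:
  assumes M: "\<And>R. R \<in> M \<Longrightarrow> comb (range C) R (Q R)"
    and MM: "\<And>R S. R \<in> M \<Longrightarrow> S \<in> M \<Longrightarrow> R \<noteq> S \<Longrightarrow> body R (Q R) \<inter> body S (Q S) \<subseteq> range C"
    and Z: "Z = range C \<union> (\<Union>R\<in>M. body R (Q R))"
    and L: "\<And>R. R \<in> L \<Longrightarrow> par R \<in> M" "\<And>R. R \<in> L \<Longrightarrow> comb (range (par R)) R (Q2 R)"
    and LZ: "\<And>R. R \<in> L \<Longrightarrow> body R (Q2 R) \<inter> Z \<subseteq> range (par R)"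
    and LL: "\<And>R S. R \<in> L \<Longrightarrow> S \<in> L \<Longrightarrow> R \<noteq> S \<Longrightarrow> body R (Q2 R) \<inter> body S (Q2 S) \<subseteq> range (par R)"
  shows "disjoint_rays (insert C (M \<union> L))" "admits_connected_ray_graph V E (insert C (M \<union> L))"
proof -
  let ?R = "insert C (M \<union> L)"
  have MC: "range R \<inter> range C = {}" if "R \<in> M" for R using M[OF that] by (simp add: comb_def)
  have MMr: "range R \<inter> body S (Q S) = {}" if "R \<in> M" "S \<in> M" "R \<noteq> S" for R S
    using MM[OF that] MC[OF that(1)] range_subset_body[of R "Q R"] by blast
  have LZr: "range R \<inter> Z = {}" if "R \<in> L" for R
    using LZ[OF that] comb_minus[OF L(2)[OF that]] by blast
  have LLr: "range R \<inter> body S (Q2 S) = {}" if "R \<in> L" "S \<in> L" "R \<noteq> S" for R S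
    using LL[OF that] comb_minus[OF L(2)[OF that(1)]] by blast
  have bZ: "body R (Q R) \<subseteq> Z" if "R \<in> M" for R using that Z by blast
  have rZ: "range R \<subseteq> Z" if "R \<in> M" for R using bZ[OF that] range_subset_body by blast
  have CZ: "range C \<subseteq> Z" using Z by blast
  have CM: "C \<notin> M" using MC by blast
  have CL: "C \<notin> L" using LZr CZ by blast
  have M_L: "M \<inter> L = {}" using LZr rZ by blast
  have LMr: "body R (Q2 R) \<inter> range S \<subseteq> range (par R)" "S \<noteq> par R \<Longrightarrow> body R (Q2 R) \<inter> range S = {}" if "R \<in> L" "S \<in> M" for R S
  proof -
    show "body R (Q2 R) \<inter> range S \<subseteq> range (par R)" using LZ[OF that(1)] rZ[OF that(2)] by blast
    thus "body R (Q2 R) \<inter> range S = {}" if "S \<noteq> par R"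
      using MMr[of S "par R"] that L(1)[OF \<open>R \<in> L\<close>] \<open>S \<in> M\<close> range_subset_body[of "par R" "Q (par R)"] by blast
  qed
  have LCr: "body R (Q2 R) \<inter> range C = {}" if "R \<in> L" for R
    using LZ[OF that] CZ MC[OF L(1)[OF that]] by blast
  have par: "par R \<notin> L" "par R \<noteq> C" if "R \<in> L" for R using L(1)[OF that] M_L CM by auto
  show dis: "disjoint_rays ?R"
  proof -
    have "range R \<inter> range S = {}" if "R \<in> ?R" "S \<in> ?R" "R \<noteq> S" for R S
    proof -
      consider "R = C" "S \<in> M" | "R = C" "S \<in> L" | "R \<in> M" "S = C" | "R \<in> M" "S \<in> M" | "R \<in> M" "S \<in> L" | "R \<in> L" "S = C"
        | "R \<in> L" "S \<in> M" | "R \<in> L" "S \<in> L" using \<open>R \<in> ?R\<close> \<open>S \<in> ?R\<close> \<open>R \<noteq> S\<close> by blast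
      thus ?thesis
      proof cases
        case 1 thus ?thesis using MC by blast
      next
        case 2 thus ?thesis using LZr CZ by blast
      next
        case 3 thus ?thesis using MC by blast
      next
        case 4 thus ?thesis using MMr[of R S] \<open>R \<noteq> S\<close> range_subset_body[of S "Q S"] by blast
      next
        case 5 thus ?thesis using LZr[of S] rZ[of R] by blast
      next
        case 6 thus ?thesis using LZr CZ by blast
      next
        case 7 thus ?thesis using LZr[of R] rZ[of S] by blast
      next
        case 8 thus ?thesis using LLr[of R S] \<open>R \<noteq> S\<close> range_subset_body[of S "Q2 S"] by blast
      qed
    qed
    thus ?thesis unfolding disjoint_rays_def by blast
  qed
  \<comment> \<open>Edges point from child to parent, so a child determines its edge and its path
    system.\<close>
  define F0 where "F0 = (\<lambda>R. (R, C)) ` M \<union> (\<lambda>R. (R, par R)) ` L"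
  define P where "P R (S :: nat \<Rightarrow> 'v) = (if R \<in> L then Q2 R else Q R)" for R S
  have F0D: "(R \<in> M \<and> R \<notin> L \<and> S = C) \<or> (R \<in> L \<and> S = par R)" if "(R, S) \<in> F0" for R S
    using that M_L by (auto simp: F0_def)
  have RpM: "is_R_path V E ?R p" if R: "R \<in> M" and p: "p \<in> Q R" for R p
  proof -
    note cp = comb_path[OF M[OF R] p]
    have pb: "set p \<subseteq> body R (Q R)" using path_subset_body[OF p] .
    have "set p \<inter> range S = {}" if "S \<in> M" "S \<noteq> R" for S using MMr[OF that(1) R that(2)] pb by blast
    moreover have "set p \<inter> range S = {}" if "S \<in> L" for S using LZr[OF that] bZ[OF R] pb by blast
    ultimately have "set p \<inter> (\<Union>S\<in>?R. range S) = (set p \<inter> range C) \<union> (set p \<inter> range R)" using R by blast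
    also have "\<dots> = {hd p, last p}" unfolding cp(4,5) by blast
    finally show ?thesis using cp(1,6) by (simp add: is_R_path_def)
  qed
  have RpL: "is_R_path V E ?R p" if R: "R \<in> L" and p: "p \<in> Q2 R" for R p
  proof -
    note cp = comb_path[OF L(2)[OF R] p]
    have pb: "set p \<subseteq> body R (Q2 R)" using path_subset_body[OF p] .
    have "set p \<inter> range S = {}" if "S \<in> M" "S \<noteq> par R" for S using LMr(2)[OF R that] pb by blast
    moreover have "set p \<inter> range S = {}" if "S \<in> L" "S \<noteq> R" for S using LLr[OF that(1) R that(2)] pb by blast
    moreover have "set p \<inter> range C = {}" using LCr[OF R] pb by blast
    ultimately have "set p \<inter> (\<Union>S\<in>?R. range S) = (set p \<inter> range (par R)) \<union> (set p \<inter> range R)" using R L(1)[OF R] by blast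
    also have "\<dots> = {hd p, last p}" unfolding cp(4,5) by blast
    finally show ?thesis using cp(1,6) by (simp add: is_R_path_def)
  qed
  show "admits_connected_ray_graph V E ?R"
  proof (rule admitsI[of F0 _ P])
    show "F0 \<subseteq> ?R \<times> ?R" using L(1) by (auto simp: F0_def)
    show "(R, R) \<notin> F0" for R using F0D[of R R] CM par(1)[of R] by metis
    fix R S assume RS: "(R, S) \<in> F0"
    have cb: "comb (range S) R (P R S)" using F0D[OF RS] M L(2) by (auto simp: P_def)
    thus "infinite (P R S)" "pairwise_vdisjoint_paths (P R S)" by (auto simp: comb_def)
    fix p assume p: "p \<in> P R S"
    show "path_between (range R) (range S) p" using comb_path(2,3)[OF cb p] by (auto simp: path_between_def)
    show "is_R_path V E ?R p" using F0D[OF RS] p RpM RpL by (auto simp: P_def)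
    fix R' S' q assume RS': "(R', S') \<in> F0" and q: "q \<in> P R' S'" and pq: "p \<noteq> q"
    have cb': "comb (range S') R' (P R' S')" using F0D[OF RS'] M L(2) by (auto simp: P_def)
    note ci = comb_inner[OF cb p]
    have qb: "set q \<subseteq> body R' (P R' S')" using path_subset_body[OF q] .
    show "inner_vertices p \<inter> set q = {}"
    proof (cases "R = R'")
      case True
      have "S = S'" using F0D[OF RS] F0D[OF RS'] True by auto
      hence "set p \<inter> set q = {}" using comb_disjoint_paths[OF cb p _ pq] q True by blast
      thus ?thesis using ci(3) by blast
    next
      case False
      consider "R \<in> M" "S = C" "P R S = Q R" "R' \<in> M" "P R' S' = Q R'"
        | "R \<in> M" "S = C" "P R S = Q R" "R' \<in> L" "P R' S' = Q2 R'" "S' = par R'"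
        | "R \<in> L" "S = par R" "P R S = Q2 R" "R' \<in> M" "P R' S' = Q R'"
        | "R \<in> L" "S = par R" "P R S = Q2 R" "R' \<in> L" "P R' S' = Q2 R'"
        using F0D[OF RS] F0D[OF RS'] by (auto simp: P_def)
      thus ?thesis
      proof cases
        case 1
        show ?thesis using MM[OF 1(1,4) False] ci(1)[unfolded 1(3), unfolded 1(2)] qb[unfolded 1(5)] by blast
      next
        case 2
        \<comment> \<open>A leaf comb meets \<open>Z\<close> only on its parent. If the parent is
          \<open>R\<close>, the inner vertices of \<open>p\<close> avoid it as the spine; otherwise
          it is disjoint from the whole comb of \<open>R\<close>.\<close>
        have "inner_vertices p \<inter> set q \<subseteq> range (par R')" using LZ[OF 2(4)] bZ[OF 2(1)] ci(1)[unfolded 2(3)] qb[unfolded 2(5)] by blast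
        moreover have "inner_vertices p \<inter> range (par R') = {}"
        proof (cases "par R' = R")
          case True thus ?thesis using ci(2) by simp
        next
          case False
          hence "range (par R') \<inter> body R (Q R) = {}" using MMr[of "par R'" R] L(1)[OF 2(4)] 2(1) by blast
          thus ?thesis using ci(1)[unfolded 2(3)] by blast
        qed
        ultimately show ?thesis by blast
      next
        case 3
        have "inner_vertices p \<inter> set q \<subseteq> range (par R)" using LZ[OF 3(1)] bZ[OF 3(4)] ci(1)[unfolded 3(3)] qb[unfolded 3(5)] by blast
        thus ?thesis using ci(1)[unfolded 3(2)] by blast
      next
        case 4
        have "inner_vertices p \<inter> set q \<subseteq> range (par R)" using LL[OF 4(1,4) False] ci(1)[unfolded 4(3)] qb[unfolded 4(5)] by blast
        thus ?thesis using ci(1)[unfolded 4(2)] by blast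
      qed
    qed
  next
    fix R S assume R: "R \<in> ?R" and S: "S \<in> ?R"
    let ?F = "F0 \<union> F0\<inverse>"
    have toC: "(R, C) \<in> ?F\<^sup>* \<and> (C, R) \<in> ?F\<^sup>*" if "R \<in> ?R" for R
    proof -
      have m: "(R, C) \<in> ?F \<and> (C, R) \<in> ?F" if "R \<in> M" for R using that by (auto simp: F0_def)
      have l: "(R, par R) \<in> ?F \<and> (par R, R) \<in> ?F" if "R \<in> L" for R using that by (auto simp: F0_def)
      consider "R = C" | "R \<in> M" | "R \<in> L" using \<open>R \<in> ?R\<close> by blast
      thus ?thesis
      proof cases
        case 2 thus ?thesis using m by blast
      next
        case 3
        hence "(R, par R) \<in> ?F" "(par R, C) \<in> ?F" "(C, par R) \<in> ?F" "(par R, R) \<in> ?F" using m[OF L(1)] l by blast+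
        thus ?thesis by (meson converse_rtrancl_into_rtrancl r_into_rtrancl)
      qed simp
    qed
    show "(R, S) \<in> ?F\<^sup>*" using toC[OF R] toC[OF S] rtrancl_trans by metis
  qed
qed

text \<open>Combs with equal tooth sets are disjoint outside the teeth, so infinitely many of them
  always leave one that avoids a given finite set; it links any tooth outside that set to a spine,
  and equivalence of the spines links different tooth sets. Thus one ray \<open>C\<close> can visit
  each of the countably many tooth sets infinitely often. It may run through bodies of combs, but
  having countably many vertices it spoils only countably many of them.\<close>

lemma star_center:
  assumes e: "is_end V E \<epsilon>" and Le: "L \<subseteq> \<epsilon>"
    and cb: "\<And>R. R \<in> L \<Longrightarrow> comb (A R) R (Q R)" and teeth: "\<And>R. R \<in> L \<Longrightarrow> last ` Q R = A R"
    and dj: "\<And>R S. R \<in> L \<Longrightarrow> S \<in> L \<Longrightarrow> R \<noteq> S \<Longrightarrow> body R (Q R) \<inter> body S (Q S) \<subseteq> A R \<inter> A S"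
    and cnt: "countable (A ` L)" and cls: "\<And>R. R \<in> L \<Longrightarrow> infinite {S \<in> L. A S = A R}" and ne: "L \<noteq> {}"
  shows "\<exists>C L' Q'. C \<in> \<epsilon> \<and> L' \<subseteq> L \<and> countable (L - L') \<and> (\<forall>R\<in>L'. comb (range C) R (Q' R)) \<and>
     (\<forall>R\<in>L'. \<forall>S\<in>L'. R \<noteq> S \<longrightarrow> body R (Q' R) \<inter> body S (Q' S) \<subseteq> range C)"
proof -
  define B where "B = from_nat_into (A ` L)"
  have B: "\<exists>R\<in>L. A R = B n" for n using from_nat_into[of "A ` L" n] ne by (auto simp: B_def)
  have BA: "\<exists>n. B n = A R" if "R \<in> L" for R
    using cnt that unfolding B_def by (meson from_nat_into_surj imageI)
  have dj': "(body R (Q R) - A R) \<inter> (body S (Q S) - A S) = {}" if "R \<in> L" "S \<in> L" "R \<noteq> S" for R S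
    using dj[OF that] by blast
  have infA: "infinite (A R)" if "R \<in> L" for R
    using comb_teeth_infinite[OF cb[OF that]] unfolding teeth[OF that] .
  \<comment> \<open>Here the classes of equal tooth sets must be infinite: the replacement comb
    keeps the tooth set of \<open>R\<close> while dodging \<open>X\<close>.\<close>
  have av: "\<exists>S\<in>L. A S = A R \<and> (body S (Q S) - A S) \<inter> X = {}" if "R \<in> L" "finite X" for R X
    using infinite_bodies_avoid[of "{S \<in> L. A S = A R}" X "\<lambda>S. body S (Q S) - A S"] cls[OF that(1)] that(2) dj' by blast
  have tooth: "conn E (V - X) a (S i)" if S: "S \<in> L" "(body S (Q S) - A S) \<inter> X = {}" and a: "a \<in> A S" "a \<notin> X" for S X a i
  proof -
    have "a \<in> last ` Q S" using teeth[OF S(1)] a by simp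
    then obtain p where p: "p \<in> Q S" "last p = a" by blast
    have sp: "set p \<subseteq> V - X"
    proof
      fix x assume x: "x \<in> set p"
      hence xb: "x \<in> body S (Q S)" using path_subset_body[OF p(1), of S] by blast
      moreover have "x \<notin> X"
      proof (cases "x \<in> A S")
        case True
        hence "x = a" using comb_path(5)[OF cb[OF S(1)] p(1)] x p(2) by auto
        thus ?thesis using a by blast
      qed (use xb S(2) in blast)
      ultimately show "x \<in> V - X" using comb_subset_V[OF cb[OF S(1)]] by blast
    qed
    moreover have "range S \<subseteq> V - X" using comb_minus[OF cb[OF S(1)]] S(2) comb_subset_V[OF cb[OF S(1)]] by blast
    ultimately show ?thesis using comb_conn[OF cb[OF S(1)] p(1)] p(2) by blast
  qed
  have AV: "A R \<subseteq> V" if "R \<in> L" for R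
    using comb_body_Int[OF cb[OF that]] comb_subset_V[OF cb[OF that]] unfolding teeth[OF that] by blast
  have "\<exists>C. is_ray V E C \<and> range C \<subseteq> V \<and> (\<forall>m. infinite (range C \<inter> B m))"
  proof (rule greedy_ray)
    fix X a n m assume X: "finite X" and a: "a \<in> B n" "a \<notin> X"
    obtain R0 where "R0 \<in> L" "A R0 = B n" using B by blast
    then obtain R where R: "R \<in> L" "A R = B n" "(body R (Q R) - A R) \<inter> X = {}" using av[OF _ X] by metis
    obtain S0 where S0: "S0 \<in> L" "A S0 = B m" using B by blast
    then obtain S where S: "S \<in> L" "A S = B m" "(body S (Q S) - A S) \<inter> X = {}" using av[OF _ X] by metis
    have "infinite (B m - insert a X)" using infA[OF S0(1)] S0(2) X by simp
    then obtain b where b: "b \<in> B m" "b \<noteq> a" "b \<notin> X" by (metis DiffE ex_in_conv finite.emptyI insertCI)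
    have "eqv R S" using end_eqv[OF e] R(1) S(1) Le by blast
    then obtain N where "\<forall>i\<ge>N. \<forall>j\<ge>N. conn E (V - X) (R i) (S j)" using X unfolding eqv_def by blast
    hence 1: "conn E (V - X) (R N) (S N)" by blast
    have 2: "conn E (V - X) a (R N)" by (rule tooth[OF R(1,3)]) (use R(2) a in auto)
    have 3: "conn E (V - X) b (S N)" by (rule tooth[OF S(1,3)]) (use S(2) b in auto)
    have "conn E (V - X) a b" using 1 2 conn_sym[OF 3] conn_trans by meson
    thus "\<exists>b\<in>B m. b \<noteq> a \<and> conn E (V - X) a b" using b by blast
  next
    show "B 0 \<noteq> {}" using B[of 0] infA by (metis finite.emptyI)
    show "B n \<subseteq> V" for n using B[of n] AV by blast
  qed simp
  then obtain C where C: "is_ray V E C" "\<And>m. infinite (range C \<inter> B m)" by blast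
  have CA: "infinite (range C \<inter> A R)" if "R \<in> L" for R using BA[OF that] C(2) by metis
  have "C \<in> \<epsilon>"
  proof (rule ray_mem_end[OF e C(1)])
    fix X :: "'v set" assume X: "finite X"
    obtain R0 where R0: "R0 \<in> L" using ne by blast
    then obtain R where R: "R \<in> L" "A R = A R0" "(body R (Q R) - A R) \<inter> X = {}" using av[OF _ X] by metis
    have "infinite (range C \<inter> A R - X)" using CA[OF R(1)] X by simp
    hence "\<exists>x. x \<in> range C \<inter> A R - X" by (metis ex_in_conv finite.emptyI)
    then obtain j where j: "C j \<in> A R" "C j \<notin> X" by blast
    have "conn E (V - X) (C j) (R 0)" using tooth[OF R(1,3) j] .
    moreover have "range R \<inter> X = {}" using comb_minus[OF cb[OF R(1)]] R(3) by blast
    ultimately show "\<exists>R\<in>\<epsilon>. \<exists>i j. range R \<inter> X = {} \<and> conn E (V - X) (C j) (R i)" using R(1) Le by blast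
  qed
  \<comment> \<open>The unspoilt combs: \<open>C\<close> meets them in teeth only, so cutting each
    down to the paths ending on \<open>C\<close> gives combs over \<open>C\<close>.\<close>
  define L' where "L' = {R \<in> L. (body R (Q R) - A R) \<inter> range C = {}}"
  define Q' where "Q' R = {p \<in> Q R. last p \<in> range C}" for R
  have cb': "comb (range C) R (Q' R)" if "R \<in> L'" for R
    unfolding Q'_def
  proof (rule comb_restrict)
    have RL: "R \<in> L" using that by (simp add: L'_def)
    show "comb (A R) R (Q R)" using cb[OF RL] .
    show "infinite (last ` Q R \<inter> range C)" using CA[OF RL] teeth[OF RL] by (simp add: Int_commute)
    show "range C \<inter> body R (Q R) \<subseteq> A R" using that unfolding L'_def by blast
  qed
  have "countable (L - L')"
  proof -
    have "\<forall>R\<in>L - L'. \<exists>x. x \<in> (body R (Q R) - A R) \<inter> range C" unfolding L'_def by blast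
    then obtain f where f: "\<And>R. R \<in> L - L' \<Longrightarrow> f R \<in> (body R (Q R) - A R) \<inter> range C" by metis
    have "inj_on f (L - L')"
    proof (rule inj_onI, rule ccontr)
      fix R S assume RS: "R \<in> L - L'" "S \<in> L - L'" "f R = f S" "R \<noteq> S"
      have "f R \<in> (body R (Q R) - A R) \<inter> (body S (Q S) - A S)" using f[OF RS(1)] f[OF RS(2)] RS(3) by auto
      thus False using dj'[of R S] RS by blast
    qed
    moreover have "countable (f ` (L - L'))" by (rule countable_subset[of _ "range C"]) (use f in auto)
    ultimately show ?thesis using countable_image_inj_on by blast
  qed
  moreover have "body R (Q' R) \<inter> body S (Q' S) \<subseteq> range C" if "R \<in> L'" "S \<in> L'" "R \<noteq> S" for R S
  proof
    fix x assume x: "x \<in> body R (Q' R) \<inter> body S (Q' S)"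
    have RL: "R \<in> L" "S \<in> L" using that by (auto simp: L'_def)
    have sub: "body R (Q' R) \<subseteq> body R (Q R)" "body S (Q' S) \<subseteq> body S (Q S)" by (auto simp: body_def Q'_def)
    have xA: "x \<in> A R" using dj[OF RL that(3)] x sub by blast
    hence "x \<notin> range R" using cb[OF RL(1)] by (auto simp: comb_def)
    then obtain p where p: "p \<in> Q' R" "x \<in> set p" using x by (auto simp: body_def)
    hence "x = last p" using comb_path(5)[OF cb[OF RL(1)], of p] xA by (auto simp: Q'_def)
    thus "x \<in> range C" using p by (auto simp: Q'_def)
  qed
  ultimately show ?thesis using \<open>C \<in> \<epsilon>\<close> cb' by (intro exI[of _ C] exI[of _ L'] exI[of _ Q']) (auto simp: L'_def)
qed

end

section \<open>Many combs with the same teeth\<close>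

text \<open>Zorn's lemma. \<open>P\<close> is not assumed symmetric, so an element that is to be
  absorbed has to be compatible in both orders.\<close>

lemma maximal_pairwise:
  "\<exists>M\<subseteq>S. pairwise P M \<and> (\<forall>z\<in>S. (\<forall>x\<in>M. x \<noteq> z \<longrightarrow> P x z \<and> P z x) \<longrightarrow> z \<in> M)"
proof -
  let ?A = "{M. M \<subseteq> S \<and> pairwise P M}"
  have "\<exists>M\<in>?A. \<forall>X\<in>?A. M \<subseteq> X \<longrightarrow> X = M"
  proof (rule subset_Zorn_nonempty)
    show "?A \<noteq> {}" by (auto simp: pairwise_def)
    fix C assume C: "C \<noteq> {}" "subset.chain ?A C"
    hence sub: "C \<subseteq> ?A" by (auto simp: subset.chain_def)
    have "pairwise P (\<Union>C)"
      unfolding pairwise_def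
    proof (intro ballI impI)
      fix x y assume xy: "x \<in> \<Union>C" "y \<in> \<Union>C" "x \<noteq> y"
      then obtain X Y where XY: "X \<in> C" "x \<in> X" "Y \<in> C" "y \<in> Y" by blast
      hence "X \<subseteq> Y \<or> Y \<subseteq> X" using C(2) XY(1,3) unfolding subset.chain_def by blast
      then obtain Z where "Z \<in> C" "x \<in> Z" "y \<in> Z" using XY by blast
      thus "P x y" using sub xy(3) unfolding pairwise_def by blast
    qed
    thus "\<Union>C \<in> ?A" using sub by blast
  qed
  then obtain M where M0: "M \<in> ?A" and mx: "\<forall>X\<in>?A. M \<subseteq> X \<longrightarrow> X = M" by (rule bexE)
  hence M: "M \<subseteq> S" "pairwise P M" by simp_all
  have "z \<in> M" if z: "z \<in> S" "\<forall>x\<in>M. x \<noteq> z \<longrightarrow> P x z \<and> P z x" for z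
  proof -
    have "pairwise P (insert z M)" using M(2) z(2) by (auto simp: pairwise_insert)
    hence "insert z M = M" using mx M(1) z(1) by (metis (mono_tags) insert_subset mem_Collect_eq subset_insertI)
    thus ?thesis by (metis insertI1)
  qed
  thus ?thesis using M by (intro exI[of _ M] conjI ballI impI) simp_all
qed

lemma uncountable_natLeq_ordLess: "\<not> countable A \<longleftrightarrow> natLeq <o |A|"
  unfolding countable_card_le_natLeq by (rule not_ordLeq_iff_ordLess[OF natLeq_Well_order card_of_Well_order])

lemma countable_ordLess: "countable A \<Longrightarrow> \<not> countable B \<Longrightarrow> |A| <o |B|"
  unfolding countable_card_le_natLeq[of A] uncountable_natLeq_ordLess by (rule ordLeq_ordLess_trans)

text \<open>The stages \<open>T i\<close> are indexed by omega_1, and later stages absorb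
  \<open>F\<close> of earlier ones. Since omega_1 is regular, a countable subset of the union
  already lies in one stage, which serves as \<open>U'\<close>. Stability of \<open>r\<close> and
  omega_1 < \<open>r\<close> keep the stages and their union below \<open>r\<close>.\<close>

lemma omega1_closure:
  fixes F :: "'a set \<Rightarrow> 'a set" and r :: "'b rel"
  assumes st: "stable r" and Cr: "Card_order r" and w: "cardSuc natLeq <o r"
    and U0: "|U0| <o r" and F: "\<And>U. |U| <o r \<Longrightarrow> |F U| <o r"
  shows "\<exists>U. U0 \<subseteq> U \<and> |U| <o r \<and> (\<forall>A\<subseteq>U. countable A \<longrightarrow> (\<exists>U'\<subseteq>U. A \<subseteq> U' \<and> F U' \<subseteq> U))"
proof -
  let ?s = "cardSuc natLeq"
  have Cs: "Card_order ?s" by (simp add: cardSuc_Card_order natLeq_Card_order)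
  hence Ws: "Well_order ?s" by (simp add: card_order_on_def)
  have infs: "infinite (Field ?s)" using cardSuc_finite[OF natLeq_Card_order] by (simp add: Field_natLeq)
  have infr: "infinite (Field r)"
  proof
    assume "finite (Field r)"
    moreover have "|Field ?s| \<le>o |Field r|"
      using w by (simp add: card_of_mono2 ordLess_imp_ordLeq)
    ultimately show False using infs card_of_ordLeq_finite by blast
  qed
  have wfs: "wf (?s - Id)" using Ws by (simp add: well_order_on_def)
  define T where "T = wfrec (?s - Id) (\<lambda>f i. U0 \<union> (\<Union>j\<in>underS ?s i. f j \<union> F (f j)))"
  have T: "T i = U0 \<union> (\<Union>j\<in>underS ?s i. T j \<union> F (T j))" for i
    unfolding T_def
    by (subst wfrec[OF wfs]) (auto simp: cut_apply underS_def)
  have uF: "|underS ?s i| <o r" for i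
  proof (cases "i \<in> Field ?s")
    case True
    thus ?thesis using card_of_underS[OF Cs] w ordLess_transitive by blast
  next
    case False
    hence "underS ?s i = {}" by (auto simp: underS_def Field_def)
    thus ?thesis using card_of_empty[of U0] U0 ordLeq_ordLess_trans by metis
  qed
  have Tr: "|T i| <o r" for i
  proof (induction i rule: wf_induct_rule[OF wfs])
    case (1 i)
    have "|T j \<union> F (T j)| <o r" if "j \<in> underS ?s i" for j
    proof -
      have "|T j| <o r" using 1[of j] that by (auto simp: underS_def)
      thus ?thesis using F card_of_Un_ordLess_infinite_Field[OF infr Cr] by blast
    qed
    hence "|\<Union>j\<in>underS ?s i. T j \<union> F (T j)| <o r" by (rule stable_UNION[OF st uF])
    thus ?case using card_of_Un_ordLess_infinite_Field[OF infr Cr U0] by (subst T) blast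
  qed
  have ch: "relChain ?s T"
    unfolding relChain_def
  proof (intro allI impI)
    fix i j assume "(i, j) \<in> ?s"
    hence "i = j \<or> i \<in> underS ?s j" by (auto simp: underS_def)
    thus "T i \<subseteq> T j" using T[of j] by auto
  qed
  let ?U = "\<Union>i\<in>Field ?s. T i"
  have "|Field ?s| <o r" using card_of_Field_ordIso[OF Cs] w ordIso_ordLess_trans by blast
  hence "|?U| <o r" using stable_UNION[OF st] Tr by blast
  moreover have "Field ?s \<noteq> {}" using infs by auto
  hence "U0 \<subseteq> ?U" using T by blast
  moreover have "\<exists>U'\<subseteq>?U. A \<subseteq> U' \<and> F U' \<subseteq> ?U" if A: "A \<subseteq> ?U" "countable A" for A
  proof -
    have "\<exists>i\<in>Field ?s. A \<subseteq> T i"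
      by (rule cardSuc_UNION[OF natLeq_Card_order _ ch A(1)]) (use A(2) in \<open>simp_all add: Field_natLeq countable_card_le_natLeq\<close>)
    then obtain i where i: "i \<in> Field ?s" "A \<subseteq> T i" by blast
    obtain b where b: "b \<in> Field ?s" "i \<noteq> b" "(i, b) \<in> ?s" using infinite_Card_order_limit[OF Cs infs i(1)] by blast
    hence "F (T i) \<subseteq> T b" using T[of b] by (auto simp: underS_def)
    thus ?thesis using i b by (intro exI[of _ "T i"]) blast
  qed
  ultimately show ?thesis by (intro exI[of _ ?U]) blast
qed

context ugraph
begin

lemma comb_family:
  assumes ray: "\<And>R. R \<in> \<R> \<Longrightarrow> is_ray V E R" and eq: "\<And>R S. R \<in> \<R> \<Longrightarrow> S \<in> \<R> \<Longrightarrow> eqv R S"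
    and dis: "disjoint_rays \<R>" and st: "stable |\<R>|" and unc: "\<not> countable \<R>"
    and P: "\<And>U :: 'v set. |U| <o |\<R>| \<Longrightarrow> |{A. A \<subseteq> U \<and> countable A}| <o |\<R>|"
  shows "\<exists>A \<R>' Q. \<R>' \<subseteq> \<R> \<and> |\<R>'| =o |\<R>| \<and> (\<forall>R\<in>\<R>'. comb A R (Q R) \<and> last ` Q R = A) \<and>
     (\<forall>R\<in>\<R>'. \<forall>S\<in>\<R>'. R \<noteq> S \<longrightarrow> body R (Q R) \<inter> body S (Q S) \<subseteq> A)"
proof -
  let ?r = "|\<R>|"
  have Cr: "Card_order ?r" by (rule card_of_Card_order)
  \<comment> \<open>Candidates are pairs of spine and path system, because one spine carries many
    combs. The teeth are required to be all of \<open>A\<close>, not merely to lie in it.\<close>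
  define S where "S A = {(R, Q). R \<in> \<R> \<and> comb A R Q \<and> last ` Q = A}" for A
  define ok where "ok A x y \<longleftrightarrow> body (fst x) (snd x) \<inter> body (fst y) (snd y) \<subseteq> A" for A and x y :: "(nat \<Rightarrow> 'v) \<times> 'v list set"
  have "\<forall>A. \<exists>M\<subseteq>S A. pairwise (ok A) M \<and> (\<forall>z\<in>S A. (\<forall>x\<in>M. x \<noteq> z \<longrightarrow> ok A x z \<and> ok A z x) \<longrightarrow> z \<in> M)"
    using maximal_pairwise by blast
  then obtain M where M: "\<And>A. M A \<subseteq> S A" "\<And>A. pairwise (ok A) (M A)"
    "\<And>A z. z \<in> S A \<Longrightarrow> (\<forall>x\<in>M A. x \<noteq> z \<longrightarrow> ok A x z \<and> ok A z x) \<Longrightarrow> z \<in> M A"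
    by metis
  have Mcomb: "fst x \<in> \<R>" "comb A (fst x) (snd x)" "last ` snd x = A" if "x \<in> M A" for x A
    using M(1)[of A] that by (auto simp: S_def)
  \<comment> \<open>Two members with a common spine would have that spine inside \<open>A\<close>,
    which no comb over \<open>A\<close> allows. So the size of a family counts spines.\<close>
  have injM: "inj_on fst (M A)" for A
  proof (rule inj_onI, rule ccontr)
    fix x y assume xy: "x \<in> M A" "y \<in> M A" "fst x = fst y" "x \<noteq> y"
    hence "ok A x y" using M(2)[of A] by (auto simp: pairwise_def)
    hence "range (fst x) \<subseteq> A" using xy(3) range_subset_body[of "fst x" "snd x"] range_subset_body[of "fst y" "snd y"]
      unfolding ok_def by auto
    thus False using Mcomb(2)[OF xy(1)] by (auto simp: comb_def)
  qed
  show ?thesis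
  proof (cases "\<exists>A. ?r \<le>o |M A|")
    case True
    then obtain A where A: "?r \<le>o |M A|" by blast
    let ?R = "fst ` M A"
    have "\<exists>Q. (R, Q) \<in> M A" if "R \<in> ?R" for R using that by force
    then obtain Q where Q: "\<And>R. R \<in> ?R \<Longrightarrow> (R, Q R) \<in> M A" by metis
    have sub: "?R \<subseteq> \<R>" using Mcomb by auto
    have "|M A| \<le>o |?R|" using injM[of A] card_of_ordLeq by blast
    hence "?r \<le>o |?R|" using A ordLeq_transitive by blast
    hence "|?R| =o ?r" using sub card_of_mono1 ordIso_iff_ordLeq by blast
    moreover have "comb A R (Q R) \<and> last ` Q R = A" if "R \<in> ?R" for R
      using Mcomb(2,3)[OF Q[OF that]] by simp
    moreover have "body R (Q R) \<inter> body T (Q T) \<subseteq> A" if "R \<in> ?R" "T \<in> ?R" "R \<noteq> T" for R T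
    proof -
      have "ok A (R, Q R) (T, Q T)" using M(2)[of A] Q[OF that(1)] Q[OF that(2)] that(3) by (auto simp: pairwise_def)
      thus ?thesis by (simp add: ok_def)
    qed
    ultimately show ?thesis using sub by (intro exI[of _ A] exI[of _ ?R] exI[of _ Q] conjI ballI impI) simp_all
  next
    case False
    hence small: "|M A| <o ?r" for A by (meson card_of_Well_order not_ordLeq_iff_ordLess)
    obtain R0 where R0: "R0 \<in> \<R>" using unc by (metis countable_empty ex_in_conv)
    have cr0: "|range R0| <o ?r" by (rule countable_ordLess[OF _ unc]) simp
    \<comment> \<open>Every subset of a ray is countable, so the assumption for one ray puts the
      continuum, and therefore omega_1, below the number of rays.\<close>
    have w: "cardSuc natLeq <o ?r"
    proof -
      have "countable (range R0)" by simp
      hence "{A. A \<subseteq> range R0 \<and> countable A} = Pow (range R0)" using countable_subset by blast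
      hence "|Pow (range R0)| <o ?r" using P[OF cr0] by simp
      moreover have "natLeq <o |Pow (range R0)|"
      proof -
        have "infinite (range R0)" using ray[OF R0] by (simp add: is_ray_def range_inj_infinite)
        hence "natLeq \<le>o |range R0|" using infinite_iff_natLeq_ordLeq by blast
        thus ?thesis using card_of_Pow ordLeq_ordLess_trans by blast
      qed
      hence "cardSuc natLeq \<le>o |Pow (range R0)|" by (intro cardSuc_least natLeq_Card_order card_of_Card_order)
      ultimately show ?thesis using ordLeq_ordLess_trans by blast
    qed
    define F where "F U = (\<Union>A\<in>{A. A \<subseteq> U \<and> countable A}. \<Union>x\<in>M A. body (fst x) (snd x))" for U
    have F: "|F U| <o ?r" if "|U| <o ?r" for U :: "'v set"
      unfolding F_def
    proof (rule stable_UNION[OF st P[OF that]], rule stable_UNION[OF st small])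
      fix A x assume "x \<in> M A"
      hence "countable (body (fst x) (snd x))" by (rule countable_body[OF Mcomb(2)])
      thus "|body (fst x) (snd x)| <o ?r" by (rule countable_ordLess[OF _ unc])
    qed
    have "\<exists>U. range R0 \<subseteq> U \<and> |U| <o ?r \<and> (\<forall>A\<subseteq>U. countable A \<longrightarrow> (\<exists>U'\<subseteq>U. A \<subseteq> U' \<and> F U' \<subseteq> U))"
      by (rule omega1_closure[OF st Cr w cr0]) (rule F)
    then obtain U where U: "range R0 \<subseteq> U" "|U| <o ?r" "\<And>A. A \<subseteq> U \<Longrightarrow> countable A \<Longrightarrow> \<exists>U'\<subseteq>U. A \<subseteq> U' \<and> F U' \<subseteq> U"
      by (elim exE conjE) (rule that, auto)
    \<comment> \<open>Disjoint rays meeting \<open>U\<close> would inject into \<open>U\<close>,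
      which has fewer elements than there are rays.\<close>
    have "\<exists>R\<in>\<R>. range R \<inter> U = {}"
    proof (rule ccontr)
      assume "\<not> ?thesis"
      hence "\<forall>R\<in>\<R>. \<exists>x. x \<in> range R \<inter> U" by blast
      then obtain f where f: "\<And>R. R \<in> \<R> \<Longrightarrow> f R \<in> range R \<inter> U" by metis
      have "inj_on f \<R>"
      proof (rule inj_onI, rule ccontr)
        fix R T assume RT: "R \<in> \<R>" "T \<in> \<R>" "f R = f T" "R \<noteq> T"
        have "f R \<in> range R \<inter> range T" using f[OF RT(1)] f[OF RT(2)] RT(3) by auto
        thus False using dis RT unfolding disjoint_rays_def by blast
      qed
      moreover have "f ` \<R> \<subseteq> U" using f by blast
      ultimately have "?r \<le>o |U|" using card_of_ordLeq by blast
      thus False using U(2) not_ordLess_ordLeq by blast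
    qed
    then obtain R where R: "R \<in> \<R>" "range R \<inter> U = {}" by blast
    obtain Q where Q: "comb U R Q" using comb_exists[OF ray[OF R(1)] U(1) R(2) eq[OF R(1) R0]] by blast
    define A where "A = last ` Q"
    have AU: "A \<subseteq> U" using comb_path(3)[OF Q] by (auto simp: A_def)
    have Aeq: "body R Q \<inter> U = A" using comb_body_Int[OF Q] by (simp add: A_def)
    have cA: "countable A" using countable_comb[OF Q] by (simp add: A_def)
    have "infinite (last ` Q)" by (rule comb_teeth_infinite[OF Q])
    hence "comb A R {p \<in> Q. last p \<in> A}"
      by (intro comb_restrict[OF Q]) (use AU in \<open>auto simp: A_def\<close>)
    moreover have "{p \<in> Q. last p \<in> A} = Q" by (auto simp: A_def)
    ultimately have cb: "comb A R Q" by simp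
    obtain U' where U': "U' \<subseteq> U" "A \<subseteq> U'" "F U' \<subseteq> U" using U(3)[OF AU cA] by blast
    have bU: "body (fst x) (snd x) \<subseteq> U" if "x \<in> M A" for x using U' cA that unfolding F_def by blast
    \<comment> \<open>All members of the family over \<open>A\<close> lie in \<open>U\<close>, while
      the new comb meets \<open>U\<close> only in \<open>A\<close>; it is therefore compatible with
      them and belongs to the family by maximality. Then its spine lies in \<open>U\<close>, which
      it was chosen to avoid.\<close>
    have "(R, Q) \<in> M A"
    proof (rule M(3))
      show "(R, Q) \<in> S A" using R cb by (simp add: S_def A_def)
      show "\<forall>x\<in>M A. x \<noteq> (R, Q) \<longrightarrow> ok A x (R, Q) \<and> ok A (R, Q) x"
        using bU Aeq unfolding ok_def by auto
    qed
    hence "range R \<subseteq> U" using bU[of "(R, Q)"] range_subset_body[of R Q] by auto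
    hence "R 0 \<in> range R \<inter> U" by blast
    thus ?thesis using R(2) by simp
  qed
qed

end

section \<open>Cardinal arithmetic\<close>

lemma card_of_linear:
  shows card_of_total: "x \<in> X \<Longrightarrow> y \<in> X \<Longrightarrow> (x, y) \<in> |X| \<or> (y, x) \<in> |X|"
    and card_of_trans: "(x, y) \<in> |X| \<Longrightarrow> (y, z) \<in> |X| \<Longrightarrow> (x, z) \<in> |X|"
    and card_of_antisym: "(x, y) \<in> |X| \<Longrightarrow> (y, x) \<in> |X| \<Longrightarrow> x = y"
    and card_of_Field: "(x, y) \<in> |X| \<Longrightarrow> x \<in> X \<and> y \<in> X"
proof -
  have w: "Well_order |X|" by (rule card_of_Well_order)
  hence wo: "wo_rel |X|" by (simp add: wo_rel_def)
  show "x \<in> X \<Longrightarrow> y \<in> X \<Longrightarrow> (x, y) \<in> |X| \<or> (y, x) \<in> |X|"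
    using wo_rel.TOTALS[OF wo] by (simp add: Field_card_of)
  show "(x, y) \<in> |X| \<Longrightarrow> (y, z) \<in> |X| \<Longrightarrow> (x, z) \<in> |X|"
    using wo_rel.TRANS[OF wo] by (meson transD)
  show "(x, y) \<in> |X| \<Longrightarrow> (y, x) \<in> |X| \<Longrightarrow> x = y"
    using wo_rel.ANTISYM[OF wo] by (meson antisymD)
  show "(x, y) \<in> |X| \<Longrightarrow> x \<in> X \<and> y \<in> X"
    using Field_card_of[of X] by (metis FieldI1 FieldI2)
qed

lemma card_of_underS_ordLess: "x \<in> X \<Longrightarrow> |underS |X| x| <o |X|"
  using card_of_underS[OF card_of_Card_order, of x X] by (simp add: Field_card_of)

lemma underS_card_of_subset: "underS |X| x \<subseteq> X"
  using card_of_Field by (fastforce simp: underS_def)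

lemma card_of_ordLess_or_ordLeq: "|A| <o |B| \<or> |B| \<le>o |A|"
  by (rule ordLess_or_ordLeq[OF card_of_Well_order card_of_Well_order])

lemma finite_ordLess_infinite_card: "finite A \<Longrightarrow> infinite B \<Longrightarrow> |A| <o |B|"
  using card_of_ordLess_or_ordLeq[of A B] card_of_ordLeq_finite by blast

lemma not_cofinal_setD:
  assumes "A \<subseteq> X" "\<not> cofinal_set |X| A" shows "\<exists>x\<in>X. A \<subseteq> underS |X| x"
proof -
  obtain x where x: "x \<in> X" "\<And>b. b \<in> A \<Longrightarrow> (x, b) \<notin> |X|"
    using assms by (auto simp: cofinal_set_def Field_card_of)
  have "b \<in> underS |X| x" if "b \<in> A" for b
    using card_of_total[OF x(1), of b] card_of_total[OF x(1) x(1)] x(2)[OF that] assms(1) that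
    by (auto simp: underS_def)
  thus ?thesis using x by blast
qed

lemma finite_not_cofinal:
  assumes "infinite X" "finite A" shows "\<not> cofinal_set |X| A"
proof
  assume c: "cofinal_set |X| A"
  have "\<exists>x\<in>X. \<forall>b\<in>A. (b, x) \<in> |X|" if "A \<subseteq> X" using assms(2) that
  proof (induction A)
    case empty
    then show ?case using assms(1) by (metis ball_empty ex_in_conv finite.emptyI)
  next
    case (insert a A)
    then obtain x where x: "x \<in> X" "\<forall>b\<in>A. (b, x) \<in> |X|" by blast
    have "a \<in> X" using insert by blast
    thus ?case using card_of_total[OF \<open>a \<in> X\<close> x(1)] x card_of_trans card_of_total[OF \<open>a \<in> X\<close> \<open>a \<in> X\<close>]
      by (metis insert_iff)
  qed
  moreover have "A \<subseteq> X" using c by (simp add: cofinal_set_def Field_card_of)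
  ultimately obtain x where x: "x \<in> X" "\<forall>b\<in>A. (b, x) \<in> |X|" by blast
  obtain y where y: "y \<in> X" "x \<noteq> y" "(x, y) \<in> |X|"
    using infinite_Card_order_limit[OF card_of_Card_order, of X x] assms(1) x(1) by (auto simp: Field_card_of)
  obtain b where "b \<in> A" "(y, b) \<in> |X|" using c y(1) by (auto simp: cofinal_set_def Field_card_of)
  hence "(y, x) \<in> |X|" using x(2) card_of_trans by metis
  thus False using y card_of_antisym by metis
qed

text \<open>A cofinal \<open>A\<close> covers \<open>X\<close> by initial segments, each smaller
  than \<open>X\<close>; if \<open>A\<close> were smaller too, stability would make their union
  smaller than \<open>X\<close>.\<close>

lemma stable_cofinal_ordLeq:
  assumes "stable |X|" "infinite X" "cofinal_set |X| A" shows "|X| \<le>o |A|"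
proof (rule ccontr)
  assume "\<not> |X| \<le>o |A|"
  hence A: "|A| <o |X|" using card_of_ordLess_or_ordLeq by blast
  have AX: "A \<subseteq> X" using assms(3) by (simp add: cofinal_set_def Field_card_of)
  have "|insert a (underS |X| a)| <o |X|" if "a \<in> A" for a
  proof -
    have "|{a} \<union> underS |X| a| <o |X|"
      by (rule card_of_Un_ordLess_infinite[OF assms(2) _ card_of_underS_ordLess])
         (use that AX assms(2) in \<open>auto intro: finite_ordLess_infinite_card\<close>)
    thus ?thesis by simp
  qed
  hence "|\<Union>a\<in>A. insert a (underS |X| a)| <o |X|" by (rule stable_UNION[OF assms(1) A])
  moreover have "X \<subseteq> (\<Union>a\<in>A. insert a (underS |X| a))"
    using assms(3) by (fastforce simp: cofinal_set_def Field_card_of underS_def)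
  hence "|X| \<le>o |\<Union>a\<in>A. insert a (underS |X| a)|" by (rule card_of_mono1)
  ultimately show False using not_ordLess_ordLeq by blast
qed

lemma countable_not_cofinal:
  assumes "infinite X" "\<not> has_cf |X| natLeq" "A \<subseteq> X" "countable A"
  shows "\<exists>x\<in>X. A \<subseteq> underS |X| x"
proof (rule not_cofinal_setD[OF assms(3)], rule notI)
  assume c: "cofinal_set |X| A"
  have inf: "natLeq \<le>o |B|" if "cofinal_set |X| B" for B
    using finite_not_cofinal[OF assms(1)] that infinite_iff_natLeq_ordLeq by blast
  have "|A| \<le>o natLeq" using assms(4) by (simp add: countable_card_le_natLeq)
  hence "|A| =o natLeq" using inf[OF c] ordIso_iff_ordLeq by blast
  hence "has_cf |X| natLeq" unfolding has_cf_def using c inf by blast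
  thus False using assms(2) by blast
qed

text \<open>Letting \<open>X\<close> range over the element type of \<open>K\<close> captures all
  predecessors, because every cardinal below that of \<open>K\<close> belongs to a subset of
  \<open>K\<close>.\<close>

definition not_suc_cf_omega :: "'a set \<Rightarrow> bool" where
  "not_suc_cf_omega K \<longleftrightarrow> \<not> (\<exists>X :: 'a set. has_cf |X| natLeq \<and> |K| =o cardSuc |X| )"

lemma card_of_singletons: "|(\<lambda>x. {x}) ` A| =o |A|"
proof -
  have "bij_betw (\<lambda>x. {x}) A ((\<lambda>x. {x}) ` A)" by (intro inj_on_imp_bij_betw) (auto simp: inj_on_def)
  thus ?thesis by (meson card_of_ordIsoI ordIso_symmetric)
qed

text \<open>The cardinals compared with \<open>Pow A\<close>, in particular the field of the
  successor of the cardinal of \<open>A\<close>, are sets of sets. GCH is therefore taken one type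
  level up, and \<open>A\<close> is moved there by singletons.\<close>

lemma GCH_set_set:
  fixes A :: "'a set" and B :: "'a set set"
  assumes "GCH_type TYPE('a set)" "infinite A" shows "\<not> ( |A| <o |B| \<and> |B| <o |Pow A| )"
proof
  assume h: "|A| <o |B| \<and> |B| <o |Pow A|"
  let ?A = "(\<lambda>x. {x}) ` A"
  have inj: "inj_on (\<lambda>x. {x}) A" by (auto simp: inj_on_def)
  have "infinite ?A" using assms(2) inj by (simp add: finite_image_iff)
  moreover have "|?A| <o |B|" using h card_of_singletons ordIso_ordLess_trans by blast
  moreover have "|B| <o |Pow ?A|"
  proof -
    have "bij_betw (image (\<lambda>x. {x})) (Pow A) (Pow ?A)" by (rule bij_betw_Pow) (rule inj_on_imp_bij_betw[OF inj])
    hence "|Pow A| =o |Pow ?A|" by (rule card_of_ordIsoI)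
    thus ?thesis using h ordLess_ordIso_trans by blast
  qed
  ultimately show False using assms(1) unfolding GCH_type_def by blast
qed

lemma GCH_Pow_ordLeq:
  fixes A B :: "'a set"
  assumes "GCH_type TYPE('a set)" "infinite A" "|A| <o |B|" shows "|Pow A| \<le>o |B|"
proof (rule ccontr)
  assume "\<not> |Pow A| \<le>o |B|"
  hence l: "|B| <o |Pow A|" using card_of_ordLess_or_ordLeq by blast
  have i: "|(\<lambda>x. {x}) ` B| =o |B|" by (rule card_of_singletons)
  have "|A| <o |(\<lambda>x. {x}) ` B|" using assms(3) ordIso_symmetric[OF i] ordLess_ordIso_trans by blast
  moreover have "|(\<lambda>x. {x}) ` B| <o |Pow A|" using i l ordIso_ordLess_trans by blast
  ultimately show False using GCH_set_set[OF assms(1,2)] by blast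
qed

text \<open>Either the power set of \<open>U\<close> is already smaller than \<open>K\<close>, or
  GCH makes \<open>K\<close> the successor of \<open>U\<close>. In the latter case the cofinality of
  \<open>U\<close> is not \<omega>, so each countable subset lies below some point of
  \<open>U\<close>, and under GCH each proper initial segment has at most as many subsets as
  \<open>U\<close> has elements.\<close>

lemma card_of_countable_subsets_ordLess:
  fixes K :: "'a set" and U :: "'c set"
  assumes GCH: "GCH_type TYPE('a set)" and unc: "\<not> countable K" and good: "not_suc_cf_omega K"
    and U: "|U| <o |K|"
  shows "|{A. A \<subseteq> U \<and> countable A}| <o |K|"
proof -
  \<comment> \<open>\<open>U\<close> has a different element type; its copy inside \<open>K\<close>
    is where GCH and the hypothesis on \<open>K\<close> apply.\<close>
  obtain f where f: "inj_on f U" "f ` U \<subseteq> K" using ordLess_imp_ordLeq[OF U] card_of_ordLeq by metis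
  let ?U = "f ` U" and ?C = "{A. A \<subseteq> f ` U \<and> countable A}"
  have U': "|?U| <o |K|" using card_of_image U ordLeq_ordLess_trans by blast
  have "inj_on (image f) {A. A \<subseteq> U \<and> countable A}"
    using f(1) by (auto simp: inj_on_def inj_on_image_eq_iff)
  moreover have "image f ` {A. A \<subseteq> U \<and> countable A} \<subseteq> ?C" by auto
  ultimately have le: "|{A. A \<subseteq> U \<and> countable A}| \<le>o |?C|" using card_of_ordLeq by blast
  have CP: "|?C| \<le>o |Pow ?U|" by (rule card_of_mono1) blast
  have "|?C| <o |K|"
  proof (cases "finite ?U")
    case True
    hence "finite ?C" by (auto intro: finite_subset[of _ "Pow ?U"])
    thus ?thesis using countable_ordLess[OF countable_finite unc] by blast
  next
    case inf: False
    show ?thesis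
    proof (cases "|Pow ?U| <o |K|")
      case True
      thus ?thesis using CP ordLeq_ordLess_trans by blast
    next
      case False
      hence "|K| \<le>o |Pow ?U|" using card_of_ordLess_or_ordLeq by blast
      hence KP: "|K| =o |Pow ?U|" using GCH_Pow_ordLeq[OF GCH inf U'] ordIso_iff_ordLeq by blast
      let ?s = "cardSuc |?U|"
      have Cs: "Card_order ?s" by (rule cardSuc_Card_order[OF card_of_Card_order])
      have Fs: "|Field ?s| =o ?s" by (rule card_of_Field_ordIso[OF Cs])
      have "|K| =o ?s"
      proof (rule ccontr)
        assume n: "\<not> |K| =o ?s"
        have "?s \<le>o |K|" by (rule cardSuc_least[OF card_of_Card_order card_of_Card_order U'])
        hence "?s <o |K|" using n ordIso_symmetric ordLeq_iff_ordLess_or_ordIso by blast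
        \<comment> \<open>Were the successor of \<open>?U\<close> below \<open>K\<close>, it would
          lie strictly between \<open>?U\<close> and its power set.\<close>
        hence "|Field ?s| <o |Pow ?U|" using Fs KP ordIso_ordLess_trans ordLess_ordIso_trans by blast
        moreover have "|?U| <o |Field ?s|"
          using cardSuc_greater[OF card_of_Card_order] ordIso_symmetric[OF Fs] ordLess_ordIso_trans by blast
        ultimately show False using GCH_set_set[OF GCH inf] by blast
      qed
      hence cf: "\<not> has_cf |?U| natLeq" using good unfolding not_suc_cf_omega_def by blast
      have "?C \<subseteq> (\<Union>u\<in>?U. Pow (underS |?U| u))"
      proof
        fix A assume "A \<in> ?C"
        hence "\<exists>u\<in>?U. A \<subseteq> underS |?U| u" by (intro countable_not_cofinal[OF inf cf]) auto
        thus "A \<in> (\<Union>u\<in>?U. Pow (underS |?U| u))" by (simp only: UN_iff Pow_iff)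
      qed
      hence "|?C| \<le>o |\<Union>u\<in>?U. Pow (underS |?U| u)|" by (rule card_of_mono1)
      moreover have "|\<Union>u\<in>?U. Pow (underS |?U| u)| \<le>o |?U|"
      proof (rule card_of_UNION_ordLeq_infinite[OF inf card_of_mono1[OF subset_refl]], rule ballI)
        show "|Pow (underS |?U| u)| \<le>o |?U|" if u: "u \<in> ?U" for u
        proof (cases "finite (underS |?U| u)")
          case True
          thus ?thesis using finite_ordLess_infinite_card[OF _ inf] ordLess_imp_ordLeq by blast
        next
          case False
          thus ?thesis using GCH_Pow_ordLeq[OF GCH] card_of_underS_ordLess[OF u] by blast
        qed
      qed
      ultimately have "|?C| \<le>o |?U|" by (rule ordLeq_transitive)
      thus ?thesis using U' by (rule ordLeq_ordLess_trans)
    qed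
  qed
  thus ?thesis using le ordLeq_ordLess_trans by blast
qed

section \<open>Cofinality and the decomposition of singular cardinals\<close>

definition min_cofinal :: "'a set \<Rightarrow> 'a set \<Rightarrow> bool" where
  "min_cofinal K Y \<longleftrightarrow> cofinal_set |K| Y \<and> (\<forall>A. cofinal_set |K| A \<longrightarrow> |Y| \<le>o |A| )"

lemma min_cofinal_exists: "\<exists>Y. min_cofinal K Y"
proof -
  let ?R = "card_of ` {A. cofinal_set |K| A}"
  have "cofinal_set |K| K" using card_of_total[of _ K] by (fastforce simp: cofinal_set_def Field_card_of)
  hence "?R \<noteq> {}" by blast
  then obtain r where "r \<in> ?R" "\<forall>r'\<in>?R. r \<le>o r'"
    using exists_minim_Card_order[of ?R] by (auto simp: card_of_Card_order)
  thus ?thesis unfolding min_cofinal_def by blast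
qed

lemma min_cofinal_subset: "min_cofinal K Y \<Longrightarrow> Y \<subseteq> K"
  by (simp add: min_cofinal_def cofinal_set_def Field_card_of)

lemma min_cofinal_has_cf: "min_cofinal K Y \<Longrightarrow> has_cf |K| |Y|"
  unfolding min_cofinal_def has_cf_def using card_of_refl by blast

lemma min_cofinal_bounded:
  assumes "min_cofinal K Y" "A \<subseteq> K" "|A| <o |Y|" shows "\<exists>x\<in>K. A \<subseteq> underS |K| x"
  using not_cofinal_setD[OF assms(2)] assms(1,3) not_ordLess_ordLeq unfolding min_cofinal_def by blast

lemma min_cofinal_infinite: "min_cofinal K Y \<Longrightarrow> infinite K \<Longrightarrow> infinite Y"
  using finite_not_cofinal unfolding min_cofinal_def by blast

text \<open>This is the regularity of cofinalities. \<open>Y\<close> carries its own cardinal order,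
  not the order inherited from \<open>K\<close>, so sets cofinal for the former have to be turned
  into sets cofinal for the latter.\<close>

lemma min_cofinal_stable:
  assumes "min_cofinal K Y" "infinite K" shows "stable |Y|"
proof (rule regularCard_stable[OF card_of_Card_order])
  show "infinite (Field |Y| )" using min_cofinal_infinite[OF assms] by (simp add: Field_card_of)
  show "regularCard |Y|"
    unfolding regularCard_def
  proof (intro allI impI, elim conjE)
    fix Z assume Z: "Z \<subseteq> Field |Y|" "cofinal Z |Y|"
    have ZY: "Z \<subseteq> Y" using Z(1) by (simp add: Field_card_of)
    \<comment> \<open>Initial segments of \<open>Y\<close> are smaller than \<open>Y\<close> and
      hence bounded in \<open>K\<close>. Their bounds, taken over a cofinal \<open>Z\<close>, are
      cofinal in \<open>K\<close>, so \<open>Z\<close> is as large as \<open>Y\<close>.\<close>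
    have "\<exists>b\<in>K. underS |Y| k \<subseteq> underS |K| b" if "k \<in> Z" for k
      by (rule min_cofinal_bounded[OF assms(1)])
         (use that ZY min_cofinal_subset[OF assms(1)] underS_card_of_subset[of Y k] card_of_underS_ordLess[of k Y] in auto)
    then obtain b where b: "\<And>k. k \<in> Z \<Longrightarrow> b k \<in> K" "\<And>k. k \<in> Z \<Longrightarrow> underS |Y| k \<subseteq> underS |K| (b k)" by metis
    have "cofinal_set |K| (b ` Z)"
      unfolding cofinal_set_def
    proof (intro conjI ballI)
      show "b ` Z \<subseteq> Field |K|" using b(1) by (auto simp: Field_card_of)
      fix a assume "a \<in> Field |K|"
      then obtain y where y: "y \<in> Y" "(a, y) \<in> |K|" using assms(1) by (auto simp: min_cofinal_def cofinal_set_def)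
      then obtain k where k: "k \<in> Z" "y \<noteq> k" "(y, k) \<in> |Y|" using Z(2) by (auto simp: cofinal_def Field_card_of)
      hence "y \<in> underS |K| (b k)" using b(2)[OF k(1)] by (auto simp: underS_def)
      hence "(a, b k) \<in> |K|" using y(2) card_of_trans by (fastforce simp: underS_def)
      thus "\<exists>c\<in>b ` Z. (a, c) \<in> |K|" using k(1) by blast
    qed
    hence "|Y| \<le>o |b ` Z|" using assms(1) by (simp add: min_cofinal_def)
    hence "|Y| \<le>o |Z|" using card_of_image ordLeq_transitive by blast
    moreover have "|Z| \<le>o |Y|" by (rule card_of_mono1[OF ZY])
    ultimately show "|Z| =o |Y|" using ordIso_iff_ordLeq by blast
  qed
qed

lemma ordLess_underS:
  assumes "|A| <o |K|" shows "\<exists>k\<in>K. |A| \<le>o |underS |K| k|"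
proof -
  obtain k where k: "k \<in> K" "|A| =o Restr |K| (underS |K| k)"
    using assms ordLess_iff_ordIso_Restr[OF card_of_Well_order card_of_Well_order, of A K] by (auto simp: Field_card_of)
  have "|A| =o |Field (Restr |K| (underS |K| k))|" using card_of_cong[OF k(2)] by (simp add: Field_card_of)
  moreover have "|Field (Restr |K| (underS |K| k))| \<le>o |underS |K| k|" by (rule card_of_mono1) (auto simp: Field_def)
  ultimately show ?thesis using k(1) ordIso_ordLeq_trans by blast
qed

lemma stable_cardSuc: "Card_order r \<Longrightarrow> infinite (Field r) \<Longrightarrow> stable (cardSuc r)"
  by (intro regularCard_stable cardSuc_Card_order infinite_cardSuc_regularCard) (simp_all add: cardSuc_finite)

text \<open>Infinite successor cardinals are regular, whereas a regular \<open>K\<close> would have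
  no cofinal subset as small as \<open>Y\<close>.\<close>

lemma singular_limit:
  assumes Y: "min_cofinal K Y" and inf: "infinite K" and sing: "|Y| <o |K|"
    and r: "Card_order r" "infinite (Field r)" "r <o |K|"
  shows "cardSuc r <o |K|"
proof (rule ccontr)
  assume n: "\<not> cardSuc r <o |K|"
  have "cardSuc r \<le>o |K|" by (rule cardSuc_least[OF r(1) card_of_Card_order r(3)])
  hence "|K| =o cardSuc r" using n ordLeq_iff_ordLess_or_ordIso ordIso_symmetric by blast
  hence "stable |K|" using stable_ordIso1[OF stable_cardSuc[OF r(1,2)]] by blast
  hence "|K| \<le>o |Y|" using stable_cofinal_ordLeq[OF _ inf] Y by (simp add: min_cofinal_def)
  thus False using sing not_ordLess_ordLeq by blast
qed

lemma singular_step: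
  fixes K :: "'a set"
  assumes Y: "min_cofinal K Y" and inf: "infinite K" and sing: "|Y| <o |K|"
    and W: "infinite W" "|W| <o |K|"
  shows "\<exists>L\<subseteq>K. |L| <o |K| \<and> |W| <o |L| \<and> stable |L| \<and> not_suc_cf_omega L"
proof -
  \<comment> \<open>The first successor could itself be the successor of a cardinal of cofinality
    \<omega>. The second cannot, since its predecessor is regular and uncountable.\<close>
  let ?a = "cardSuc |W|" and ?b = "cardSuc (cardSuc |W| )"
  have Ca: "Card_order ?a" "Card_order ?b" by (simp_all add: cardSuc_Card_order card_of_Card_order)
  have ia: "infinite (Field ?a)" using W(1) cardSuc_finite[OF card_of_Card_order, of W] by (simp add: Field_card_of)
  have lt: "|W| <o ?a" "?a <o ?b" by (rule cardSuc_greater[OF card_of_Card_order], rule cardSuc_greater[OF Ca(1)])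
  have "?a <o |K|" by (rule singular_limit[OF Y inf sing card_of_Card_order]) (use W in \<open>simp_all add: Field_card_of\<close>)
  hence bK: "?b <o |K|" by (rule singular_limit[OF Y inf sing Ca(1) ia])
  hence "|Field ?b| <o |K|" using card_of_Field_ordIso[OF Ca(2)] ordIso_ordLess_trans by blast
  then obtain L where L: "L \<subseteq> K" "|Field ?b| =o |L|" using internalize_card_of_ordLess[of "Field ?b" "|K|"] by (auto simp: Field_card_of)
  have Lb: "|L| =o ?b" using L(2) card_of_Field_ordIso[OF Ca(2)] ordIso_symmetric ordIso_transitive by blast
  have "|L| <o |K|" using Lb bK ordIso_ordLess_trans by blast
  moreover have "|W| <o |L|" using lt ordIso_symmetric[OF Lb] ordLess_transitive ordLess_ordIso_trans by blast
  moreover have "stable |L|" using stable_ordIso1[OF stable_cardSuc[OF Ca(1) ia] Lb] .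
  moreover have "not_suc_cf_omega L"
    unfolding not_suc_cf_omega_def
  proof (rule notI, elim exE conjE)
    fix X :: "'a set" assume X: "has_cf |X| natLeq" "|L| =o cardSuc |X|"
    have "?b =o cardSuc |X|" using Lb X(2) ordIso_symmetric ordIso_transitive by blast
    hence aX: "?a =o |X|" using cardSuc_invar_ordIso[OF Ca(1) card_of_Card_order] by blast
    have "stable ?a" by (rule stable_cardSuc[OF card_of_Card_order]) (use W(1) in \<open>simp add: Field_card_of\<close>)
    hence stX: "stable |X|" by (rule stable_ordIso1) (rule ordIso_symmetric[OF aX])
    have WX: "|W| <o |X|" using lt(1) aX ordLess_ordIso_trans by blast
    hence infX: "infinite X" using W(1) card_of_ordLeq_infinite ordLess_imp_ordLeq by blast
    obtain A where A: "cofinal_set |X| A" "|A| =o natLeq" using X(1) unfolding has_cf_def by blast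
    have "natLeq \<le>o |W|" using W(1) infinite_iff_natLeq_ordLeq by blast
    hence "|A| <o |X|" using A(2) WX ordIso_ordLeq_trans ordLeq_ordLess_trans by blast
    moreover have "|X| \<le>o |A|" by (rule stable_cofinal_ordLeq[OF stX infX A(1)])
    ultimately show False using not_ordLess_ordLeq by blast
  qed
  ultimately show ?thesis using L(1) by blast
qed

text \<open>Recursion along the order of \<open>Y\<close>. Exceeding the initial segment of
  \<open>K\<close> below \<open>y\<close> makes the sizes unbounded in \<open>K\<close>; exceeding
  \<open>Y\<close> leaves room to discard, from each summand, all combs that meet a set of about
  \<open>|Y|\<close> vertices.\<close>

lemma singular_decomposition:
  fixes K :: "'a set"
  assumes Y: "min_cofinal K Y" and inf: "infinite K" and sing: "|Y| <o |K|"
  shows "\<exists>L. \<forall>y\<in>Y. L y \<subseteq> K \<and> stable |L y| \<and> not_suc_cf_omega (L y) \<and> |Y| <o |L y| \<and>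
    |underS |K| y| <o |L y| \<and> (\<forall>z\<in>underS |Y| y. |L z| <o |L y| )"
proof -
  define P where "P f y L \<longleftrightarrow> (y \<in> Y \<longrightarrow> L \<subseteq> K \<and> |L| <o |K| \<and> stable |L| \<and> not_suc_cf_omega L \<and> |Y| <o |L| \<and>
    |underS |K| y| <o |L| \<and> (\<forall>z\<in>underS |Y| y. |f z| <o |L| ))" for f :: "'a \<Rightarrow> 'a set" and y and L :: "'a set"
  have YK: "Y \<subseteq> K" using min_cofinal_subset[OF Y] .
  have "\<exists>L. \<forall>y. P L y (L y)"
  proof (rule dependent_wf_choice)
    show "wf ( |Y| - Id)" using card_of_Well_order[of Y] by (simp add: well_order_on_def)
    show "P f x r = P g x r" if "\<And>z. (z, x) \<in> |Y| - Id \<Longrightarrow> f z = g z" for f g x r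
    proof -
      have "f z = g z" if "z \<in> underS |Y| x" for z using that \<open>\<And>z. (z, x) \<in> |Y| - Id \<Longrightarrow> f z = g z\<close> by (auto simp: underS_def)
      thus ?thesis unfolding P_def by auto
    qed
    fix y f assume IH: "\<And>z. (z, y) \<in> |Y| - Id \<Longrightarrow> P f z (f z)"
    show "\<exists>r. P f y r"
    proof (cases "y \<in> Y")
      case True
      have "|f z| <o |K|" if "z \<in> underS |Y| y" for z
        using IH[of z] that underS_card_of_subset[of Y y] unfolding P_def by (auto simp: underS_def)
      hence "\<exists>k\<in>K. |f z| \<le>o |underS |K| k|" if "z \<in> underS |Y| y" for z using ordLess_underS that by blast
      then obtain k where k: "\<And>z. z \<in> underS |Y| y \<Longrightarrow> k z \<in> K" "\<And>z. z \<in> underS |Y| y \<Longrightarrow> |f z| \<le>o |underS |K| (k z)|" by metis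
      \<comment> \<open>Fewer than \<open>|Y|\<close> earlier sizes occur, so the points
        \<open>k z\<close> measuring them have a common bound \<open>b\<close>, and the segment
        below \<open>b\<close> dominates them all.\<close>
      have "|k ` underS |Y| y| <o |Y|" using card_of_image card_of_underS_ordLess[OF True] ordLeq_ordLess_trans by blast
      then obtain b where b: "b \<in> K" "k ` underS |Y| y \<subseteq> underS |K| b" using min_cofinal_bounded[OF Y, of "k ` underS |Y| y"] k(1) by blast
      let ?W = "(underS |K| b \<union> underS |K| y) \<union> Y"
      have Wi: "infinite ?W" using min_cofinal_infinite[OF Y inf] by simp
      have WK: "|?W| <o |K|"
        by (intro card_of_Un_ordLess_infinite[OF inf] card_of_underS_ordLess sing b(1)) (use True YK in blast)
      obtain L where L: "L \<subseteq> K" "|L| <o |K|" "|?W| <o |L|" "stable |L|" "not_suc_cf_omega L"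
        using singular_step[OF Y inf sing Wi WK] by blast
      have sub: "|S| <o |L|" if "S \<subseteq> ?W" for S using card_of_mono1[OF that] L(3) ordLeq_ordLess_trans by blast
      have "|f z| <o |L|" if z: "z \<in> underS |Y| y" for z
      proof -
        have "underS |K| (k z) \<subseteq> underS |K| b"
        proof
          fix x assume x: "x \<in> underS |K| (k z)"
          have kb: "k z \<in> underS |K| b" using b(2) z by blast
          show "x \<in> underS |K| b" using x kb card_of_trans card_of_antisym unfolding underS_def by (metis (mono_tags, lifting) mem_Collect_eq)
        qed
        hence "|underS |K| (k z)| <o |L|" by (intro sub) blast
        thus ?thesis using k(2)[OF z] ordLeq_ordLess_trans by blast
      qed
      moreover have "|Y| <o |L|" "|underS |K| y| <o |L|" by (intro sub; blast)+
      ultimately have "P f y L" unfolding P_def using L by blast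
      thus ?thesis by blast
    qed (auto simp: P_def)
  qed
  then obtain L where L: "\<forall>y. P L y (L y)" by (rule exE)
  show ?thesis
  proof (intro exI[of _ L] ballI)
    fix y assume "y \<in> Y"
    thus "L y \<subseteq> K \<and> stable |L y| \<and> not_suc_cf_omega (L y) \<and> |Y| <o |L y| \<and>
      |underS |K| y| <o |L y| \<and> (\<forall>z\<in>underS |Y| y. |L z| <o |L y| )" using L unfolding P_def by blast
  qed
qed

text \<open>A subset \<open>J\<close> of full size is unbounded in the order of \<open>Y\<close>,
  and the sizes of the \<open>L y\<close> increase, so it suffices to dominate them along
  \<open>J\<close>. This permits dropping indices later.\<close>

lemma singular_sum:
  assumes Y: "min_cofinal K Y" and inf: "infinite K"
    and L: "\<And>y. y \<in> Y \<Longrightarrow> |underS |K| y| <o |L y|" "\<And>y z. y \<in> Y \<Longrightarrow> z \<in> underS |Y| y \<Longrightarrow> |L z| <o |L y|"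
    and J: "J \<subseteq> Y" "|J| =o |Y|" and S: "\<And>y. y \<in> J \<Longrightarrow> |L y| \<le>o |S|"
  shows "|K| \<le>o |S|"
proof (rule ccontr)
  assume "\<not> |K| \<le>o |S|"
  hence "|S| <o |K|" using card_of_ordLess_or_ordLeq by blast
  then obtain k where k: "k \<in> K" "|S| \<le>o |underS |K| k|" using ordLess_underS by blast
  obtain y where y: "y \<in> Y" "(k, y) \<in> |K|" using Y k(1) by (auto simp: min_cofinal_def cofinal_set_def Field_card_of)
  have "\<not> J \<subseteq> underS |Y| y"
  proof
    assume "J \<subseteq> underS |Y| y"
    hence "|J| <o |Y|" using card_of_mono1 card_of_underS_ordLess[OF y(1)] ordLeq_ordLess_trans by blast
    thus False using J(2) not_ordLess_ordIso by blast
  qed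
  then obtain j where j: "j \<in> J" "j \<notin> underS |Y| y" by blast
  have jY: "j \<in> Y" using j J by blast
  have "j = y \<or> y \<in> underS |Y| j" using card_of_total[OF jY y(1)] j(2) by (auto simp: underS_def)
  hence "|L y| \<le>o |L j|" using L(2)[OF jY] ordLess_imp_ordLeq card_of_mono1 by blast
  hence LS: "|L y| \<le>o |S|" using S[OF j(1)] ordLeq_transitive by blast
  have "underS |K| k \<subseteq> underS |K| y"
    using y(2) card_of_trans card_of_antisym unfolding underS_def by (smt (verit, ccfv_threshold) mem_Collect_eq subsetI)
  hence "|S| \<le>o |underS |K| y|" using k(2) card_of_mono1 ordLeq_transitive by blast
  hence "|S| <o |L y|" using L(1)[OF y(1)] ordLeq_ordLess_trans by blast
  thus False using LS not_ordLess_ordLeq by blast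
qed

section \<open>Uncountable degrees\<close>

lemma card_of_diff_small:
  assumes "infinite L" "L' \<subseteq> L" "|L - L'| <o |L|" shows "|L| \<le>o |L'|"
proof (rule ccontr)
  assume "\<not> |L| \<le>o |L'|"
  hence "|L'| <o |L|" using card_of_ordLess_or_ordLeq by blast
  hence "|L' \<union> (L - L')| <o |L|" using card_of_Un_ordLess_infinite[OF assms(1) _ assms(3)] by blast
  moreover have "L' \<union> (L - L') = L" using assms(2) by blast
  ultimately show False using ordLess_irreflexive by metis
qed

text \<open>Disjoint sets meeting \<open>Z\<close> inject into \<open>Z\<close>, so fewer than
  \<open>|F|\<close> of them are lost.\<close>

lemma card_of_avoiding:
  assumes "infinite F" "|Z| <o |F|"
    and d: "\<And>R S. R \<in> F \<Longrightarrow> S \<in> F \<Longrightarrow> R \<noteq> S \<Longrightarrow> B R \<inter> B S = {}"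
  shows "|F| \<le>o |{R \<in> F. B R \<inter> Z = {}}|"
proof (rule card_of_diff_small[OF assms(1)])
  let ?G = "{R \<in> F. B R \<inter> Z = {}}"
  have "\<forall>R\<in>F - ?G. \<exists>x. x \<in> B R \<inter> Z" by blast
  then obtain f where f: "\<And>R. R \<in> F - ?G \<Longrightarrow> f R \<in> B R \<inter> Z" by metis
  have "inj_on f (F - ?G)"
  proof (rule inj_onI, rule ccontr)
    fix R S assume RS: "R \<in> F - ?G" "S \<in> F - ?G" "f R = f S" "R \<noteq> S"
    have "f R \<in> B R \<inter> B S" using f[OF RS(1)] f[OF RS(2)] RS(3) by auto
    thus False using d[of R S] RS by blast
  qed
  moreover have "f ` (F - ?G) \<subseteq> Z" using f by blast
  ultimately have "|F - ?G| \<le>o |Z|" using card_of_ordLeq by blast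
  thus "|F - ?G| <o |F|" using assms(2) ordLeq_ordLess_trans by blast
qed blast

lemma uncountable_infinite: "\<not> countable A \<Longrightarrow> infinite A"
  using countable_finite by blast

lemma uncountable_ordLeq: "\<not> countable A \<Longrightarrow> |A| \<le>o |B| \<Longrightarrow> \<not> countable B"
  using ordLess_ordLeq_trans unfolding uncountable_natLeq_ordLess by blast

lemma infinite_ordLess_uncountable: "infinite A \<Longrightarrow> |A| <o |B| \<Longrightarrow> \<not> countable B"
  using ordLeq_ordLess_trans infinite_iff_natLeq_ordLeq unfolding uncountable_natLeq_ordLess by blast

section \<open>Stars of rays and regular uncountable degrees\<close>

context ugraph
begin

lemma end_comb_family:
  fixes \<R> :: "(nat \<Rightarrow> 'v) set"
  assumes GCH: "GCH_type TYPE((nat \<Rightarrow> 'v) set)" and e: "is_end V E \<epsilon>" and \<R>: "\<R> \<subseteq> \<epsilon>" "disjoint_rays \<R>"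
    and st: "stable |\<R>|" and unc: "\<not> countable \<R>" and good: "not_suc_cf_omega \<R>"
  shows "\<exists>A \<R>' Q. \<R>' \<subseteq> \<R> \<and> |\<R>'| =o |\<R>| \<and> (\<forall>R\<in>\<R>'. comb A R (Q R) \<and> last ` Q R = A) \<and>
     (\<forall>R\<in>\<R>'. \<forall>S\<in>\<R>'. R \<noteq> S \<longrightarrow> body R (Q R) \<inter> body S (Q S) \<subseteq> A)"
proof (rule comb_family[OF _ _ \<R>(2) st unc])
  show "\<And>R. R \<in> \<R> \<Longrightarrow> is_ray V E R" using end_is_ray[OF e] \<R>(1) by blast
  show "\<And>R S. R \<in> \<R> \<Longrightarrow> S \<in> \<R> \<Longrightarrow> eqv R S" using end_eqv[OF e] \<R>(1) by blast
  show "|{A. A \<subseteq> U \<and> countable A}| <o |\<R>|" if "|U| <o |\<R>|" for U :: "'v set"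
    by (rule card_of_countable_subsets_ordLess[OF GCH unc good that])
qed

lemma star_result:
  assumes e: "is_end V E \<epsilon>" and Le: "L \<subseteq> \<epsilon>"
    and cb: "\<And>R. R \<in> L \<Longrightarrow> comb (A R) R (Q R)" and teeth: "\<And>R. R \<in> L \<Longrightarrow> last ` Q R = A R"
    and dj: "\<And>R S. R \<in> L \<Longrightarrow> S \<in> L \<Longrightarrow> R \<noteq> S \<Longrightarrow> body R (Q R) \<inter> body S (Q S) \<subseteq> A R \<inter> A S"
    and cnt: "countable (A ` L)" and cls: "\<And>R. R \<in> L \<Longrightarrow> infinite {S \<in> L. A S = A R}" and unc: "\<not> countable L"
  shows "\<exists>\<R>\<subseteq>\<epsilon>. disjoint_rays \<R> \<and> |L| \<le>o |\<R>| \<and> admits_connected_ray_graph V E \<R>"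
proof -
  have ne: "L \<noteq> {}" using unc by auto
  have "\<exists>C L' Q'. C \<in> \<epsilon> \<and> L' \<subseteq> L \<and> countable (L - L') \<and> (\<forall>R\<in>L'. comb (range C) R (Q' R)) \<and>
     (\<forall>R\<in>L'. \<forall>S\<in>L'. R \<noteq> S \<longrightarrow> body R (Q' R) \<inter> body S (Q' S) \<subseteq> range C)"
    by (rule star_center[OF e Le cb teeth dj cnt cls ne])
  then obtain C L' Q' where C: "C \<in> \<epsilon>" "L' \<subseteq> L" "countable (L - L')" "\<forall>R\<in>L'. comb (range C) R (Q' R)"
     "\<forall>R\<in>L'. \<forall>S\<in>L'. R \<noteq> S \<longrightarrow> body R (Q' R) \<inter> body S (Q' S) \<subseteq> range C" by (elim exE conjE) (rule that)
  have "|L - L'| <o |L|" by (rule countable_ordLess[OF C(3) unc])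
  hence "|L| \<le>o |L'|" by (rule card_of_diff_small[OF uncountable_infinite[OF unc] C(2)])
  \<comment> \<open>The star is the tree without leaves, which is why an empty union is carried
    along.\<close>
  moreover have "|L'| \<le>o |insert C (L' \<union> {})|" by (rule card_of_mono1) blast
  ultimately have "|L| \<le>o |insert C (L' \<union> {})|" by (rule ordLeq_transitive)
  moreover have "disjoint_rays (insert C (L' \<union> {}))"
    by (rule tree_admits(1)[of L' C Q' _ "{}"]) (use C(4,5) in auto)
  moreover have "admits_connected_ray_graph V E (insert C (L' \<union> {}))"
    by (rule tree_admits(2)[of L' C Q' _ "{}"]) (use C(4,5) in auto)
  moreover have "insert C (L' \<union> {}) \<subseteq> \<epsilon>" using C(1,2) Le by blast
  ultimately show ?thesis by (intro exI[of _ "insert C (L' \<union> {})"]) simp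
qed

lemma regular_case:
  fixes \<R> :: "(nat \<Rightarrow> 'v) set"
  assumes GCH: "GCH_type TYPE((nat \<Rightarrow> 'v) set)" and e: "is_end V E \<epsilon>" and \<R>: "\<R> \<subseteq> \<epsilon>" "disjoint_rays \<R>"
    and st: "stable |\<R>|" and unc: "\<not> countable \<R>" and good: "not_suc_cf_omega \<R>"
  shows "\<exists>\<S>\<subseteq>\<epsilon>. disjoint_rays \<S> \<and> |\<R>| \<le>o |\<S>| \<and> admits_connected_ray_graph V E \<S>"
proof -
  obtain A \<R>' Q where R': "\<R>' \<subseteq> \<R>" "|\<R>'| =o |\<R>|" "\<forall>R\<in>\<R>'. comb A R (Q R) \<and> last ` Q R = A"
     "\<forall>R\<in>\<R>'. \<forall>S\<in>\<R>'. R \<noteq> S \<longrightarrow> body R (Q R) \<inter> body S (Q S) \<subseteq> A"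
    using end_comb_family[OF assms] by (elim exE conjE) (rule that)
  have le: "|\<R>| \<le>o |\<R>'|" using R'(2) ordIso_iff_ordLeq by blast
  have unc': "\<not> countable \<R>'" by (rule uncountable_ordLeq[OF unc le])
  have cA: "countable ((\<lambda>_. A) ` \<R>')" by (rule countable_subset[of _ "{A}"]) auto
  have "\<exists>\<S>\<subseteq>\<epsilon>. disjoint_rays \<S> \<and> |\<R>'| \<le>o |\<S>| \<and> admits_connected_ray_graph V E \<S>"
    by (rule star_result[OF e, of _ "\<lambda>_. A" Q])
       (use R'(1,3,4) \<R>(1) unc' uncountable_infinite[OF unc'] cA in auto)
  then obtain \<S> where "\<S> \<subseteq> \<epsilon>" "disjoint_rays \<S>" "|\<R>'| \<le>o |\<S>|" "admits_connected_ray_graph V E \<S>" by blast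
  thus ?thesis using le ordLeq_transitive by blast
qed

end

text \<open>
  \<open>Y\<close> represents the cofinality of \<open>|K|\<close>, the sizes of the \<open>L y\<close> are regular and increase to \<open>|K|\<close>, and \<open>F y\<close>
  consists of the spines of \<open>|L y|\<close> many combs with teeth \<open>A y\<close>; the combs for distinct \<open>y\<close> are already disjoint
  outside the tooth sets.
\<close>

locale singular_combs = ugraph V E for V :: "'v set" and E +
  fixes \<epsilon> K Y :: "(nat \<Rightarrow> 'v) set" and L F :: "(nat \<Rightarrow> 'v) \<Rightarrow> (nat \<Rightarrow> 'v) set"
    and A :: "(nat \<Rightarrow> 'v) \<Rightarrow> 'v set" and Q :: "(nat \<Rightarrow> 'v) \<Rightarrow> (nat \<Rightarrow> 'v) \<Rightarrow> 'v list set"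
  assumes e: "is_end V E \<epsilon>" and Ke: "K \<subseteq> \<epsilon>" and infK: "infinite K" and Y: "min_cofinal K Y"
    and L: "\<And>y. y \<in> Y \<Longrightarrow> stable |L y|" "\<And>y. y \<in> Y \<Longrightarrow> |Y| <o |L y|"
      "\<And>y. y \<in> Y \<Longrightarrow> |underS |K| y| <o |L y|" "\<And>y z. y \<in> Y \<Longrightarrow> z \<in> underS |Y| y \<Longrightarrow> |L z| <o |L y|"
    and F: "\<And>y. y \<in> Y \<Longrightarrow> F y \<subseteq> K" "\<And>y. y \<in> Y \<Longrightarrow> |L y| \<le>o |F y|"
    and cb: "\<And>y R. y \<in> Y \<Longrightarrow> R \<in> F y \<Longrightarrow> comb (A y) R (Q y R)"
    and teeth: "\<And>y R. y \<in> Y \<Longrightarrow> R \<in> F y \<Longrightarrow> last ` Q y R = A y"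
    and bb: "\<And>y R S. y \<in> Y \<Longrightarrow> R \<in> F y \<Longrightarrow> S \<in> F y \<Longrightarrow> R \<noteq> S \<Longrightarrow> body R (Q y R) \<inter> body S (Q y S) \<subseteq> A y"
    and bb2: "\<And>y z R S. y \<in> Y \<Longrightarrow> z \<in> Y \<Longrightarrow> y \<noteq> z \<Longrightarrow> R \<in> F y \<Longrightarrow> S \<in> F z \<Longrightarrow> body R (Q y R) \<inter> body S (Q z S) \<subseteq> A y \<inter> A z"
    and ba: "\<And>y z R. y \<in> Y \<Longrightarrow> z \<in> Y \<Longrightarrow> R \<in> F y \<Longrightarrow> body R (Q y R) \<inter> A z \<subseteq> A y"
begin

lemma infY: "infinite Y" using min_cofinal_infinite[OF Y infK] .

lemma L_unc: "y \<in> Y \<Longrightarrow> \<not> countable (L y)"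
  using infinite_ordLess_uncountable[OF infY L(2)] .

lemma F_unc: "y \<in> Y \<Longrightarrow> \<not> countable (F y)"
  using uncountable_ordLeq[OF L_unc F(2)] .

lemma A_countable: assumes "y \<in> Y" shows "countable (A y)"
proof -
  obtain R where R: "R \<in> F y" using F_unc[OF assms] by (metis countable_empty ex_in_conv)
  thus ?thesis using countable_comb[OF cb[OF assms R]] teeth[OF assms R] by (metis countable_image)
qed

lemma A_infinite: assumes "y \<in> Y" shows "infinite (A y)"
proof -
  obtain R where R: "R \<in> F y" using F_unc[OF assms] by (metis countable_empty ex_in_conv)
  show ?thesis using comb_teeth_infinite[OF cb[OF assms R]] unfolding teeth[OF assms R] .
qed

lemma F_disjoint: "y \<in> Y \<Longrightarrow> z \<in> Y \<Longrightarrow> y \<noteq> z \<Longrightarrow> F y \<inter> F z = {}"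
proof (rule ccontr)
  assume yz: "y \<in> Y" "z \<in> Y" "y \<noteq> z" and "F y \<inter> F z \<noteq> {}"
  then obtain R where R: "R \<in> F y" "R \<in> F z" by blast
  have "R 0 \<in> body R (Q y R) \<inter> body R (Q z R)" by (simp add: body_def)
  hence "R 0 \<in> A y" using bb2[OF yz R] by blast
  thus False using cb[OF yz(1) R(1)] by (auto simp: comb_def)
qed

definition idx :: "(nat \<Rightarrow> 'v) \<Rightarrow> (nat \<Rightarrow> 'v)" where
  "idx R = (SOME y. y \<in> Y \<and> R \<in> F y)"

lemma idx: assumes "y \<in> Y" "R \<in> F y" shows "idx R = y"
proof -
  have "idx R \<in> Y \<and> R \<in> F (idx R)" unfolding idx_def by (rule someI[of _ y]) (use assms in blast)
  thus ?thesis using F_disjoint[of "idx R" y] assms by blast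
qed

text \<open>A comb meets its tooth set only in last vertices of its paths, so dropping the paths
  that end outside \<open>D\<close> removes all other teeth.\<close>

lemma body_restrict_Int:
  assumes "y \<in> Y" "R \<in> F y" shows "body R {p \<in> Q y R. last p \<in> D} \<inter> A y \<subseteq> D"
proof
  fix x assume x: "x \<in> body R {p \<in> Q y R. last p \<in> D} \<inter> A y"
  hence "x \<notin> range R" using cb[OF assms] by (auto simp: comb_def)
  then obtain p where p: "p \<in> Q y R" "last p \<in> D" "x \<in> set p" using x by (auto simp: body_def)
  hence "x = last p" using comb_path(5)[OF cb[OF assms] p(1)] x by auto
  thus "x \<in> D" using p by simp
qed

lemma bodies_Int_subset:
  assumes "y \<in> Y" "z \<in> Y" "R \<in> F y" "S \<in> F z" "R \<noteq> S"
  shows "body R (Q y R) \<inter> body S (Q z S) \<subseteq> A y \<inter> A z"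
  using bb[of y R S] bb2[of y z R S] assms by (cases "y = z") auto

lemma sum_ge:
  assumes "J \<subseteq> Y" "|J| =o |Y|" "\<And>y. y \<in> J \<Longrightarrow> |F y| \<le>o |S|" shows "|K| \<le>o |S|"
proof (rule singular_sum[OF Y infK L(3) L(4) assms(1,2)])
  fix y assume y: "y \<in> J"
  show "|L y| \<le>o |S|" using ordLeq_transitive[OF F(2) assms(3)[OF y]] y assms(1) by blast
qed

lemma countable_cofinality:
  assumes "countable Y"
  shows "\<exists>\<R>\<subseteq>\<epsilon>. disjoint_rays \<R> \<and> |K| \<le>o |\<R>| \<and> admits_connected_ray_graph V E \<R>"
proof -
  let ?L = "\<Union>y\<in>Y. F y"
  obtain y0 where y0: "y0 \<in> Y" using infY by (metis ex_in_conv finite.emptyI)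
  have FL: "|F y| \<le>o |?L|" if "y \<in> Y" for y by (rule card_of_mono1) (use that in blast)
  have "\<exists>\<R>\<subseteq>\<epsilon>. disjoint_rays \<R> \<and> |?L| \<le>o |\<R>| \<and> admits_connected_ray_graph V E \<R>"
  proof (rule star_result[OF e, of _ "\<lambda>R. A (idx R)" "\<lambda>R. Q (idx R) R"])
    show "?L \<subseteq> \<epsilon>" using F(1) Ke by blast
    show "comb (A (idx R)) R (Q (idx R) R)" "last ` Q (idx R) R = A (idx R)" if RL: "R \<in> ?L" for R
    proof -
      obtain y where y: "y \<in> Y" "R \<in> F y" using RL by blast
      show "comb (A (idx R)) R (Q (idx R) R)" "last ` Q (idx R) R = A (idx R)"
        unfolding idx[OF y] by (rule cb[OF y], rule teeth[OF y])
    qed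
    show "body R (Q (idx R) R) \<inter> body S (Q (idx S) S) \<subseteq> A (idx R) \<inter> A (idx S)" if "R \<in> ?L" "S \<in> ?L" "R \<noteq> S" for R S
    proof -
      obtain y z where yz: "y \<in> Y" "R \<in> F y" "z \<in> Y" "S \<in> F z" using \<open>R \<in> ?L\<close> \<open>S \<in> ?L\<close> by blast
      show ?thesis unfolding idx[OF yz(1,2)] idx[OF yz(3,4)] by (rule bodies_Int_subset[OF yz(1,3,2,4) \<open>R \<noteq> S\<close>])
    qed
    have "(\<lambda>R. A (idx R)) ` ?L \<subseteq> A ` Y" by (auto simp: idx)
    thus "countable ((\<lambda>R. A (idx R)) ` ?L)" by (rule countable_subset) (rule countable_image[OF assms])
    show "infinite {S \<in> ?L. A (idx S) = A (idx R)}" if "R \<in> ?L" for R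
    proof -
      obtain y where y: "y \<in> Y" "R \<in> F y" using \<open>R \<in> ?L\<close> by blast
      have "F y \<subseteq> {S \<in> ?L. A (idx S) = A (idx R)}" using y by (auto simp: idx)
      thus ?thesis using uncountable_infinite[OF F_unc[OF y(1)]] by (rule infinite_super)
    qed
    show "\<not> countable ?L" by (rule uncountable_ordLeq[OF F_unc[OF y0] FL[OF y0]])
  qed
  then obtain \<R> where R: "\<R> \<subseteq> \<epsilon>" "disjoint_rays \<R>" "|?L| \<le>o |\<R>|" "admits_connected_ray_graph V E \<R>" by blast
  have "|K| \<le>o |?L|" by (rule sum_ge[OF subset_refl card_of_refl FL])
  hence "|K| \<le>o |\<R>|" using R(3) by (rule ordLeq_transitive)
  thus ?thesis using R by blast
qed

text \<open>Once every comb with index in \<open>J\<close> is cut down to the paths ending in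
  \<open>D\<close>, all of them share one tooth set and a single star suffices.\<close>

lemma common_teeth:
  assumes J: "J \<subseteq> Y" "|J| =o |Y|" and D: "infinite D" "\<And>y. y \<in> J \<Longrightarrow> D \<subseteq> A y"
  shows "\<exists>\<R>\<subseteq>\<epsilon>. disjoint_rays \<R> \<and> |K| \<le>o |\<R>| \<and> admits_connected_ray_graph V E \<R>"
proof -
  let ?L = "\<Union>y\<in>J. F y" and ?Q = "\<lambda>R. {p \<in> Q (idx R) R. last p \<in> D}"
  have "infinite J" using J(2) infY card_of_ordIso_finite by blast
  then obtain y0 where y0: "y0 \<in> J" by (metis ex_in_conv finite.emptyI)
  have y0Y: "y0 \<in> Y" using y0 J by blast
  have FL: "|F y| \<le>o |?L|" if "y \<in> J" for y by (rule card_of_mono1) (use that in blast)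
  have unc: "\<not> countable ?L" by (rule uncountable_ordLeq[OF F_unc[OF y0Y] FL[OF y0]])
  have "\<exists>\<R>\<subseteq>\<epsilon>. disjoint_rays \<R> \<and> |?L| \<le>o |\<R>| \<and> admits_connected_ray_graph V E \<R>"
  proof (rule star_result[OF e, of _ "\<lambda>R. D" ?Q])
    show "?L \<subseteq> \<epsilon>" using F(1) Ke J by blast
    show "comb D R (?Q R)" "last ` ?Q R = D" if RL: "R \<in> ?L" for R
    proof -
      obtain y where y: "y \<in> J" "R \<in> F y" using RL by blast
      hence yY: "y \<in> Y" using J by blast
      have i: "idx R = y" by (rule idx[OF yY y(2)])
      have "last ` Q y R \<inter> D = D" using teeth[OF yY y(2)] D(2)[OF y(1)] by auto
      thus "comb D R (?Q R)" unfolding i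
        by (intro comb_restrict[OF cb[OF yY y(2)]]) (use D(1) D(2)[OF y(1)] in auto)
      have "D \<subseteq> last ` Q y R" using \<open>last ` Q y R \<inter> D = D\<close> by blast
      thus "last ` ?Q R = D" unfolding i by blast
    qed
    show "body R (?Q R) \<inter> body S (?Q S) \<subseteq> D \<inter> D" if "R \<in> ?L" "S \<in> ?L" "R \<noteq> S" for R S
    proof -
      obtain y z where yz: "y \<in> Y" "R \<in> F y" "z \<in> Y" "S \<in> F z" using \<open>R \<in> ?L\<close> \<open>S \<in> ?L\<close> J by blast
      have sub: "body R (?Q R) \<subseteq> body R (Q y R)" "body S (?Q S) \<subseteq> body S (Q z S)"
        unfolding idx[OF yz(1,2)] idx[OF yz(3,4)] by (auto intro!: body_mono)
      have "body R (?Q R) \<inter> A y \<subseteq> D" unfolding idx[OF yz(1,2)] by (rule body_restrict_Int[OF yz(1,2)])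
      thus ?thesis using bodies_Int_subset[OF yz(1,3,2,4) \<open>R \<noteq> S\<close>] sub by blast
    qed
    show "infinite {S \<in> ?L. D = D}" by (rule infinite_super[OF _ uncountable_infinite[OF unc]]) blast
    show "countable ((\<lambda>R. D) ` ?L)" by (rule countable_subset[of _ "{D}"]) auto
    show "\<not> countable ?L" by (rule unc)
  qed
  then obtain \<R> where R: "\<R> \<subseteq> \<epsilon>" "disjoint_rays \<R>" "|?L| \<le>o |\<R>|" "admits_connected_ray_graph V E \<R>" by blast
  have "|K| \<le>o |?L|" by (rule sum_ge[OF J FL])
  hence "|K| \<le>o |\<R>|" using R(3) by (rule ordLeq_transitive)
  thus ?thesis using R by blast
qed

end

lemma not_suc_cf_omega_ordIso:
  "not_suc_cf_omega K \<Longrightarrow> |K'| =o |K| \<Longrightarrow> not_suc_cf_omega K'" for K K' :: "'a set"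
  unfolding not_suc_cf_omega_def using ordIso_symmetric ordIso_transitive by blast

context singular_combs
begin

text \<open>The centres of the stars are to be spines in turn, so they have to be disjoint rays of
  the end. Each is threaded through its own \<open>B y\<close> inside a private region; the upper
  two levels of the tree are built from these centres, and only then are leaves attached.\<close>

lemma disjoint_teeth:
  assumes GCH: "GCH_type TYPE((nat \<Rightarrow> 'v) set)" and Yunc: "\<not> countable Y" and good: "not_suc_cf_omega Y"
    and J: "J \<subseteq> Y" "|J| =o |Y|" and B: "\<And>y. y \<in> J \<Longrightarrow> B y \<subseteq> A y" "\<And>y. y \<in> J \<Longrightarrow> infinite (B y)"
    and Bd: "\<And>y z. y \<in> J \<Longrightarrow> z \<in> J \<Longrightarrow> y \<noteq> z \<Longrightarrow> B y \<inter> B z = {}"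
  shows "\<exists>\<R>\<subseteq>\<epsilon>. disjoint_rays \<R> \<and> |K| \<le>o |\<R>| \<and> admits_connected_ray_graph V E \<R>"
proof -
  \<comment> \<open>Only the part \<open>B y\<close> of the teeth is included, because the full
    tooth sets may overlap; the regions \<open>W y\<close> are pairwise disjoint.\<close>
  define W where "W y = B y \<union> (\<Union>R\<in>F y. body R (Q y R) - A y)" for y
  have AV: "A y \<subseteq> V" if y: "y \<in> Y" for y
  proof -
    obtain R where R: "R \<in> F y" using F_unc[OF y] by (metis countable_empty ex_in_conv)
    show ?thesis using comb_body_Int[OF cb[OF y R]] comb_subset_V[OF cb[OF y R]] unfolding teeth[OF y R] by blast
  qed
  have WV: "W y \<subseteq> V" if y: "y \<in> J" for y
  proof -
    have yY: "y \<in> Y" using y J by blast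
    have "body R (Q y R) \<subseteq> V" if "R \<in> F y" for R using comb_subset_V[OF cb[OF yY that]] .
    thus ?thesis using B(1)[OF y] AV[OF yY] unfolding W_def by blast
  qed
  have Wd: "W y \<inter> W z = {}" if y: "y \<in> J" and z: "z \<in> J" and n: "y \<noteq> z" for y z
  proof -
    have yY: "y \<in> Y" "z \<in> Y" using y z J by blast+
    have 1: "(body R (Q y R) - A y) \<inter> B z = {}" if "R \<in> F y" for R using ba[OF yY that] B(1)[OF z] by blast
    have 2: "(body R (Q z R) - A z) \<inter> B y = {}" if "R \<in> F z" for R using ba[OF yY(2,1) that] B(1)[OF y] by blast
    have 3: "(body R (Q y R) - A y) \<inter> (body S (Q z S) - A z) = {}" if "R \<in> F y" "S \<in> F z" for R S
      using bb2[OF yY n that] by blast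
    show ?thesis unfolding W_def using 1 2 3 Bd[OF y z n] by blast
  qed
  have av: "\<exists>R\<in>F y. (body R (Q y R) - A y) \<inter> X = {}" if y: "y \<in> Y" and X: "finite X" for y X
  proof (rule infinite_bodies_avoid[OF uncountable_infinite[OF F_unc[OF y]] X])
    fix R S assume "R \<in> F y" "S \<in> F y" "R \<noteq> S"
    thus "(body R (Q y R) - A y) \<inter> (body S (Q y S) - A y) = {}" using bb[OF y] by blast
  qed
  have tooth: "conn E (W y - X) a (R i)"
    if y: "y \<in> J" and R: "R \<in> F y" "(body R (Q y R) - A y) \<inter> X = {}" and a: "a \<in> B y" "a \<notin> X" for y R X a i
  proof -
    have yY: "y \<in> Y" using y J by blast
    have "a \<in> last ` Q y R" using teeth[OF yY R(1)] B(1)[OF y] a by auto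
    then obtain p where p: "p \<in> Q y R" "last p = a" by blast
    have bW: "body R (Q y R) - A y \<subseteq> W y - X" using R unfolding W_def by blast
    have "set p \<subseteq> W y - X"
    proof
      fix x assume x: "x \<in> set p"
      show "x \<in> W y - X"
      proof (cases "x \<in> A y")
        case True
        hence "x = a" using comb_path(5)[OF cb[OF yY R(1)] p(1)] x p(2) by auto
        thus ?thesis using a by (simp add: W_def)
      next
        case False
        thus ?thesis using bW path_subset_body[OF p(1), of R] x by blast
      qed
    qed
    moreover have "range R \<subseteq> W y - X" using comb_minus[OF cb[OF yY R(1)]] bW by blast
    ultimately show ?thesis using comb_conn[OF cb[OF yY R(1)] p(1)] p(2) by blast
  qed
  have "\<exists>C. is_ray V E C \<and> range C \<subseteq> W y \<and> (\<forall>m::nat. infinite (range C \<inter> B y))" if y: "y \<in> J" for y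
  proof (rule greedy_ray)
    have yY: "y \<in> Y" using y J by blast
    fix X a and n m :: nat assume X: "finite X" and a: "a \<in> B y" "a \<notin> X"
    obtain R where R: "R \<in> F y" "(body R (Q y R) - A y) \<inter> X = {}" using av[OF yY X] by blast
    have "infinite (B y - insert a X)" using B(2)[OF y] X by simp
    hence "\<exists>b. b \<in> B y - insert a X" by (metis ex_in_conv finite.emptyI)
    then obtain b where b: "b \<in> B y" "b \<noteq> a" "b \<notin> X" by blast
    have "conn E (W y - X) a (R 0)" "conn E (W y - X) b (R 0)" using tooth[OF y R] a b by blast+
    hence "conn E (W y - X) a b" using conn_sym conn_trans by meson
    thus "\<exists>b\<in>B y. b \<noteq> a \<and> conn E (W y - X) a b" using b by blast
  next
    show "B y \<noteq> {}" using B(2)[OF y] by auto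
    show "W y \<subseteq> V" by (rule WV[OF y])
    show "B y \<subseteq> W y" by (simp add: W_def)
  qed
  hence "\<forall>y\<in>J. \<exists>C. is_ray V E C \<and> range C \<subseteq> W y \<and> infinite (range C \<inter> B y)" by blast
  then obtain C where C: "\<And>y. y \<in> J \<Longrightarrow> is_ray V E (C y)" "\<And>y. y \<in> J \<Longrightarrow> range (C y) \<subseteq> W y"
    "\<And>y. y \<in> J \<Longrightarrow> infinite (range (C y) \<inter> B y)" by metis
  have Ce: "C y \<in> \<epsilon>" if y: "y \<in> J" for y
  proof (rule ray_mem_end[OF e C(1)[OF y]])
    have yY: "y \<in> Y" using y J by blast
    fix X :: "'v set" assume X: "finite X"
    obtain R where R: "R \<in> F y" "(body R (Q y R) - A y) \<inter> X = {}" using av[OF yY X] by blast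
    have "infinite (range (C y) \<inter> B y - X)" using C(3)[OF y] X by simp
    hence "\<exists>x. x \<in> range (C y) \<inter> B y - X" by (metis ex_in_conv finite.emptyI)
    then obtain j where j: "C y j \<in> B y" "C y j \<notin> X" by blast
    have "conn E (W y - X) (C y j) (R 0)" by (rule tooth[OF y R j])
    hence "conn E (V - X) (C y j) (R 0)" by (rule conn_mono) (use WV[OF y] in blast)
    moreover have "range R \<inter> X = {}" using comb_minus[OF cb[OF yY R(1)]] R(2) by blast
    moreover have "R \<in> \<epsilon>" using F(1)[OF yY] R(1) Ke by blast
    ultimately show "\<exists>R\<in>\<epsilon>. \<exists>i j. range R \<inter> X = {} \<and> conn E (V - X) (C y j) (R i)" by blast
  qed
  have Cd: "range (C y) \<inter> range (C z) = {}" if "y \<in> J" "z \<in> J" "y \<noteq> z" for y z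
    using Wd[OF that] C(2)[OF that(1)] C(2)[OF that(2)] by blast
  have injC: "inj_on C J"
  proof (rule inj_onI, rule ccontr)
    fix y z assume "y \<in> J" "z \<in> J" "C y = C z" "y \<noteq> z"
    thus False using Cd[of y z] by simp
  qed
  have CJ: "|C ` J| =o |Y|"
  proof -
    have "|J| =o |C ` J|" by (rule card_of_ordIsoI[OF inj_on_imp_bij_betw[OF injC]])
    thus ?thesis using J(2) ordIso_symmetric ordIso_transitive by blast
  qed
  \<comment> \<open>The centres are \<open>|Y|\<close> many disjoint rays of the end, and
    \<open>|Y|\<close> is regular and not exceptional. So many of them are themselves spines of
    combs with a single tooth set.\<close>
  have "\<exists>A \<R>' Q. \<R>' \<subseteq> C ` J \<and> |\<R>'| =o |C ` J| \<and> (\<forall>R\<in>\<R>'. comb A R (Q R) \<and> last ` Q R = A) \<and>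
     (\<forall>R\<in>\<R>'. \<forall>S\<in>\<R>'. R \<noteq> S \<longrightarrow> body R (Q R) \<inter> body S (Q S) \<subseteq> A)"
  proof (rule end_comb_family[OF GCH e])
    show "C ` J \<subseteq> \<epsilon>" using Ce by blast
    show "disjoint_rays (C ` J)" unfolding disjoint_rays_def
    proof (intro ballI impI)
      fix R S assume "R \<in> C ` J" "S \<in> C ` J" "R \<noteq> S"
      thus "range R \<inter> range S = {}" using Cd by (metis imageE)
    qed
    show "stable |C ` J|" by (rule stable_ordIso1[OF min_cofinal_stable[OF Y infK] CJ])
    show "\<not> countable (C ` J)" using uncountable_ordLeq[OF Yunc] CJ ordIso_iff_ordLeq by blast
    show "not_suc_cf_omega (C ` J)" by (rule not_suc_cf_omega_ordIso[OF good CJ])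
  qed
  then obtain A0 \<C> Q0 where c12: "\<C> \<subseteq> C ` J" "|\<C>| =o |C ` J|"
     and c34: "\<forall>R\<in>\<C>. comb A0 R (Q0 R) \<and> last ` Q0 R = A0"
     and c5: "\<forall>R\<in>\<C>. \<forall>S\<in>\<C>. R \<noteq> S \<longrightarrow> body R (Q0 R) \<inter> body S (Q0 S) \<subseteq> A0"
    by (elim exE conjE) (rule that)
  have c3: "comb A0 R (Q0 R)" "last ` Q0 R = A0" if "R \<in> \<C>" for R using bspec[OF c34 that] by simp_all
  have c6: "body R (Q0 R) \<inter> body S (Q0 S) \<subseteq> A0" if "R \<in> \<C>" "S \<in> \<C>" "R \<noteq> S" for R S using c5 that by blast
  note c = c12 c3 c6
  have cY: "|\<C>| =o |Y|" using c(2) CJ by (rule ordIso_transitive)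
  have cunc: "\<not> countable \<C>" using uncountable_ordLeq[OF Yunc] cY ordIso_iff_ordLeq by blast
  have "\<exists>C0 M Q1. C0 \<in> \<epsilon> \<and> M \<subseteq> \<C> \<and> countable (\<C> - M) \<and> (\<forall>R\<in>M. comb (range C0) R (Q1 R)) \<and>
     (\<forall>R\<in>M. \<forall>S\<in>M. R \<noteq> S \<longrightarrow> body R (Q1 R) \<inter> body S (Q1 S) \<subseteq> range C0)"
  proof (rule star_center[OF e, of \<C> "\<lambda>_. A0" Q0])
    show "\<C> \<subseteq> \<epsilon>" using c(1) Ce by blast
    show "countable ((\<lambda>_. A0) ` \<C>)" by (rule countable_subset[of _ "{A0}"]) auto
    show "infinite {S \<in> \<C>. A0 = A0}" using uncountable_infinite[OF cunc] by simp
    show "\<C> \<noteq> {}" using cunc by auto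
    show "body R (Q0 R) \<inter> body S (Q0 S) \<subseteq> A0 \<inter> A0" if "R \<in> \<C>" "S \<in> \<C>" "R \<noteq> S" for R S
      using c(5)[OF that] by simp
  qed (fact c(3), fact c(4))
  then obtain C0 M Q1 where M123: "C0 \<in> \<epsilon>" "M \<subseteq> \<C>" "countable (\<C> - M)"
     and M4: "\<forall>R\<in>M. comb (range C0) R (Q1 R)"
     and M5: "\<forall>R\<in>M. \<forall>S\<in>M. R \<noteq> S \<longrightarrow> body R (Q1 R) \<inter> body S (Q1 S) \<subseteq> range C0"
    by (elim exE conjE) (rule that)
  have M6: "comb (range C0) R (Q1 R)" if "R \<in> M" for R using M4 that by blast
  have M7: "body R (Q1 R) \<inter> body S (Q1 S) \<subseteq> range C0" if "R \<in> M" "S \<in> M" "R \<noteq> S" for R S using M5 that by blast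
  note M = M123 M6 M7
  \<comment> \<open>Only centres that survive in the upper star receive leaves; \<open>J'\<close>
    still has full size in \<open>Y\<close>.\<close>
  define J' where "J' = {y \<in> J. C y \<in> M}"
  have J'Y: "J' \<subseteq> Y" using J by (auto simp: J'_def)
  have "|J'| =o |Y|"
  proof -
    have "|\<C> - M| <o |\<C>|" by (rule countable_ordLess[OF M(3) cunc])
    hence 1: "|\<C>| \<le>o |M|" by (rule card_of_diff_small[OF uncountable_infinite[OF cunc] M(2)])
    have "M \<subseteq> C ` J'" using M(2) c(1) unfolding J'_def by blast
    hence "|M| \<le>o |J'|" by (rule surj_imp_ordLeq)
    with 1 have "|\<C>| \<le>o |J'|" by (rule ordLeq_transitive)
    moreover have "|Y| \<le>o |\<C>|" using cY ordIso_iff_ordLeq by blast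
    ultimately have "|Y| \<le>o |J'|" using ordLeq_transitive by blast
    thus ?thesis using card_of_mono1[OF J'Y] ordIso_iff_ordLeq by blast
  qed
  \<comment> \<open>All vertices of the upper star and its combs. They number fewer than each
    \<open>F y\<close>, because \<open>|Y| <o |L y|\<close>.\<close>
  define Z where "Z = range C0 \<union> (\<Union>R\<in>M. body R (Q1 R))"
  have ZL: "|Z| <o |F y|" if y: "y \<in> Y" for y
  proof -
    note Lunc = L_unc[OF y]
    have "|M| \<le>o |Y|" using card_of_mono1[OF M(2)] cY ordLeq_ordIso_trans by blast
    hence Ml: "|M| <o |L y|" using L(2)[OF y] by (rule ordLeq_ordLess_trans)
    have "|\<Union>R\<in>M. body R (Q1 R)| <o |L y|"
    proof (rule stable_UNION[OF L(1)[OF y] Ml])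
      show "|body R (Q1 R)| <o |L y|" if "R \<in> M" for R
        by (rule countable_ordLess[OF countable_body[OF M(4)[OF that]] Lunc])
    qed
    moreover have "|range C0| <o |L y|" by (rule countable_ordLess[OF _ Lunc]) simp
    ultimately have "|Z| <o |L y|" unfolding Z_def
      using card_of_Un_ordLess_infinite[OF uncountable_infinite[OF Lunc]] by blast
    thus ?thesis using F(2)[OF y] by (rule ordLess_ordLeq_trans)
  qed
  \<comment> \<open>\<open>Z\<close> contains the surviving centres, so this also discards the combs
    of \<open>y\<close> whose bodies are met outside the teeth by their own centre
    \<open>C y\<close>.\<close>
  define G where "G y = {R \<in> F y. (body R (Q y R) - A y) \<inter> Z = {}}" for y
  have FG: "|F y| \<le>o |G y|" if y: "y \<in> Y" for y
    unfolding G_def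
  proof (rule card_of_avoiding[OF uncountable_infinite[OF F_unc[OF y]] ZL[OF y]])
    fix R S assume "R \<in> F y" "S \<in> F y" "R \<noteq> S"
    thus "(body R (Q y R) - A y) \<inter> (body S (Q y S) - A y) = {}" using bb[OF y] by blast
  qed
  let ?L = "\<Union>y\<in>J'. G y"
  define Q2 where "Q2 R = {p \<in> Q (idx R) R. last p \<in> range (C (idx R))}" for R
  have LD: "\<exists>y\<in>J'. R \<in> F y \<and> y \<in> Y \<and> y \<in> J \<and> idx R = y \<and> C y \<in> M \<and> (body R (Q y R) - A y) \<inter> Z = {}" if RL: "R \<in> ?L" for R
  proof -
    obtain y where y: "y \<in> J'" "R \<in> G y" using RL by blast
    hence "R \<in> F y" "(body R (Q y R) - A y) \<inter> Z = {}" by (auto simp: G_def)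
    thus ?thesis using y(1) J'Y idx by (intro bexI[of _ y]) (auto simp: J'_def)
  qed
  have sub2: "body R (Q2 R) \<subseteq> body R (Q (idx R) R)" for R by (rule body_mono) (auto simp: Q2_def)
  have teeth2: "body R (Q2 R) \<inter> A (idx R) \<subseteq> range (C (idx R))" if RL: "R \<in> ?L" for R
  proof -
    obtain y where y: "R \<in> F y" "y \<in> Y" "idx R = y" using LD[OF RL] by blast
    show ?thesis unfolding Q2_def y(3) by (rule body_restrict_Int[OF y(2,1)])
  qed
  have CZ: "range (C y) \<subseteq> Z" if "C y \<in> M" for y
    using that range_subset_body[of "C y" "Q1 (C y)"] unfolding Z_def by blast
  have prem: "C (idx R) \<in> M" "comb (range (C (idx R))) R (Q2 R)" "body R (Q2 R) \<inter> Z \<subseteq> range (C (idx R))"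
    if RL: "R \<in> ?L" for R
  proof -
    obtain y where y: "R \<in> F y" "y \<in> Y" "y \<in> J" "idx R = y" "C y \<in> M" "(body R (Q y R) - A y) \<inter> Z = {}" using LD[OF RL] by blast
    show "C (idx R) \<in> M" using y by simp
    have "infinite (last ` Q y R \<inter> range (C y))"
    proof -
      have "range (C y) \<inter> B y \<subseteq> last ` Q y R \<inter> range (C y)" using teeth[OF y(2,1)] B(1)[OF y(3)] by auto
      thus ?thesis using C(3)[OF y(3)] finite_subset by blast
    qed
    thus "comb (range (C (idx R))) R (Q2 R)" unfolding Q2_def y(4)
      by (rule comb_restrict[OF cb[OF y(2,1)]]) (use y(6) CZ[OF y(5)] in blast)
    show "body R (Q2 R) \<inter> Z \<subseteq> range (C (idx R))"
      using teeth2[OF RL] sub2[of R] y(6) unfolding y(4) by blast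
  qed
  have LL: "body R (Q2 R) \<inter> body S (Q2 S) \<subseteq> range (C (idx R))" if RS: "R \<in> ?L" "S \<in> ?L" "R \<noteq> S" for R S
  proof -
    obtain y where y: "R \<in> F y" "y \<in> Y" "idx R = y" using LD[OF RS(1)] by blast
    obtain z where z: "S \<in> F z" "z \<in> Y" "idx S = z" using LD[OF RS(2)] by blast
    have "body R (Q2 R) \<inter> body S (Q2 S) \<subseteq> A y"
      using bodies_Int_subset[OF y(2) z(2) y(1) z(1) RS(3)] sub2[of R] sub2[of S] unfolding y(3) z(3) by blast
    thus ?thesis using teeth2[OF RS(1)] unfolding y(3) by blast
  qed
  let ?R = "insert C0 (M \<union> ?L)"
  have "disjoint_rays ?R"
    by (rule tree_admits(1)[OF M(4,5) Z_def, where par = "\<lambda>R. C (idx R)" and ?Q2.0 = Q2]) (assumption | (rule prem LL, assumption+))+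
  moreover have "admits_connected_ray_graph V E ?R"
    by (rule tree_admits(2)[OF M(4,5) Z_def, where par = "\<lambda>R. C (idx R)" and ?Q2.0 = Q2]) (assumption | (rule prem LL, assumption+))+
  moreover have "?R \<subseteq> \<epsilon>"
  proof -
    have "?L \<subseteq> \<epsilon>" using F(1) Ke J'Y by (auto simp: G_def)
    moreover have "M \<subseteq> \<epsilon>" using M(2) c(1) Ce by blast
    ultimately show ?thesis using M(1) by blast
  qed
  moreover have "|K| \<le>o |?R|"
  proof (rule sum_ge[OF J'Y \<open>|J'| =o |Y|\<close>])
    fix y assume y: "y \<in> J'"
    have "|G y| \<le>o |?R|" by (rule card_of_mono1) (use y in blast)
    with FG show "|F y| \<le>o |?R|" using y J'Y ordLeq_transitive by blast
  qed
  ultimately show ?thesis by (intro exI[of _ ?R]) simp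
qed

lemma uncountable_cofinality:
  assumes GCH: "GCH_type TYPE((nat \<Rightarrow> 'v) set)" and Yunc: "\<not> countable Y" and good: "not_suc_cf_omega Y"
  shows "\<exists>\<R>\<subseteq>\<epsilon>. disjoint_rays \<R> \<and> |K| \<le>o |\<R>| \<and> admits_connected_ray_graph V E \<R>"
proof -
  define S where "S = {(y, B). y \<in> Y \<and> B \<subseteq> A y \<and> infinite B}"
  define P where "P x x' \<longleftrightarrow> fst x \<noteq> fst x' \<and> snd x \<inter> snd x' = {}" for x x' :: "(nat \<Rightarrow> 'v) \<times> 'v set"
  obtain M where M: "M \<subseteq> S" "pairwise P M" and mx: "\<forall>z\<in>S. (\<forall>x\<in>M. x \<noteq> z \<longrightarrow> P x z \<and> P z x) \<longrightarrow> z \<in> M"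
    using maximal_pairwise[of S P] by (elim exE conjE) (rule that)
  have injM: "inj_on fst M" using M(2) by (auto simp: inj_on_def pairwise_def P_def)
  have MS: "fst x \<in> Y" "snd x \<subseteq> A (fst x)" "infinite (snd x)" if "x \<in> M" for x
    using subsetD[OF M(1) that] by (auto simp: S_def split_beta)
  have stY: "stable |Y|" by (rule min_cofinal_stable[OF Y infK])
  show ?thesis
  proof (cases "|Y| \<le>o |M|")
    case True
    let ?J = "fst ` M"
    have "|M| \<le>o |?J|" using injM card_of_ordLeq by blast
    hence "|Y| \<le>o |?J|" using True ordLeq_transitive by blast
    moreover have JY: "?J \<subseteq> Y" using MS(1) by blast
    ultimately have JI: "|?J| =o |Y|" using card_of_mono1 ordIso_iff_ordLeq by blast
    have "\<forall>y\<in>?J. \<exists>B. (y, B) \<in> M" by force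
    then obtain B where B: "\<And>y. y \<in> ?J \<Longrightarrow> (y, B y) \<in> M" by metis
    show ?thesis
    proof (rule disjoint_teeth[OF GCH Yunc good JY JI])
      show "B y \<subseteq> A y" "infinite (B y)" if "y \<in> ?J" for y using MS(2,3)[OF B[OF that]] by auto
      show "B y \<inter> B z = {}" if "y \<in> ?J" "z \<in> ?J" "y \<noteq> z" for y z
      proof -
        have "P (y, B y) (z, B z)" using M(2) B[OF \<open>y \<in> ?J\<close>] B[OF \<open>z \<in> ?J\<close>] \<open>y \<noteq> z\<close> unfolding pairwise_def by blast
        thus ?thesis by (simp add: P_def)
      qed
    qed
  next
    case False
    hence Ml: "|M| <o |Y|" using card_of_ordLess_or_ordLeq by blast
    let ?U = "\<Union>x\<in>M. snd x" and ?N = "Y - fst ` M"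
    have Ul: "|?U| <o |Y|"
    proof (rule stable_UNION[OF stY Ml])
      fix x assume x: "x \<in> M"
      have "countable (snd x)" using MS(2)[OF x] A_countable[OF MS(1)[OF x]] countable_subset by blast
      thus "|snd x| <o |Y|" by (rule countable_ordLess[OF _ Yunc])
    qed
    \<comment> \<open>Otherwise the part of \<open>A y\<close> outside \<open>?U\<close> is infinite
      and could be added to the maximal system.\<close>
    have infU: "infinite (A y \<inter> ?U)" if y: "y \<in> ?N" for y
    proof
      assume fin: "finite (A y \<inter> ?U)"
      have "infinite (A y - (A y \<inter> ?U))" using A_infinite[of y] y fin by simp
      hence "(y, A y - ?U) \<in> S" using y by (simp add: S_def Diff_Int_distrib Diff_Int)
      moreover have "P x (y, A y - ?U) \<and> P (y, A y - ?U) x" if "x \<in> M" for x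
        using y that by (auto simp: P_def)
      ultimately have "(y, A y - ?U) \<in> M" using mx by blast
      thus False using y by force
    qed
    let ?D = "{D. D \<subseteq> ?U \<and> countable D}" and ?f = "\<lambda>D. {y \<in> ?N. A y \<inter> ?U = D}"
    have "|?D| <o |Y|" by (rule card_of_countable_subsets_ordLess[OF GCH Yunc good Ul])
    \<comment> \<open>A pigeonhole argument by regularity of \<open>|Y|\<close>: fewer than
      \<open>|Y|\<close> traces are possible, and the indices used up in \<open>M\<close> are also
      fewer.\<close>
    have "\<exists>D\<in>?D. |Y| \<le>o |?f D|"
    proof (rule ccontr)
      assume "\<not> ?thesis"
      hence "|?f D| <o |Y|" if "D \<in> ?D" for D using that card_of_ordLess_or_ordLeq by blast
      hence "|\<Union>D\<in>?D. ?f D| <o |Y|" by (rule stable_UNION[OF stY \<open>|?D| <o |Y|\<close>])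
      moreover have "|fst ` M| <o |Y|" using card_of_image Ml ordLeq_ordLess_trans by blast
      ultimately have "|fst ` M \<union> (\<Union>D\<in>?D. ?f D)| <o |Y|" using card_of_Un_ordLess_infinite[OF infY] by blast
      moreover have "Y \<subseteq> fst ` M \<union> (\<Union>D\<in>?D. ?f D)"
      proof
        fix y assume y: "y \<in> Y"
        have "countable (A y \<inter> ?U)" using A_countable[OF y] by (rule countable_subset[rotated]) blast
        thus "y \<in> fst ` M \<union> (\<Union>D\<in>?D. ?f D)" using y by auto
      qed
      hence "|Y| \<le>o |fst ` M \<union> (\<Union>D\<in>?D. ?f D)|" by (rule card_of_mono1)
      ultimately show False using not_ordLess_ordLeq by blast
    qed
    then obtain D where D: "|Y| \<le>o |?f D|" by blast
    have sub: "?f D \<subseteq> Y" by blast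
    have JI: "|?f D| =o |Y|" using D card_of_mono1[OF sub] ordIso_iff_ordLeq by blast
    hence "infinite (?f D)" using infY card_of_ordIso_finite by blast
    hence "?f D \<noteq> {}" by (rule infinite_imp_nonempty)
    then obtain y where y: "y \<in> ?N" "A y \<inter> ?U = D" by blast
    have "infinite D" using infU[OF y(1)] unfolding y(2) .
    thus ?thesis by (rule common_teeth[OF sub JI]) blast
  qed
qed

end

section \<open>Separation of the comb families of a singular degree\<close>

context ugraph
begin

text \<open>The sets \<open>L y\<close> are chosen for their sizes only and may overlap, so the comb
  families obtained from them must still be separated. Each loses the combs that interfere with any
  tooth set or with an earlier family, and its size is regular and large enough to bear
  this.\<close>

lemma singular_case:
  fixes K :: "(nat \<Rightarrow> 'v) set"
  assumes GCH: "GCH_type TYPE((nat \<Rightarrow> 'v) set)" and e: "is_end V E \<epsilon>" and K: "K \<subseteq> \<epsilon>" "disjoint_rays K"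
    and inf: "infinite K" and Y: "min_cofinal K Y" and sing: "|Y| <o |K|" and good: "not_suc_cf_omega Y"
  shows "\<exists>\<R>\<subseteq>\<epsilon>. disjoint_rays \<R> \<and> |K| \<le>o |\<R>| \<and> admits_connected_ray_graph V E \<R>"
proof -
  have infY: "infinite Y" by (rule min_cofinal_infinite[OF Y inf])
  obtain L where L0: "\<forall>y\<in>Y. L y \<subseteq> K \<and> stable |L y| \<and> not_suc_cf_omega (L y) \<and> |Y| <o |L y| \<and>
    |underS |K| y| <o |L y| \<and> (\<forall>z\<in>underS |Y| y. |L z| <o |L y| )"
    using singular_decomposition[OF Y inf sing] by (rule exE)
  have L: "L y \<subseteq> K" "stable |L y|" "not_suc_cf_omega (L y)" "|Y| <o |L y|" "|underS |K| y| <o |L y|"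
    "\<And>z. z \<in> underS |Y| y \<Longrightarrow> |L z| <o |L y|" if "y \<in> Y" for y
    using bspec[OF L0 that] by simp_all
  have Lunc: "\<not> countable (L y)" if "y \<in> Y" for y by (rule infinite_ordLess_uncountable[OF infY L(4)[OF that]])
  have "\<exists>A F Q. F \<subseteq> L y \<and> |F| =o |L y| \<and> (\<forall>R\<in>F. comb A R (Q R) \<and> last ` Q R = A) \<and>
     (\<forall>R\<in>F. \<forall>S\<in>F. R \<noteq> S \<longrightarrow> body R (Q R) \<inter> body S (Q S) \<subseteq> A)" if y: "y \<in> Y" for y
  proof (rule end_comb_family[OF GCH e _ _ L(2)[OF y] Lunc[OF y] L(3)[OF y]])
    show "L y \<subseteq> \<epsilon>" using L(1)[OF y] K(1) by blast
    show "disjoint_rays (L y)" using L(1)[OF y] K(2) unfolding disjoint_rays_def by blast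
  qed
  hence "\<forall>y\<in>Y. \<exists>A F Q. F \<subseteq> L y \<and> |F| =o |L y| \<and> (\<forall>R\<in>F. comb A R (Q R) \<and> last ` Q R = A) \<and>
     (\<forall>R\<in>F. \<forall>S\<in>F. R \<noteq> S \<longrightarrow> body R (Q R) \<inter> body S (Q S) \<subseteq> A)" by blast
  from this[unfolded bchoice_iff] obtain A F Q where FQ: "\<forall>y\<in>Y. F y \<subseteq> L y \<and> |F y| =o |L y| \<and> (\<forall>R\<in>F y. comb (A y) R (Q y R) \<and> last ` Q y R = A y) \<and>
     (\<forall>R\<in>F y. \<forall>S\<in>F y. R \<noteq> S \<longrightarrow> body R (Q y R) \<inter> body S (Q y S) \<subseteq> A y)" by (elim exE) (rule that)
  have F1: "F y \<subseteq> L y" "|F y| =o |L y|" if "y \<in> Y" for y using FQ that by blast+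
  have cb: "comb (A y) R (Q y R)" and teeth: "last ` Q y R = A y" if "y \<in> Y" "R \<in> F y" for y R
  proof -
    have "comb (A y) R (Q y R) \<and> last ` Q y R = A y" using FQ that by blast
    thus "comb (A y) R (Q y R)" "last ` Q y R = A y" by simp_all
  qed
  have bb: "body R (Q y R) \<inter> body S (Q y S) \<subseteq> A y" if "y \<in> Y" "R \<in> F y" "S \<in> F y" "R \<noteq> S" for y R S
    using FQ that by blast
  have LF: "|L y| \<le>o |F y|" if "y \<in> Y" for y using F1(2)[OF that] ordIso_iff_ordLeq by blast
  have Func: "\<not> countable (F y)" if "y \<in> Y" for y by (rule uncountable_ordLeq[OF Lunc[OF that] LF[OF that]])
  have Acnt: "countable (A y)" if y: "y \<in> Y" for y
  proof -
    obtain R where R: "R \<in> F y" using Func[OF y] by (metis countable_empty ex_in_conv)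
    show ?thesis using countable_comb[OF cb[OF y R]] teeth[OF y R] by (metis countable_image)
  qed
  \<comment> \<open>Tooth sets of all indices are included, but bodies only of earlier ones: the
    later families are too large to be avoided.\<close>
  define Z where "Z y = (\<Union>z\<in>Y. A z) \<union> (\<Union>z\<in>underS |Y| y. \<Union>S\<in>F z. body S (Q z S))" for y
  have Zl: "|Z y| <o |L y|" if y: "y \<in> Y" for y
  proof -
    note un = Lunc[OF y]
    have cl: "|X| <o |L y|" if "countable X" for X :: "'v set" by (rule countable_ordLess[OF that un])
    have "|\<Union>z\<in>Y. A z| <o |L y|" by (rule stable_UNION[OF L(2)[OF y] L(4)[OF y]]) (rule cl[OF Acnt])
    moreover have "|\<Union>z\<in>underS |Y| y. \<Union>S\<in>F z. body S (Q z S)| <o |L y|"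
    proof (rule stable_UNION[OF L(2)[OF y]])
      show "|underS |Y| y| <o |L y|" using card_of_underS_ordLess[OF y] L(4)[OF y] by (rule ordLess_transitive)
      fix z assume z: "z \<in> underS |Y| y"
      hence zY: "z \<in> Y" by (rule subsetD[OF underS_card_of_subset])
      show "|\<Union>S\<in>F z. body S (Q z S)| <o |L y|"
      proof (rule stable_UNION[OF L(2)[OF y]])
        show "|F z| <o |L y|" using F1(2)[OF zY] L(6)[OF y z] by (rule ordIso_ordLess_trans)
        show "|body S (Q z S)| <o |L y|" if "S \<in> F z" for S by (rule cl[OF countable_body[OF cb[OF zY that]]])
      qed
    qed
    ultimately show ?thesis unfolding Z_def using card_of_Un_ordLess_infinite[OF uncountable_infinite[OF un]] by blast
  qed
  define F' where "F' y = {R \<in> F y. (body R (Q y R) - A y) \<inter> Z y = {}}" for y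
  have F'F: "F' y \<subseteq> F y" for y by (auto simp: F'_def)
  have LF': "|L y| \<le>o |F' y|" if y: "y \<in> Y" for y
  proof -
    have "|F y| \<le>o |F' y|"
      unfolding F'_def
    proof (rule card_of_avoiding[OF uncountable_infinite[OF Func[OF y]]])
      show "|Z y| <o |F y|" using Zl[OF y] LF[OF y] by (rule ordLess_ordLeq_trans)
      fix R S assume "R \<in> F y" "S \<in> F y" "R \<noteq> S"
      thus "(body R (Q y R) - A y) \<inter> (body S (Q y S) - A y) = {}" using bb[OF y] by blast
    qed
    with LF[OF y] show ?thesis by (rule ordLeq_transitive)
  qed
  have ba: "body R (Q y R) \<inter> A z \<subseteq> A y" if "y \<in> Y" "z \<in> Y" "R \<in> F' y" for y z R
    using that unfolding F'_def Z_def by blast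
  \<comment> \<open>The later comb avoids the earlier one outside \<open>A y\<close>. Conversely the
    earlier comb meets \<open>A y\<close> only inside \<open>A z\<close>, as its own family was
    thinned against all tooth sets.\<close>
  have bb0: "body R (Q y R) \<inter> body S (Q z S) \<subseteq> A y \<inter> A z"
    if y: "y \<in> Y" and z: "z \<in> Y" and zy: "z \<in> underS |Y| y" and R: "R \<in> F' y" and S: "S \<in> F' z" for y z R S
  proof -
    have "body S (Q z S) \<subseteq> Z y" using zy S unfolding Z_def F'_def by blast
    hence "body R (Q y R) \<inter> body S (Q z S) \<subseteq> A y" using R unfolding F'_def by blast
    moreover have "body S (Q z S) \<inter> A y \<subseteq> A z" by (rule ba[OF z y S])
    ultimately show ?thesis by blast
  qed
  interpret singular_combs V E \<epsilon> K Y L F' A Q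
  proof
    show "is_end V E \<epsilon>" "K \<subseteq> \<epsilon>" "infinite K" "min_cofinal K Y" by fact+
    show "stable |L y|" "|Y| <o |L y|" "|underS |K| y| <o |L y|" if "y \<in> Y" for y using L(2,4,5)[OF that] by auto
    show "|L z| <o |L y|" if "y \<in> Y" "z \<in> underS |Y| y" for y z using L(6)[OF that] .
    show "F' y \<subseteq> K" if "y \<in> Y" for y using F'F[of y] F1(1)[OF that] L(1)[OF that] by blast
    show "|L y| \<le>o |F' y|" if "y \<in> Y" for y by (rule LF'[OF that])
    show "comb (A y) R (Q y R)" "last ` Q y R = A y" if "y \<in> Y" "R \<in> F' y" for y R
      by (rule cb teeth, use that F'F in blast, use that F'F in blast)+
    show "body R (Q y R) \<inter> body S (Q y S) \<subseteq> A y" if "y \<in> Y" "R \<in> F' y" "S \<in> F' y" "R \<noteq> S" for y R S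
      by (rule bb) (use that F'F in blast)+
    show "body R (Q y R) \<inter> body S (Q z S) \<subseteq> A y \<inter> A z" if yz: "y \<in> Y" "z \<in> Y" "y \<noteq> z" "R \<in> F' y" "S \<in> F' z" for y z R S
    proof (cases "z \<in> underS |Y| y")
      case True
      thus ?thesis using bb0 yz by blast
    next
      case False
      hence "y \<in> underS |Y| z" using card_of_total[OF yz(1,2)] yz(3) by (auto simp: underS_def)
      thus ?thesis using bb0[OF yz(2,1) _ yz(5,4)] by blast
    qed
    show "body R (Q y R) \<inter> A z \<subseteq> A y" if "y \<in> Y" "z \<in> Y" "R \<in> F' y" for y z R by (rule ba[OF that])
  qed
  show ?thesis
    by (cases "countable Y") (rule countable_cofinality, assumption, rule uncountable_cofinality[OF GCH _ good])
qed

end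

section \<open>Countable degree\<close>

text \<open>
  In the relations below, vertex \<open>i\<close> stands for the \<open>i\<close>-th ray and \<open>geo e i j\<close> says that \<open>j\<close> lies on a geodesic from \<open>i\<close>
  to \<open>0\<close>. Chains of geodesics in either direction, as well as antichains, give paths between consecutive
  members that avoid the remaining members.
\<close>

definition dist0 :: "nat rel \<Rightarrow> nat \<Rightarrow> nat" where
  "dist0 e i = (LEAST n. (i, 0) \<in> e ^^ n)"

definition geo :: "nat rel \<Rightarrow> nat \<Rightarrow> nat \<Rightarrow> bool" where
  "geo e i j \<longleftrightarrow> (\<exists>n. (i, j) \<in> e ^^ n \<and> dist0 e i = n + dist0 e j)"

lemma dist0_relpow: "(i, 0) \<in> e\<^sup>* \<Longrightarrow> (i, 0) \<in> e ^^ dist0 e i"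
  unfolding dist0_def by (rule LeastI_ex) (simp add: rtrancl_is_UN_relpow)

lemma dist0_le: "(i, 0) \<in> e ^^ n \<Longrightarrow> dist0 e i \<le> n"
  unfolding dist0_def by (rule Least_le)

lemma geo_dist0: "geo e i j \<Longrightarrow> dist0 e j \<le> dist0 e i"
  by (auto simp: geo_def)

lemma geo_trans: assumes "geo e i j" "geo e j k" shows "geo e i k"
proof -
  obtain m n where "(i, j) \<in> e ^^ m" "dist0 e i = m + dist0 e j" "(j, k) \<in> e ^^ n" "dist0 e j = n + dist0 e k"
    using assms by (auto simp: geo_def)
  moreover hence "(i, k) \<in> e ^^ (m + n)" by (auto simp: relpow_add)
  ultimately show ?thesis unfolding geo_def by (intro exI[of _ "m + n"]) simp
qed

lemma geo_zero: "(i, 0) \<in> e\<^sup>* \<Longrightarrow> geo e i 0"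
  using dist0_relpow[of i e] dist0_le[of 0 0 e] by (auto simp: geo_def)

text \<open>The vertices of a geodesic between its ends have distances strictly between those of the
  ends. This strictness is what excludes other members of a chain. Reachability of 0 is required
  because otherwise \<open>dist0\<close> is unspecified.\<close>

lemma geo_chain:
  assumes "geo e i j" "(j, 0) \<in> e\<^sup>*"
  shows "(i, j) \<in> (Restr e {l. l = i \<or> l = j \<or> geo e i l \<and> dist0 e j < dist0 e l \<and> dist0 e l < dist0 e i})\<^sup>*"
proof -
  obtain n where "(i, j) \<in> e ^^ n" "dist0 e i = n + dist0 e j" using assms(1) by (auto simp: geo_def)
  thus ?thesis
  proof (induction n arbitrary: i)
    case (Suc n)
    obtain l where l: "(i, l) \<in> e" "(l, j) \<in> e ^^ n" using relpow_Suc_D2[OF Suc.prems(1)] by blast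
    have "(l, 0) \<in> e ^^ (n + dist0 e j)" using l(2) dist0_relpow[OF assms(2)] by (auto simp: relpow_add)
    note l0 = this
    have "dist0 e l \<le> n + dist0 e j" by (rule dist0_le[OF l0])
    moreover have "(l, 0) \<in> e\<^sup>*" using l0 by (auto simp: rtrancl_is_UN_relpow)
    hence "(i, 0) \<in> e ^^ Suc (dist0 e l)" using relpow_Suc_I2[OF l(1) dist0_relpow] by blast
    hence "dist0 e i \<le> Suc (dist0 e l)" by (rule dist0_le)
    ultimately have dl: "dist0 e l = n + dist0 e j" "dist0 e i = Suc (dist0 e l)" using Suc.prems(2) by auto
    have gil: "geo e i l" unfolding geo_def using l(1) dl by (intro exI[of _ 1]) auto
    let ?S = "\<lambda>i. {l. l = i \<or> l = j \<or> geo e i l \<and> dist0 e j < dist0 e l \<and> dist0 e l < dist0 e i}"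
    have lS: "l \<in> ?S i"
    proof (cases n)
      case 0
      thus ?thesis using l(2) by simp
    qed (use gil dl in simp)
    have "?S l \<subseteq> ?S i" using lS gil dl geo_trans[OF gil] by auto
    hence "Restr e (?S l) \<subseteq> Restr e (?S i)" by blast
    hence "(l, j) \<in> (Restr e (?S i))\<^sup>*" using Suc.IH[OF l(2) dl(1)] rtrancl_mono by blast
    moreover have "(i, l) \<in> Restr e (?S i)" using l(1) lS by blast
    ultimately show ?case by (rule converse_rtrancl_into_rtrancl[rotated])
  qed simp
qed

section \<open>Ladders of finite connected sets across infinitely many rays\<close>

context ugraph
begin

text \<open>Rays and rungs are chosen alternately: \<open>H n\<close> connects the earlier rays, and
  \<open>R n\<close> is then chosen off all rungs built so far. Each rung meets each of its rays in
  one segment, so that inside the rung a ray behaves like a single node.\<close>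

lemma ladder_exists:
  assumes inf: "infinite \<R>" and rays: "\<forall>R\<in>\<R>. is_ray V E R" and eqvs: "\<forall>R\<in>\<R>. \<forall>S\<in>\<R>. eqv R S"
    and dis: "disjoint_rays \<R>"
  shows "\<exists>(R :: nat \<Rightarrow> nat \<Rightarrow> 'v) (H :: nat \<Rightarrow> 'v set). (\<forall>n. R n \<in> \<R> \<and> H n \<subseteq> V \<and> finite (H n)) \<and> (\<forall>m n. m < n \<longrightarrow> R m \<noteq> R n \<and> H m \<inter> H n = {}) \<and>
     (\<forall>m n. m \<le> n \<longrightarrow> range (R n) \<inter> H m = {}) \<and>
     (\<forall>n. \<forall>i<n. \<exists>a b. a \<le> b \<and> H n \<inter> range (R i) = R i ` {a..b}) \<and>
     (\<forall>n. \<forall>i<n. \<forall>x\<in>H n \<inter> range (R i). \<forall>y\<in>H n \<inter> range (R 0). conn E (H n) x y)"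
proof -
  have ray: "is_ray V E R" if "R \<in> \<R>" for R using rays that by blast
  have eq: "eqv R S" if "R \<in> \<R>" "S \<in> \<R>" for R S using eqvs that by blast
  define P where "P f n x \<longleftrightarrow> fst x \<in> \<R> \<and> snd x \<subseteq> V \<and> finite (snd x) \<and>
      (\<forall>m<n. fst x \<noteq> fst (f m) \<and> range (fst x) \<inter> snd (f m) = {} \<and> snd (f m) \<inter> snd x = {}) \<and> range (fst x) \<inter> snd x = {} \<and>
      (\<forall>i<n. \<exists>a b. a \<le> b \<and> snd x \<inter> range (fst (f i)) = fst (f i) ` {a..b}) \<and>
      (\<forall>i<n. \<forall>u\<in>snd x \<inter> range (fst (f i)). \<forall>v\<in>snd x \<inter> range (fst (f 0)). conn E (snd x) u v)"
    for f :: "nat \<Rightarrow> (nat \<Rightarrow> 'v) \<times> 'v set" and n x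
  have "\<exists>f. \<forall>n. P f n (f n)"
  proof (rule dependent_wf_choice)
    show "wf less_than" by simp
    show "P f n r = P g n r" if fg: "\<And>z. (z, n) \<in> less_than \<Longrightarrow> f z = g z" for f g n r
    proof (cases n)
      case (Suc m)
      have "f i = g i" if "i < n" for i using fg that by simp
      moreover have "f 0 = g 0" using fg Suc by simp
      ultimately show ?thesis unfolding P_def by auto
    qed (simp add: P_def)
    fix n f assume IH: "\<And>y. (y, n) \<in> less_than \<Longrightarrow> P f y (f y)"
    define R where "R i = fst (f i)" for i
    define X where "X = (\<Union>m<n. snd (f m))"
    have IH': "P f i (f i)" if "i < n" for i using IH that by simp
    have R: "R i \<in> \<R>" if "i < n" for i using IH'[OF that] by (simp add: P_def R_def)
    have Rd: "range (R i) \<inter> range (R j) = {}" if "i < n" "j < n" "i \<noteq> j" for i j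
    proof -
      have "R i \<noteq> R j" using IH'[OF that(1)] IH'[OF that(2)] that(3) unfolding P_def R_def by (metis nat_neq_iff)
      thus ?thesis using dis R that unfolding disjoint_rays_def by blast
    qed
    have fX: "finite X" using IH' by (auto simp: X_def P_def)
    have "\<exists>H. H \<subseteq> V \<and> finite H \<and> H \<inter> X = {} \<and> (\<forall>i<n. \<exists>a b. a \<le> b \<and> H \<inter> range (R i) = R i ` {a..b}) \<and>
      (\<forall>i<n. \<forall>u\<in>H \<inter> range (R i). \<forall>v\<in>H \<inter> range (R 0). conn E H u v)"
    proof (cases "n = 0")
      case True
      \<comment> \<open>The rung of index 0 has no rays to connect and is empty.\<close>
      thus ?thesis by (intro exI[of _ "{}"]) simp
    next
      case False
      have "\<exists>N. \<forall>j\<ge>N. R i j \<notin> X" if "i < n" for i by (rule ray_tail_avoids[OF ray[OF R[OF that]] fX])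
      then obtain Nf where Nf: "\<And>i j. i < n \<Longrightarrow> j \<ge> Nf i \<Longrightarrow> R i j \<notin> X" by metis
      define N where "N = Max (Nf ` {..<n})"
      have N: "R i j \<notin> X" if "i < n" "j \<ge> N" for i j
      proof -
        have "Nf i \<le> N" unfolding N_def using that by (intro Max_ge) auto
        thus ?thesis using Nf that by simp
      qed
      \<comment> \<open>Removing the initial segments as well keeps the connecting paths at indices
        at least \<open>N\<close>, beyond which the rays avoid the earlier rungs.\<close>
      define X' where "X' = X \<union> (\<Union>i<n. R i ` {..<N})"
      have fX': "finite X'" using fX by (simp add: X'_def)
      have "\<exists>p a b. is_path (V - X') E p \<and> R 0 a \<in> set p \<and> R i b \<in> set p" if i: "i < n" for i
      proof -
        obtain M where "\<forall>a\<ge>M. \<forall>b\<ge>M. conn E (V - X') (R 0 a) (R i b)"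
          using eq[OF R R[OF i], of 0] False fX' unfolding eqv_def by blast
        hence "conn E (V - X') (R 0 M) (R i M)" by blast
        then obtain p where p: "is_path (V - X') E p" "hd p = R 0 M" "last p = R i M" using conn_path by metis
        hence "R 0 M \<in> set p" "R i M \<in> set p" unfolding is_path_def by (metis hd_in_set, metis last_in_set)
        thus ?thesis using p(1) by blast
      qed
      then obtain p a b where p: "\<And>i. i < n \<Longrightarrow> is_path (V - X') E (p i)" "\<And>i. i < n \<Longrightarrow> R 0 (a i) \<in> set (p i)"
        "\<And>i. i < n \<Longrightarrow> R i (b i) \<in> set (p i)" by metis
      define H0 where "H0 = (\<Union>i<n. set (p i))"
      have H0: "finite H0" "H0 \<subseteq> V - X'" using p(1) by (auto simp: H0_def is_path_def)
      have "\<exists>M. \<forall>j\<ge>M. R i j \<notin> H0" if "i < n" for i by (rule ray_tail_avoids[OF ray[OF R[OF that]] H0(1)])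
      then obtain Mf where Mf: "\<And>i j. i < n \<Longrightarrow> j \<ge> Mf i \<Longrightarrow> R i j \<notin> H0" by metis
      define M where "M = Max (insert N (Mf ` {..<n}))"
      have NM: "N \<le> M" unfolding M_def by simp
      have M: "j \<le> M" if "i < n" "R i j \<in> H0" for i j
      proof -
        have "Mf i \<le> M" unfolding M_def using that by (intro Max_ge) auto
        moreover have "j < Mf i" using Mf[of i j] that by (meson not_le)
        ultimately show ?thesis by simp
      qed
      have M': "N \<le> j" if "i < n" "R i j \<in> H0" for i j
      proof (rule ccontr)
        assume "\<not> N \<le> j"
        hence "R i j \<in> R i ` {..<N}" by simp
        hence "R i j \<in> X'" using that(1) unfolding X'_def by blast
        thus False using H0(2) that(2) by blast
      qed
      \<comment> \<open>All intersections of the paths with the rays occur at indices from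
        \<open>N\<close> to \<open>M\<close>; adding these stretches makes every intersection
        exactly one segment.\<close>
      define H where "H = H0 \<union> (\<Union>i<n. R i ` {N..M})"
      have Hi: "H \<inter> range (R i) = R i ` {N..M}" if i: "i < n" for i
      proof
        show "R i ` {N..M} \<subseteq> H \<inter> range (R i)" using i by (auto simp: H_def)
        show "H \<inter> range (R i) \<subseteq> R i ` {N..M}"
        proof
          fix x assume x: "x \<in> H \<inter> range (R i)"
          then obtain j where j: "x = R i j" by blast
          show "x \<in> R i ` {N..M}"
          proof (cases "x \<in> H0")
            case True
            hence "N \<le> j" "j \<le> M" using M[OF i] M'[OF i] j by auto
            thus ?thesis using j by auto
          next
            case False
            then obtain k where k: "k < n" "x \<in> R k ` {N..M}" using x by (auto simp: H_def)
            have "x \<in> range (R i) \<inter> range (R k)" using x k by auto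
            hence "k = i" using Rd[OF i k(1)] by blast
            thus ?thesis using k by simp
          qed
        qed
      qed
      have "H \<subseteq> V" using H0(2) ray_in_V[OF ray[OF R]] by (auto simp: H_def)
      moreover have "finite H" using H0(1) by (simp add: H_def)
      moreover have "H \<inter> X = {}" using H0(2) N by (fastforce simp: H_def X'_def)
      moreover have "\<exists>a b. a \<le> b \<and> H \<inter> range (R i) = R i ` {a..b}" if "i < n" for i using Hi[OF that] NM by blast
      moreover have "conn E H u v" if i: "i < n" and u: "u \<in> H \<inter> range (R i)" and v: "v \<in> H \<inter> range (R 0)" for i u v
      proof -
        have seg: "conn E H (R k j) (R k l)" if "k < n" "R k j \<in> H" "R k l \<in> H" for k j l
        proof (rule conn_ray[OF ray[OF R[OF that(1)]]])
          have "R k j \<in> R k ` {N..M}" "R k l \<in> R k ` {N..M}" using Hi[OF that(1)] that by auto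
          moreover have "inj (R k)" using ray[OF R[OF that(1)]] by (simp add: is_ray_def)
          ultimately have "j \<in> {N..M}" "l \<in> {N..M}" by (auto simp: inj_image_mem_iff)
          hence "{min j l..max j l} \<subseteq> {N..M}" by auto
          hence "R k ` {min j l..max j l} \<subseteq> R k ` {N..M}" by (rule image_mono)
          also have "\<dots> \<subseteq> H" using that(1) unfolding H_def by blast
          finally show "R k ` {min j l..max j l} \<subseteq> H" .
        qed
        have n0: "0 < n" using False by simp
        have pH: "set (p i) \<subseteq> H" using i by (auto simp: H_def H0_def)
        obtain j l where jl: "u = R i j" "v = R 0 l" using u v by blast
        have "R i j \<in> H" "R 0 l \<in> H" "R i (b i) \<in> H" "R 0 (a i) \<in> H" using u v jl p(2,3)[OF i] pH by auto
        hence "conn E H (R i j) (R i (b i))" "conn E H (R 0 (a i)) (R 0 l)" by (auto intro: seg[OF i] seg[OF n0])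
        moreover have "conn E H (R i (b i)) (R 0 (a i))" by (rule path_conn[OF p(1,3,2)[OF i] pH])
        ultimately show ?thesis using jl conn_trans by metis
      qed
      ultimately show ?thesis by (intro exI[of _ H]) blast
    qed
    then obtain H where H: "H \<subseteq> V" "finite H" "H \<inter> X = {}" "\<forall>i<n. \<exists>a b. a \<le> b \<and> H \<inter> range (R i) = R i ` {a..b}"
      "\<forall>i<n. \<forall>u\<in>H \<inter> range (R i). \<forall>v\<in>H \<inter> range (R 0). conn E H u v" by (elim exE conjE) (rule that)
    have "\<exists>r\<in>\<R> - R ` {..<n}. range r \<inter> (X \<union> H) = {}"
    proof (rule infinite_bodies_avoid)
      show "infinite (\<R> - R ` {..<n})" using inf by simp
      show "finite (X \<union> H)" using fX H(2) by simp
      show "\<And>R' S. R' \<in> \<R> - R ` {..<n} \<Longrightarrow> S \<in> \<R> - R ` {..<n} \<Longrightarrow> R' \<noteq> S \<Longrightarrow> range R' \<inter> range S = {}"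
        using dis unfolding disjoint_rays_def by blast
    qed
    then obtain r where r: "r \<in> \<R>" "r \<notin> R ` {..<n}" "range r \<inter> (X \<union> H) = {}" by blast
    have "r \<noteq> fst (f m) \<and> range r \<inter> snd (f m) = {} \<and> snd (f m) \<inter> H = {}" if "m < n" for m
    proof -
      have "snd (f m) \<subseteq> X" using that by (auto simp: X_def)
      moreover have "r \<noteq> R m" using r(2) that by blast
      ultimately show ?thesis using r(3) H(3) unfolding R_def by blast
    qed
    moreover have "range r \<inter> H = {}" using r(3) by blast
    ultimately have "P f n (r, H)" unfolding P_def using r(1) H(1,2,4,5) unfolding R_def by simp
    thus "\<exists>r. P f n r" by blast
  qed
  then obtain f where f: "\<And>n. P f n (f n)" by blast
  have f1: "fst (f n) \<in> \<R> \<and> snd (f n) \<subseteq> V \<and> finite (snd (f n))" for n using f[of n] unfolding P_def by simp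
  have f2: "range (fst (f n)) \<inter> snd (f m) = {}" if "m \<le> n" for m n
    using f[of n] that unfolding P_def by (cases "m = n") auto
  have f3: "fst (f m) \<noteq> fst (f n) \<and> snd (f m) \<inter> snd (f n) = {}" if "m < n" for m n
    using f[of n] that unfolding P_def by metis
  have f4: "\<exists>a b. a \<le> b \<and> snd (f n) \<inter> range (fst (f i)) = fst (f i) ` {a..b}" if "i < n" for n i
    using f[of n] that unfolding P_def by simp
  have f5: "conn E (snd (f n)) x y" if "i < n" "x \<in> snd (f n) \<inter> range (fst (f i))" "y \<in> snd (f n) \<inter> range (fst (f 0))" for n i x y
    using f[of n] that unfolding P_def by blast
  show ?thesis
    by (rule exI[of _ "\<lambda>n. fst (f n)"], rule exI[of _ "\<lambda>n. snd (f n)"], intro conjI allI impI ballI)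
      (use f1 f2 f3 f4 f5 in simp_all)
qed

text \<open>For each rung, the graph \<open>e k\<close> records which of the first \<open>k\<close>
  rays are joined inside \<open>H k\<close> without touching the others. Triples are coloured by the
  geodesic relation of their two smaller members in the graph of the largest. In a homogeneous set,
  consecutive rays can be joined in every later rung past all other selected rays, so the ray graph
  is a one-way infinite path.\<close>

lemma countable_case:
  assumes inf: "infinite \<R>" and ray: "\<And>R. R \<in> \<R> \<Longrightarrow> is_ray V E R" and eq: "\<And>R S. R \<in> \<R> \<Longrightarrow> S \<in> \<R> \<Longrightarrow> eqv R S"
    and dis: "disjoint_rays \<R>"
  shows "\<exists>\<S>\<subseteq>\<R>. infinite \<S> \<and> admits_connected_ray_graph V E \<S>"
proof -
  have rays: "\<forall>R\<in>\<R>. is_ray V E R" and eqvs: "\<forall>R\<in>\<R>. \<forall>S\<in>\<R>. eqv R S" using ray eq by blast+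
  obtain R :: "nat \<Rightarrow> nat \<Rightarrow> 'v" and H :: "nat \<Rightarrow> 'v set" where R: "\<forall>n. R n \<in> \<R> \<and> H n \<subseteq> V \<and> finite (H n)"
    and RH1: "\<forall>m n. m < n \<longrightarrow> R m \<noteq> R n \<and> H m \<inter> H n = {}"
    and RH2: "\<forall>m n. m \<le> n \<longrightarrow> range (R n) \<inter> H m = {}"
    and seg: "\<forall>n. \<forall>i<n. \<exists>a b. a \<le> b \<and> H n \<inter> range (R i) = R i ` {a..b}"
    and Hc: "\<forall>n. \<forall>i<n. \<forall>x\<in>H n \<inter> range (R i). \<forall>y\<in>H n \<inter> range (R 0). conn E (H n) x y"
    using ladder_exists[OF inf rays eqvs dis] by (elim exE conjE) (rule that)
  have Rr: "is_ray V E (R n)" for n using R ray by blast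
  have injR: "inj R" by (rule injI, rule ccontr) (use RH1 in \<open>metis nat_neq_iff\<close>)
  have Rd: "range (R i) \<inter> range (R j) = {}" if "i \<noteq> j" for i j
    using dis R injR that unfolding disjoint_rays_def inj_def by blast
  \<comment> \<open>The rung with all of the first \<open>k\<close> rays deleted except those
    indexed by \<open>S\<close>.\<close>
  define U where "U k S = H k - (\<Union>l\<in>{..<k} - S. range (R l))" for k S
  define e where "e k = {(i, j). i < k \<and> j < k \<and> (\<exists>x\<in>H k \<inter> range (R i). \<exists>y\<in>H k \<inter> range (R j). conn E (U k {i, j}) x y)}" for k
  have Hne: "H k \<inter> range (R i) \<noteq> {}" if "i < k" for i k using seg that by fastforce
  have inU: "H k \<inter> range (R i) \<subseteq> U k S" if "i \<in> S" for i k S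
  proof
    fix x assume x: "x \<in> H k \<inter> range (R i)"
    have "x \<notin> range (R l)" if "l \<in> {..<k} - S" for l using x Rd[of i l] that \<open>i \<in> S\<close> by blast
    thus "x \<in> U k S" using x unfolding U_def by blast
  qed
  have segc: "conn E (U k S) x y" if sc: "i < k" "i \<in> S" "x \<in> H k \<inter> range (R i)" "y \<in> H k \<inter> range (R i)" for i k S x y
  proof -
    have "\<exists>a b. a \<le> b \<and> H k \<inter> range (R i) = R i ` {a..b}" using seg sc(1) by blast
    then obtain a b where ab: "H k \<inter> range (R i) = R i ` {a..b}" by blast
    obtain j l where jl: "x = R i j" "j \<in> {a..b}" "y = R i l" "l \<in> {a..b}" using sc(3,4) unfolding ab by blast
    have "R i ` {min j l..max j l} \<subseteq> R i ` {a..b}" using jl by (intro image_mono) auto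
    hence "R i ` {min j l..max j l} \<subseteq> U k S" using inU[OF sc(2), of k] unfolding ab by blast
    thus ?thesis unfolding jl(1,3) by (rule conn_ray[OF Rr])
  qed
  \<comment> \<open>A shortest path in the rung from the rays in the component of 0 to the remaining
    ones touches none of the first \<open>k\<close> rays except at its two ends, so it yields an
    edge leaving the component.\<close>
  have e_conn: "(i, 0) \<in> (e k)\<^sup>*" if i: "i < k" for i k
  proof (rule ccontr)
    assume n: "(i, 0) \<notin> (e k)\<^sup>*"
    define C where "C = {l. l < k \<and> (l, 0) \<in> (e k)\<^sup>*}"
    have k0: "0 < k" using i by simp
    have C0: "0 \<in> C" using k0 by (simp add: C_def)
    let ?A = "\<Union>l\<in>C. range (R l)" and ?B = "\<Union>l\<in>{..<k} - C. range (R l)"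
    obtain x y where x: "x \<in> H k \<inter> range (R i)" and y: "y \<in> H k \<inter> range (R 0)" using Hne[OF i] Hne[OF k0] by blast
    have "conn E (H k) x y" using Hc i x y by blast
    hence c: "conn E (H k) y x" by (rule conn_sym)
    have yA: "y \<in> ?A" using y C0 by blast
    have xB: "x \<in> ?B" using x i n unfolding C_def by blast
    obtain p where p: "is_path (H k) E p" "hd p \<in> ?A" "last p \<in> ?B" "set p \<inter> ?A = {hd p}" "set p \<inter> ?B = {last p}"
      using shortest_path_between[OF c yA xB] by (elim exE conjE) (rule that)
    obtain l m where lm: "l \<in> C" "hd p \<in> range (R l)" "m \<in> {..<k} - C" "last p \<in> range (R m)" using p(2,3) by blast
    have pH: "set p \<subseteq> H k" using p(1) by (simp add: is_path_def)
    have hl: "hd p \<in> set p" "last p \<in> set p" using p(1) by (auto simp: is_path_def)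
    have "set p \<subseteq> U k {m, l}"
    proof
      fix z assume z: "z \<in> set p"
      have "z \<notin> range (R l')" if l': "l' \<in> {..<k} - {m, l}" for l'
      proof
        assume zl: "z \<in> range (R l')"
        show False
        proof (cases "l' \<in> C")
          case True
          hence "z \<in> set p \<inter> ?A" using z zl by blast
          hence "z = hd p" using p(4) by simp
          thus False using zl lm(2) Rd[of l' l] l' by blast
        next
          case False
          hence "z \<in> set p \<inter> ?B" using z zl l' by blast
          hence "z = last p" using p(5) by simp
          thus False using zl lm(4) Rd[of l' m] l' by blast
        qed
      qed
      thus "z \<in> U k {m, l}" using z pH unfolding U_def by blast
    qed
    hence "conn E (U k {m, l}) (last p) (hd p)" using path_conn[OF p(1) hl(2,1)] by blast
    moreover have "l < k" "m < k" using lm(1,3) by (auto simp: C_def)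
    ultimately have "(m, l) \<in> e k" unfolding e_def using lm(2,4) hl pH by blast
    moreover have "(l, 0) \<in> (e k)\<^sup>*" using lm(1) by (simp add: C_def)
    ultimately have "m \<in> C" using \<open>m < k\<close> by (auto simp: C_def)
    thus False using lm(3) by blast
  qed
  \<comment> \<open>The connections for successive edges end at different vertices of a common ray;
    they are linked along the single segment in which the rung meets that ray.\<close>
  have lift: "conn E (U k S) x y"
    if "(i, j) \<in> (Restr (e k) S)\<^sup>*" "i < k" "i \<in> S" "x \<in> H k \<inter> range (R i)" "y \<in> H k \<inter> range (R j)" for k S i j x y
    using that(1,5)
  proof (induction j arbitrary: y rule: rtrancl_induct)
    case base
    thus ?case using segc[OF that(2,3,4)] by blast
  next
    case (step j l)
    have jl: "j \<in> S" "l \<in> S" "j < k" "l < k" using step(2) by (auto simp: e_def)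
    obtain x' y' where xy: "x' \<in> H k \<inter> range (R j)" "y' \<in> H k \<inter> range (R l)" "conn E (U k {j, l}) x' y'"
      using step(2) unfolding e_def by blast
    have "U k {j, l} \<subseteq> U k S" using jl unfolding U_def by blast
    hence "conn E (U k S) x' y'" by (rule conn_mono[OF xy(3)])
    moreover have "conn E (U k S) x x'" by (rule step.IH[OF xy(1)])
    moreover have "conn E (U k S) y' y" by (rule segc[OF jl(4,2) xy(2) step.prems])
    ultimately show ?case using conn_trans by metis
  qed
  define col where "col X = (let k = Max X; i = Min X; j = Max (X - {k}) in
      if geo (e k) i j then 0 else if geo (e k) j i then 1 else (2::nat))" for X
  \<comment> \<open>Index 0 is kept out of \<open>N\<close> because it is the common target of the
    geodesics: paths through ray 0 must not hit a selected ray.\<close>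
  have "\<exists>N t. N \<subseteq> {0<..} \<and> infinite N \<and> t < (3::nat) \<and> (\<forall>X. X \<subseteq> N \<and> finite X \<and> card X = 3 \<longrightarrow> col X = t)"
    by (rule Ramsey) (auto simp: infinite_Ioi col_def Let_def)
  then obtain N t where N: "N \<subseteq> {0<..}" "infinite N" "t < (3::nat)" "\<forall>X. X \<subseteq> N \<and> finite X \<and> card X = 3 \<longrightarrow> col X = t"
    by (elim exE conjE) (rule that)
  have col: "(if geo (e k) i j then 0 else if geo (e k) j i then 1 else 2) = t"
    if "i \<in> N" "j \<in> N" "k \<in> N" "i < j" "j < k" for i j k
  proof -
    have "Max {i, j, k} = k" "Min {i, j, k} = i" using that by auto
    moreover have "{i, j, k} - {k} = {i, j}" using that by auto
    moreover have "Max {i, j} = j" using that by auto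
    moreover have "col {i, j, k} = t" by (rule N(4)[rule_format]) (use that in auto)
    ultimately show ?thesis by (simp add: col_def)
  qed
  define s where "s = enumerate N"
  have smono: "strict_mono s" unfolding s_def using N(2) by (simp add: strict_mono_enumerate)
  have sN: "range s = N" unfolding s_def using N(2) by (simp add: range_enumerate)
  define S where "S n = R (s n)" for n
  have injS: "inj S"
    by (rule injI) (use injR smono in \<open>metis S_def injD strict_mono_eq\<close>)
  have we: "weak_edge (range S) (S n) (S (Suc n))" for n
    unfolding weak_edge_def
  proof (intro allI impI)
    fix X :: "'v set" assume X: "finite X"
    let ?i = "s n" and ?j = "s (Suc n)"
    have ij: "?i < ?j" using smono by (simp add: strict_mono_less)
    have ijN: "?i \<in> N" "?j \<in> N" using sN by blast+
    have gap: "l \<le> ?i \<or> ?j \<le> l" if "l \<in> N" for l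
    proof -
      obtain m where "l = s m" using \<open>l \<in> N\<close> sN by blast
      thus ?thesis using smono by (cases "m \<le> n") (auto simp: strict_mono_less_eq)
    qed
    have "\<exists>k\<in>{k \<in> N. ?j < k}. H k \<inter> X = {}"
    proof (rule infinite_bodies_avoid[OF _ X])
      have "{k \<in> N. ?j < k} = N - {..?j}" by auto
      thus "infinite {k \<in> N. ?j < k}" using N(2) by simp
      show "\<And>k l. k \<in> {k \<in> N. ?j < k} \<Longrightarrow> l \<in> {k \<in> N. ?j < k} \<Longrightarrow> k \<noteq> l \<Longrightarrow> H k \<inter> H l = {}"
        using RH1 by (metis Int_commute nat_neq_iff)
    qed
    then obtain k where k: "k \<in> N" "?j < k" "H k \<inter> X = {}" by blast
    have ik: "?i < k" and k0: "0 < k" using ij k by auto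
    obtain x where x: "x \<in> H k \<inter> range (R ?i)" using Hne[OF ik] by blast
    obtain y where y: "y \<in> H k \<inter> range (R ?j)" using Hne[OF k(2)] by blast
    obtain w where w: "w \<in> H k \<inter> range (R 0)" using Hne[OF k0] by blast
    have "\<exists>T. conn E (U k T) x y \<and> (\<forall>l\<in>N. l < k \<longrightarrow> l \<in> T \<longrightarrow> l = ?i \<or> l = ?j)"
    proof -
      consider "t = 0" | "t = 1" | "t = 2" using N(3) by linarith
      thus ?thesis
      proof cases
        case 1
        have g: "geo (e k) a b" if "a \<in> N" "b \<in> N" "a < b" "b < k" for a b
          by (rule ccontr) (use col[OF that(1,2) k(1) that(3,4)] 1 in \<open>simp split: if_splits\<close>)
        let ?T = "{l. l = ?i \<or> l = ?j \<or> geo (e k) ?i l \<and> dist0 (e k) ?j < dist0 (e k) l \<and> dist0 (e k) l < dist0 (e k) ?i}"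
        have "(?i, ?j) \<in> (Restr (e k) ?T)\<^sup>*" by (rule geo_chain[OF g[OF ijN ij k(2)] e_conn[OF k(2)]])
        hence "conn E (U k ?T) x y" by (rule lift[OF _ ik _ x y]) simp
        \<comment> \<open>Earlier members have \<open>?i\<close> on a geodesic and are at least as
          far from 0 as \<open>?i\<close>; later ones lie on a geodesic from \<open>?j\<close> and
          are at most as far as \<open>?j\<close>. Neither fits strictly between the two
          distances.\<close>
        moreover have "l = ?i \<or> l = ?j" if l: "l \<in> N" "l < k" "l \<in> ?T" for l
        proof (rule ccontr)
          assume ne: "\<not> (l = ?i \<or> l = ?j)"
          hence "l < ?i \<or> ?j < l" using gap[OF l(1)] by auto
          hence "geo (e k) l ?i \<or> geo (e k) ?j l" using g l ijN ik by blast
          thus False using geo_dist0 l(3) ne by fastforce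
        qed
        ultimately show ?thesis by blast
      next
        case 2
        have g: "geo (e k) b a" if "a \<in> N" "b \<in> N" "a < b" "b < k" for a b
          by (rule ccontr) (use col[OF that(1,2) k(1) that(3,4)] 2 in \<open>simp split: if_splits\<close>)
        let ?T = "{l. l = ?j \<or> l = ?i \<or> geo (e k) ?j l \<and> dist0 (e k) ?i < dist0 (e k) l \<and> dist0 (e k) l < dist0 (e k) ?j}"
        have "(?j, ?i) \<in> (Restr (e k) ?T)\<^sup>*" by (rule geo_chain[OF g[OF ijN ij k(2)] e_conn[OF ik]])
        hence "conn E (U k ?T) y x" by (rule lift[OF _ k(2) _ y x]) simp
        moreover have "l = ?i \<or> l = ?j" if l: "l \<in> N" "l < k" "l \<in> ?T" for l
        proof (rule ccontr)
          assume ne: "\<not> (l = ?i \<or> l = ?j)"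
          hence "l < ?i \<or> ?j < l" using gap[OF l(1)] by auto
          hence "geo (e k) ?i l \<or> geo (e k) l ?j" using g l ijN ik by blast
          thus False using geo_dist0 l(3) ne by fastforce
        qed
        ultimately show ?thesis using conn_sym by blast
      next
        case 3
        have g: "\<not> geo (e k) a b" if "a \<in> N" "b \<in> N" "a \<noteq> b" "a < k" "b < k" for a b
        proof (cases "a < b")
          case True
          show ?thesis by (rule notI) (use col[OF that(1,2) k(1) True that(5)] 3 in simp)
        next
          case False
          hence "b < a" using that(3) by simp
          show ?thesis by (rule notI) (use col[OF that(2,1) k(1) \<open>b < a\<close> that(4)] 3 in \<open>simp split: if_splits\<close>)
        qed
        \<comment> \<open>In an antichain the connection runs from both rays down to ray 0; no other
          selected ray lies on these geodesics.\<close>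
        let ?T = "{l. l = ?i \<or> l = ?j \<or> l = 0 \<or> geo (e k) ?i l \<or> geo (e k) ?j l}"
        have to0: "(a, 0) \<in> (Restr (e k) ?T)\<^sup>*" if a: "a = ?i \<or> a = ?j" for a
        proof -
          have ak: "a < k" using a ik k(2) by auto
          let ?T' = "{l. l = a \<or> l = 0 \<or> geo (e k) a l \<and> dist0 (e k) 0 < dist0 (e k) l \<and> dist0 (e k) l < dist0 (e k) a}"
          have "(a, 0) \<in> (Restr (e k) ?T')\<^sup>*" by (rule geo_chain[OF geo_zero[OF e_conn[OF ak]]]) simp
          moreover have "Restr (e k) ?T' \<subseteq> Restr (e k) ?T" using a by auto
          ultimately show ?thesis using rtrancl_mono by blast
        qed
        have "conn E (U k ?T) x w" by (rule lift[OF to0 ik _ x w]) simp_all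
        moreover have "conn E (U k ?T) y w" by (rule lift[OF to0 k(2) _ y w]) simp_all
        ultimately have "conn E (U k ?T) x y" using conn_sym conn_trans by meson
        moreover have "l = ?i \<or> l = ?j" if l: "l \<in> N" "l < k" "l \<in> ?T" for l
        proof (rule ccontr)
          assume ne: "\<not> (l = ?i \<or> l = ?j)"
          moreover have "l \<noteq> 0" using l(1) N(1) by auto
          ultimately have "geo (e k) ?i l \<or> geo (e k) ?j l" using l(3) by blast
          thus False using g[OF ijN(1) l(1) _ ik l(2)] g[OF ijN(2) l(1) _ k(2) l(2)] ne by blast
        qed
        ultimately show ?thesis by blast
      qed
    qed
    then obtain T where T: "conn E (U k T) x y" "\<And>l. l \<in> N \<Longrightarrow> l < k \<Longrightarrow> l \<in> T \<Longrightarrow> l = ?i \<or> l = ?j" by blast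
    have xy: "x \<in> range (S n)" "y \<in> range (S (Suc n))" using x y by (auto simp: S_def)
    obtain p where p: "is_path (U k T) E p" "hd p \<in> range (S n)" "last p \<in> range (S (Suc n))"
      "set p \<inter> range (S n) = {hd p}" "set p \<inter> range (S (Suc n)) = {last p}"
      using shortest_path_between[OF T(1) xy] by (elim exE conjE) (rule that)
    have pU: "set p \<subseteq> U k T" using p(1) by (simp add: is_path_def)
    have UH: "U k T \<subseteq> H k" by (auto simp: U_def)
    \<comment> \<open>Selected rays of index below \<open>k\<close> are deleted in
      \<open>U k T\<close>; those of index at least \<open>k\<close> miss the rung
      altogether.\<close>
    have other: "set p \<inter> range (S m) = {}" if m: "m \<noteq> n" "m \<noteq> Suc n" for m
    proof -
      have mN: "s m \<in> N" using sN by blast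
      have ne: "s m \<noteq> ?i" "s m \<noteq> ?j" using m smono by (simp_all add: strict_mono_eq)
      show ?thesis
      proof (cases "s m < k")
        case True
        hence "s m \<notin> T" using T(2)[OF mN] ne by blast
        thus ?thesis using pU True unfolding U_def S_def by blast
      next
        case False
        hence "range (S m) \<inter> H k = {}" using RH2 unfolding S_def by (meson not_le)
        thus ?thesis using pU UH by blast
      qed
    qed
    have "(\<Union>R\<in>range S. range R) = (\<Union>m. range (S m))" by blast
    moreover have "set p \<inter> (\<Union>m. range (S m)) = (set p \<inter> range (S n)) \<union> (set p \<inter> range (S (Suc n)))"
    proof (intro equalityI subsetI)
      fix z assume "z \<in> set p \<inter> (\<Union>m. range (S m))"
      then obtain m where m: "z \<in> set p" "z \<in> range (S m)" by blast
      hence "m = n \<or> m = Suc n" using other[of m] by blast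
      thus "z \<in> (set p \<inter> range (S n)) \<union> (set p \<inter> range (S (Suc n)))" using m by blast
    qed blast
    ultimately have "set p \<inter> (\<Union>R\<in>range S. range R) = {hd p, last p}" unfolding p(4,5) by (simp add: insert_commute)
    moreover have "hd p \<noteq> last p"
    proof -
      have "range (S n) \<inter> range (S (Suc n)) = {}" unfolding S_def by (rule Rd) (use ij in simp)
      thus ?thesis using p(2,3) by (metis disjoint_iff)
    qed
    moreover have "is_path V E p" by (rule is_path_mono[OF p(1)]) (use UH R in blast)
    ultimately have "is_R_path V E (range S) p" by (simp add: is_R_path_def)
    moreover have "path_between (range (S n)) (range (S (Suc n))) p" using p(2,3) by (simp add: path_between_def)
    moreover have "set p \<inter> X = {}" using pU UH k(3) by blast
    ultimately show "\<exists>p. is_R_path V E (range S) p \<and> path_between (range (S n)) (range (S (Suc n))) p \<and> set p \<inter> X = {}" by blast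
  qed
  let ?F = "range (\<lambda>n. (S n, S (Suc n)))"
  have "admits_connected_ray_graph V E (range S)"
  proof (rule admits_countable[of ?F])
    show "?F \<subseteq> range S \<times> range S" by auto
    show "(R, R) \<notin> ?F" for R
    proof
      assume "(R, R) \<in> ?F"
      then obtain n where "S n = S (Suc n)" by auto
      thus False using injD[OF injS] by fastforce
    qed
    show "countable ?F" by simp
    show "weak_edge (range S) R R'" if "(R, R') \<in> ?F" for R R' using that we by auto
    fix T T' assume T: "T \<in> range S" "T' \<in> range S"
    define F where "F = ?F \<union> ?F\<inverse>"
    have F: "(S n, S (Suc n)) \<in> F" "(S (Suc n), S n) \<in> F" for n unfolding F_def by auto
    have star: "(S 0, S n) \<in> F\<^sup>* \<and> (S n, S 0) \<in> F\<^sup>*" for n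
    proof (induction n)
      case (Suc n)
      thus ?case using rtrancl_into_rtrancl[OF _ F(1)[of n]] converse_rtrancl_into_rtrancl[OF F(2)[of n]] by simp
    qed simp
    obtain m n where mn: "T = S m" "T' = S n" using T by (elim rangeE)
    have "(S m, S n) \<in> F\<^sup>*" using star[of m] star[of n] rtrancl_trans by metis
    thus "(T, T') \<in> (?F \<union> ?F\<inverse>)\<^sup>*" unfolding mn F_def .
  qed
  moreover have "range S \<subseteq> \<R>" using R by (auto simp: S_def)
  moreover have "infinite (range S)" using injS by (rule range_inj_infinite)
  ultimately show ?thesis by blast
qed

end

theorem theorem5p4:
  fixes V :: "'v set" and E :: "'v \<Rightarrow> 'v \<Rightarrow> bool"
    and \<epsilon> \<R>0 :: "(nat \<Rightarrow> 'v) set"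
  assumes GCH: "GCH_type TYPE((nat \<Rightarrow> 'v) set)"
    and G: "graph V E"
    and end_eps: "is_end V E \<epsilon>"
    and deg: "end_degree_witness \<epsilon> \<R>0"
    and cf: "\<not> (\<exists>(X :: (nat \<Rightarrow> 'v) set) (Y :: (nat \<Rightarrow> 'v) set).
               has_cf (card_of X) natLeq \<and> has_cf (card_of \<R>0) (card_of Y) \<and>
               (card_of Y, cardSuc (card_of X)) \<in> ordIso)"
  shows "\<exists>\<R>. \<R> \<subseteq> \<epsilon> \<and> disjoint_rays \<R> \<and> (card_of \<R>, card_of \<R>0) \<in> ordIso \<and>
             admits_connected_ray_graph V E \<R>"
proof -
  interpret ugraph V E by standard (rule G)
  have R0: "\<R>0 \<subseteq> \<epsilon>" "disjoint_rays \<R>0"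
    and mx: "\<And>\<S>. \<S> \<subseteq> \<epsilon> \<Longrightarrow> disjoint_rays \<S> \<Longrightarrow> |\<S>| \<le>o |\<R>0|"
    using deg unfolding end_degree_witness_def by blast+
  have ray: "is_ray V E R" if "R \<in> \<R>0" for R using end_is_ray[OF end_eps] R0(1) that by blast
  have eq: "eqv R S" if "R \<in> \<R>0" "S \<in> \<R>0" for R S using end_eqv[OF end_eps] R0(1) that by blast
  \<comment> \<open>Only a lower bound on the size has to be produced; the upper bound is the
    maximality of \<open>\<R>0\<close>.\<close>
  have "\<exists>\<R>\<subseteq>\<epsilon>. disjoint_rays \<R> \<and> |\<R>0| \<le>o |\<R>| \<and> admits_connected_ray_graph V E \<R>"
  proof (cases "finite \<R>0")
    case True
    have "admits_connected_ray_graph V E \<R>0" by (rule admits_finite[OF True R0(2) ray eq])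
    thus ?thesis using R0 card_of_mono1[OF subset_refl] by blast
  next
    case inf: False
    show ?thesis
    proof (cases "countable \<R>0")
      case True
      obtain \<S> where S: "\<S> \<subseteq> \<R>0" "infinite \<S>" "admits_connected_ray_graph V E \<S>"
        using countable_case[OF inf ray eq R0(2)] by blast
      have "|\<R>0| \<le>o natLeq" using True by (simp add: countable_card_le_natLeq)
      moreover have "natLeq \<le>o |\<S>|" using S(2) infinite_iff_natLeq_ordLeq by blast
      ultimately have "|\<R>0| \<le>o |\<S>|" by (rule ordLeq_transitive)
      moreover have "disjoint_rays \<S>" using S(1) R0(2) unfolding disjoint_rays_def by blast
      moreover have "\<S> \<subseteq> \<epsilon>" using S(1) R0(1) by blast
      ultimately show ?thesis using S(3) by blast
    next
      case unc: False
      \<comment> \<open>The cofinality is represented by a set of rays of the end, so it can be used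
        both as an index set and as a family of rays.\<close>
      obtain Y where Y: "min_cofinal \<R>0 Y" using min_cofinal_exists by blast
      have YR: "Y \<subseteq> \<R>0" by (rule min_cofinal_subset[OF Y])
      have good: "not_suc_cf_omega Y"
        unfolding not_suc_cf_omega_def using cf min_cofinal_has_cf[OF Y] by blast
      show ?thesis
      proof (cases "|Y| <o |\<R>0|")
        case True
        show ?thesis by (rule singular_case[OF GCH end_eps R0 inf Y True good])
      next
        case False
        hence le: "|\<R>0| \<le>o |Y|" using card_of_ordLess_or_ordLeq by blast
        \<comment> \<open>In the regular case \<open>Y\<close> is as large as \<open>\<R>0\<close>,
          so the argument is run on \<open>Y\<close>, whose regularity and non-exceptional size are
          at hand.\<close>
        have "\<exists>\<S>\<subseteq>\<epsilon>. disjoint_rays \<S> \<and> |Y| \<le>o |\<S>| \<and> admits_connected_ray_graph V E \<S>"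
        proof (rule regular_case[OF GCH end_eps])
          show "Y \<subseteq> \<epsilon>" using YR R0(1) by blast
          show "disjoint_rays Y" using YR R0(2) unfolding disjoint_rays_def by blast
          show "stable |Y|" by (rule min_cofinal_stable[OF Y inf])
          show "\<not> countable Y" by (rule uncountable_ordLeq[OF unc le])
        qed (rule good)
        thus ?thesis using le ordLeq_transitive by blast
      qed
    qed
  qed
  then obtain \<R> where R: "\<R> \<subseteq> \<epsilon>" "disjoint_rays \<R>" "|\<R>0| \<le>o |\<R>|" "admits_connected_ray_graph V E \<R>" by blast
  have "|\<R>| =o |\<R>0|" using mx[OF R(1,2)] R(3) ordIso_iff_ordLeq by blast
  thus ?thesis using R by blast
qed

end
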